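(* Let $K$ be an infinite field, let $(M,\prec)$ be an ordered simple matroid of rank $r$ on $[n]$, and let $\mathcal{I}_\prec(M)\subset S=K[x_1,\ldots,x_n]$ be the Stanley-Reisner ideal of the broken circuit complex of $M$. Then the following conditions are equivalent: (i) $\mathcal{I}_\prec(M)$ has a $p$-linear resolution; (ii) $2\leq p\leq r$ and $M$ is isomorphic to $U_{p,n-r+p}\oplus U_{r-p,r-p}$.
   Context: Here $p$ denotes an integer and $[n]=\{1,\ldots,n\}$. A circuit of a matroid is a minimal dependent set; a matroid is simple if every circuit has at least 3 elements; $\mathfrak{C}(M)$ is the set of circuits of $M$. The rank of $M$ is the common cardinality of its maximal independent sets. An ordered matroid $(M,\prec)$ on $[n]$ is a matroid $M$ on $[n]$ with a linear ordering $\prec$ of $[n]$ (not necessarily the usual one). For a circuit $C$, $\min_\prec(C)$ is its $\prec$-smallest element and $bc_\prec(C)=C-\{\min_\prec(C)\}$ is called a broken circuit. The broken circuit complex $BC_\prec(M)$ is the simplicial complex of all subsets of $[n]$ containing no broken circuit. Its Stanley-Reisner ideal $\mathcal{I}_\prec(M)\subset S=K[x_1,\ldots,x_n]$ is generated by the monomials $x_{bc_\prec(C)}=\prod_{i\in bc_\prec(C)}x_i$, $C\in\mathfrak{C}(M)$. $U_{m,k}$ (with $0\le m\leq k$) denotes the uniform matroid on a $k$-element set, whose independent sets are the subsets of cardinality at most $m$. The direct sum $M_1\oplus M_2$ of matroids on disjoint ground sets is the matroid on the union of the ground sets whose circuits are exactly the circuits of $M_1$ and those of $M_2$. $S$ is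 standard graded. A finitely generated graded $S$-module $W$ has a $p$-linear resolution if its graded minimal free resolution has the form $0\to S(-p-m)^{\beta_m}\to\cdots\to S(-p-1)^{\beta_1}\to S(-p)^{\beta_0}\to W\to 0$.
   Formalization: If M has no circuit, the ideal is zero and its zero resolution is p-linear for every integer p, so the equivalence fails for p outside [2,r]; the formal theorem assumes 2 ≤ p ≤ r in that case only (M without circuits). *)

theory Defs
  imports "HOL-Algebra.Ideal" "HOL-Algebra.Module" "HOL-Library.Poly_Mapping"
begin

section \<open>Matroids\<close>

record 'a set_system =
  ground :: "'a set"
  indeps :: "'a set set"

locale matroid =
  fixes M :: "'a set_system"
  assumes finite_ground: "finite (ground M)"
    and indeps_subset: "X \<in> indeps M \<Longrightarrow> X \<subseteq> ground M"
    and empty_indep: "{} \<in> indeps M"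
    and indep_mono: "X \<in> indeps M \<Longrightarrow> Y \<subseteq> X \<Longrightarrow> Y \<in> indeps M"
    and augment: "X \<in> indeps M \<Longrightarrow> Y \<in> indeps M \<Longrightarrow> card X < card Y \<Longrightarrow>
                    \<exists>y\<in>Y - X. insert y X \<in> indeps M"

definition circuits :: "'a set_system \<Rightarrow> 'a set set" where
  "circuits M = {C. C \<subseteq> ground M \<and> C \<notin> indeps M \<and> (\<forall>D. D \<subset> C \<longrightarrow> D \<in> indeps M)}"

definition bases :: "'a set_system \<Rightarrow> 'a set set" where
  "bases M = {B \<in> indeps M. \<forall>X\<in>indeps M. B \<subseteq> X \<longrightarrow> X = B}"

definition matroid_rank :: "'a set_system \<Rightarrow> nat" where
  "matroid_rank M = (THE r. \<forall>B\<in>bases M. card B = r)"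

definition simple_matroid :: "'a set_system \<Rightarrow> bool" where
  "simple_matroid M \<longleftrightarrow> matroid M \<and> (\<forall>C\<in>circuits M. 3 \<le> card C)"

text \<open>The matroid \<open>U\<^sub>m\<^sub>,\<^sub>k\<close>, for a finite set \<open>A\<close> with \<open>k\<close> elements.\<close>

definition uniform_matroid :: "nat \<Rightarrow> 'a set \<Rightarrow> 'a set_system" where
  "uniform_matroid m A = \<lparr>ground = A, indeps = {X. X \<subseteq> A \<and> card X \<le> m}\<rparr>"

text \<open>The direct sum (for disjoint ground sets) is determined by its circuits, which are
  those of the two summands; see \<open>circuits_direct_sum\<close>.\<close>

definition direct_sum :: "'a set_system \<Rightarrow> 'a set_system \<Rightarrow> 'a set_system" where
  "direct_sum M N =
     \<lparr>ground = ground M \<union> ground N,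
      indeps = {X. X \<subseteq> ground M \<union> ground N \<and> (\<forall>C\<in>circuits M \<union> circuits N. \<not> C \<subseteq> X)}\<rparr>"

definition matroid_iso :: "'a set_system \<Rightarrow> 'b set_system \<Rightarrow> bool" where
  "matroid_iso M N \<longleftrightarrow>
     (\<exists>f. bij_betw f (ground M) (ground N) \<and>
          (\<forall>X. X \<subseteq> ground M \<longrightarrow> (X \<in> indeps M \<longleftrightarrow> f ` X \<in> indeps N)))"

lemma circuits_antichain: "C \<in> circuits M \<Longrightarrow> D \<in> circuits M \<Longrightarrow> C \<subseteq> D \<Longrightarrow> C = D"
  by (auto simp: circuits_def)

lemma (in matroid) circuit_nonempty: "C \<in> circuits M \<Longrightarrow> C \<noteq> {}"
  using empty_indep by (auto simp: circuits_def)

lemma circuits_direct_sum: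
  assumes "matroid M" "matroid N" "ground M \<inter> ground N = {}"
  shows "circuits (direct_sum M N) = circuits M \<union> circuits N"
proof -
  have anti: "C = D" if "C \<in> circuits M \<union> circuits N" "D \<in> circuits M \<union> circuits N" "C \<subseteq> D" for C D
  proof -
    have ne: "C \<noteq> {}"
      using that(1) matroid.circuit_nonempty[OF assms(1)] matroid.circuit_nonempty[OF assms(2)]
      by auto
    have M: "E \<subseteq> ground M" if "E \<in> circuits M" for E
      using that by (simp add: circuits_def)
    have N: "E \<subseteq> ground N" if "E \<in> circuits N" for E
      using that by (simp add: circuits_def)
    have "\<not> (C \<subseteq> ground M \<and> D \<subseteq> ground N)" "\<not> (C \<subseteq> ground N \<and> D \<subseteq> ground M)"
      using ne that(3) assms(3) by auto
    then have "C \<in> circuits M \<and> D \<in> circuits M \<or> C \<in> circuits N \<and> D \<in> circuits N"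
      using that(1,2) M N by (elim UnE) simp_all
    then show ?thesis
      using circuits_antichain that(3) by blast
  qed
  have sub: "C \<subseteq> ground M \<union> ground N" if "C \<in> circuits M \<union> circuits N" for C
    using that by (auto simp: circuits_def)
  have circ: "X \<in> circuits (direct_sum M N) \<longleftrightarrow> X \<subseteq> ground M \<union> ground N \<and>
      X \<notin> indeps (direct_sum M N) \<and> (\<forall>D. D \<subset> X \<longrightarrow> D \<in> indeps (direct_sum M N))" for X
    unfolding circuits_def[of "direct_sum M N"] by (simp add: direct_sum_def)
  show ?thesis
  proof (intro equalityI subsetI)
    fix X assume X: "X \<in> circuits (direct_sum M N)"
    then obtain C where C: "C \<in> circuits M \<union> circuits N" "C \<subseteq> X"
      unfolding circ by (auto simp: direct_sum_def)
    have "C \<notin> indeps (direct_sum M N)"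
      using C(1) by (auto simp: direct_sum_def)
    then have "C = X"
      using X C(2) unfolding circ by auto
    then show "X \<in> circuits M \<union> circuits N"
      using C(1) by simp
  next
    fix X assume X: "X \<in> circuits M \<union> circuits N"
    have "D \<in> indeps (direct_sum M N)" if "D \<subset> X" for D
    proof -
      have "\<not> C \<subseteq> D" if "C \<in> circuits M \<union> circuits N" for C
        using anti[OF that X] \<open>D \<subset> X\<close> by blast
      moreover have "D \<subseteq> ground M \<union> ground N"
        using sub[OF X] \<open>D \<subset> X\<close> by blast
      ultimately show ?thesis
        by (simp add: direct_sum_def)
    qed
    moreover have "X \<notin> indeps (direct_sum M N)"
      using X by (auto simp: direct_sum_def)
    ultimately show "X \<in> circuits (direct_sum M N)"
      using sub[OF X] unfolding circ by simp
  qed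
qed


section \<open>Broken circuits\<close>

text \<open>A linear ordering of the ground set is given by its reflexive relation \<open>R\<close>.\<close>

definition min_wrt :: "'a rel \<Rightarrow> 'a set \<Rightarrow> 'a" where
  "min_wrt R C = (THE m. m \<in> C \<and> (\<forall>c\<in>C. (m, c) \<in> R))"

definition broken_circuit :: "'a rel \<Rightarrow> 'a set \<Rightarrow> 'a set" where
  "broken_circuit R C = C - {min_wrt R C}"

definition broken_circuit_complex :: "'a set_system \<Rightarrow> 'a rel \<Rightarrow> 'a set set" where
  "broken_circuit_complex M R =
     {F. F \<subseteq> ground M \<and> (\<forall>C\<in>circuits M. \<not> broken_circuit R C \<subseteq> F)}"


section \<open>The standard graded polynomial ring in \<open>n\<close> variables\<close>

text \<open>A polynomial maps exponent vectors to coefficients. The variables are indexed by the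
  natural numbers; \<open>poly_ring n\<close> is the subring of polynomials in the variables
  \<open>1, \<dots>, n\<close> only.\<close>

type_synonym 'k mpoly = "(nat \<Rightarrow>\<^sub>0 nat) \<Rightarrow>\<^sub>0 'k"

definition poly_ring :: "nat \<Rightarrow> 'k::field mpoly ring" where
  "poly_ring n =
     \<lparr>carrier = {f. \<forall>m\<in>Poly_Mapping.keys f. Poly_Mapping.keys m \<subseteq> {1..n}},
      monoid.mult = (*), one = 1, zero = 0, add = (+)\<rparr>"

definition var :: "nat \<Rightarrow> 'k::field mpoly" where
  "var i = Poly_Mapping.single (Poly_Mapping.single i 1) 1"

definition mdegree :: "(nat \<Rightarrow>\<^sub>0 nat) \<Rightarrow> nat" where
  "mdegree m = (\<Sum>i\<in>Poly_Mapping.keys m. Poly_Mapping.lookup m i)"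

definition poly_homog :: "nat \<Rightarrow> int \<Rightarrow> 'k::field mpoly set" where
  "poly_homog n d = {f \<in> carrier (poly_ring n). \<forall>m\<in>Poly_Mapping.keys f. int (mdegree m) = d}"

text \<open>The homogeneous maximal ideal \<open>(x\<^sub>1, \<dots>, x\<^sub>n)\<close>.\<close>

definition irrelevant_ideal :: "nat \<Rightarrow> 'k::field mpoly set" where
  "irrelevant_ideal n = genideal (poly_ring n) (var ` {1..n})"

definition stanley_reisner_ideal :: "nat \<Rightarrow> nat set set \<Rightarrow> 'k::field mpoly set" where
  "stanley_reisner_ideal n \<Delta> =
     genideal (poly_ring n) {\<Prod>i\<in>F. var i | F. F \<subseteq> {1..n} \<and> F \<notin> \<Delta>}"


section \<open>Graded free resolutions\<close>

text \<open>The ideal \<open>I\<close> as a module; only \<open>carrier\<close>, \<open>zero\<close>, \<open>add\<close> and \<open>smult\<close> of a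
  module record are meaningful.\<close>

definition ideal_module :: "nat \<Rightarrow> 'k::field mpoly set \<Rightarrow> ('k mpoly, 'k mpoly) module" where
  "ideal_module n I =
     \<lparr>carrier = I, monoid.mult = (*), one = 1, zero = 0, add = (+), smult = (*)\<rparr>"

definition ideal_homog :: "nat \<Rightarrow> 'k::field mpoly set \<Rightarrow> int \<Rightarrow> 'k mpoly set" where
  "ideal_homog n I d = I \<inter> poly_homog n d"

text \<open>The free module of rank \<open>b\<close>: vectors are functions vanishing outside \<open>{..<b}\<close>.\<close>

definition free_module :: "nat \<Rightarrow> nat \<Rightarrow> ('k::field mpoly, nat \<Rightarrow> 'k mpoly) module" where
  "free_module n b =
     \<lparr>carrier = {v. (\<forall>j<b. v j \<in> carrier (poly_ring n)) \<and> (\<forall>j\<ge>b. v j = 0)},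
      monoid.mult = (\<lambda>v w j. v j * w j), one = (\<lambda>j. if j < b then 1 else 0),
      zero = (\<lambda>j. 0), add = (\<lambda>v w j. v j + w j), smult = (\<lambda>f v j. f * v j)\<rparr>"

text \<open>The component of degree \<open>d\<close> of \<open>S(-a 0) \<oplus> \<dots> \<oplus> S(-a (b - 1))\<close>,
  where \<open>S(c)\<close> has \<open>S\<^bsub>c + d\<^esub>\<close> in degree \<open>d\<close>.\<close>

definition free_homog :: "nat \<Rightarrow> nat \<Rightarrow> (nat \<Rightarrow> int) \<Rightarrow> int \<Rightarrow> (nat \<Rightarrow> 'k::field mpoly) set" where
  "free_homog n b a d =
     {v \<in> carrier (free_module n b). \<forall>j<b. v j \<in> poly_homog n (d - a j)}"

definition module_homs ::
  "('r, 'm) ring_scheme \<Rightarrow> ('r, 'a, 'c) module_scheme \<Rightarrow> ('r, 'b, 'd) module_scheme \<Rightarrow> ('a \<Rightarrow> 'b) set"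
  where
  "module_homs R M N =
     {h. h \<in> hom (add_monoid M) (add_monoid N) \<and>
         (\<forall>c\<in>carrier R. \<forall>x\<in>carrier M. h (c \<odot>\<^bsub>M\<^esub> x) = c \<odot>\<^bsub>N\<^esub> h x)}"

text \<open>A minimal graded free resolution of the graded module \<open>W\<close> with homogeneous components
  \<open>gr d\<close>: the \<open>i\<close>-th free module has rank \<open>b i\<close> and \<open>j\<close>-th basis vector of degree \<open>a i j\<close>,
  \<open>\<epsilon>\<close> maps the zeroth one onto \<open>W\<close>, and \<open>\<phi> i\<close> maps the \<open>(i+1)\<close>-st to the \<open>i\<close>-th.
  Zero ranks are allowed, so that all finite lengths are covered.\<close>

definition minimal_graded_free_resolution ::
  "nat \<Rightarrow> ('k::field mpoly, 'w) module \<Rightarrow> (int \<Rightarrow> 'w set) \<Rightarrow>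
   (nat \<Rightarrow> nat) \<Rightarrow> (nat \<Rightarrow> nat \<Rightarrow> int) \<Rightarrow> ((nat \<Rightarrow> 'k mpoly) \<Rightarrow> 'w) \<Rightarrow>
   (nat \<Rightarrow> (nat \<Rightarrow> 'k mpoly) \<Rightarrow> (nat \<Rightarrow> 'k mpoly)) \<Rightarrow> bool" where
  "minimal_graded_free_resolution n W gr b a \<epsilon> \<phi> \<longleftrightarrow>
     (let F = (\<lambda>i. free_module n (b i)) in
      (\<exists>m. \<forall>i>m. b i = 0) \<and>
      \<epsilon> \<in> module_homs (poly_ring n) (F 0) W \<and>
      (\<forall>i. \<phi> i \<in> module_homs (poly_ring n) (F (Suc i)) (F i)) \<and>
      (\<forall>d. \<epsilon> ` free_homog n (b 0) (a 0) d \<subseteq> gr d) \<and>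
      (\<forall>i d. \<phi> i ` free_homog n (b (Suc i)) (a (Suc i)) d \<subseteq> free_homog n (b i) (a i) d) \<and>
      \<epsilon> ` carrier (F 0) = carrier W \<and>
      \<phi> 0 ` carrier (F 1) = {v \<in> carrier (F 0). \<epsilon> v = \<zero>\<^bsub>W\<^esub>} \<and>
      (\<forall>i. \<phi> (Suc i) ` carrier (F (Suc (Suc i))) =
             {v \<in> carrier (F (Suc i)). \<phi> i v = \<zero>\<^bsub>F i\<^esub>}) \<and>
      (\<forall>i. \<forall>v\<in>carrier (F (Suc i)). \<forall>j<b i. \<phi> i v j \<in> irrelevant_ideal n))"

definition has_linear_resolution ::
  "nat \<Rightarrow> ('k::field mpoly, 'w) module \<Rightarrow> (int \<Rightarrow> 'w set) \<Rightarrow> int \<Rightarrow> bool" where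
  "has_linear_resolution n W gr p \<longleftrightarrow>
     (\<exists>b a \<epsilon> \<phi>. minimal_graded_free_resolution n W gr b a \<epsilon> \<phi> \<and>
        (\<forall>i. \<forall>j<b i. a i j = p + int i))"


section \<open>Sanity checks\<close>

lemma poly_ring_add_closed:
  assumes "f \<in> carrier (poly_ring n)" "g \<in> carrier (poly_ring n)"
  shows "f + g \<in> carrier (poly_ring n)"
  using assms Poly_Mapping.keys_add[of f g] unfolding poly_ring_def by fastforce

lemma poly_ring_mult_closed:
  assumes "f \<in> carrier (poly_ring n)" "g \<in> carrier (poly_ring n)"
  shows "f * g \<in> carrier (poly_ring n)"
proof -
  have "Poly_Mapping.keys m \<subseteq> {1..n}" if "m \<in> Poly_Mapping.keys (f * g)" for m
  proof -
    have "m \<in> {a + b | a b. a \<in> Poly_Mapping.keys f \<and> b \<in> Poly_Mapping.keys g}"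
      using that keys_mult[of f g] by (rule rev_subsetD)
    then obtain a b where "m = a + b" "a \<in> Poly_Mapping.keys f" "b \<in> Poly_Mapping.keys g"
      by auto
    then show ?thesis
      using assms Poly_Mapping.keys_add[of a b] unfolding poly_ring_def by fastforce
  qed
  then show ?thesis by (simp add: poly_ring_def)
qed

lemma poly_ring_cring: "cring (poly_ring n :: 'k::field mpoly ring)"
proof (rule cringI)
  show "abelian_group (poly_ring n :: 'k mpoly ring)"
  proof (rule abelian_groupI)
    fix f :: "'k mpoly" assume "f \<in> carrier (poly_ring n)"
    then have "- f \<in> carrier (poly_ring n)"
      by (simp add: poly_ring_def in_keys_iff)
    then show "\<exists>g\<in>carrier (poly_ring n). g \<oplus>\<^bsub>poly_ring n\<^esub> f = \<zero>\<^bsub>poly_ring n\<^esub>"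
      by (intro bexI[of _ "- f"]) (auto simp: poly_ring_def)
  next
    fix f g :: "'k mpoly"
    assume "f \<in> carrier (poly_ring n)" "g \<in> carrier (poly_ring n)"
    then show "f \<oplus>\<^bsub>poly_ring n\<^esub> g \<in> carrier (poly_ring n)"
      using poly_ring_add_closed[of f n g] by (simp add: poly_ring_def)
  qed (simp_all add: poly_ring_def add_ac)
  show "comm_monoid (poly_ring n :: 'k mpoly ring)"
  proof (rule comm_monoidI)
    fix f g :: "'k mpoly"
    assume "f \<in> carrier (poly_ring n)" "g \<in> carrier (poly_ring n)"
    then show "f \<otimes>\<^bsub>poly_ring n\<^esub> g \<in> carrier (poly_ring n)"
      using poly_ring_mult_closed[of f n g] by (simp add: poly_ring_def)
  qed (simp_all add: poly_ring_def mult_ac)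
qed (auto simp: poly_ring_def distrib_right)

lemma free_module_module: "module (poly_ring n) (free_module n b :: (_, nat \<Rightarrow> 'k::field mpoly) module)"
proof (rule moduleI)
  show "abelian_group (free_module n b :: (_, nat \<Rightarrow> 'k mpoly) module)"
  proof (rule abelian_groupI)
    fix v :: "nat \<Rightarrow> 'k mpoly" assume "v \<in> carrier (free_module n b)"
    then show "\<exists>w\<in>carrier (free_module n b).
                 w \<oplus>\<^bsub>free_module n b\<^esub> v = \<zero>\<^bsub>free_module n b\<^esub>"
      by (intro bexI[of _ "\<lambda>j. - v j"]) (auto simp: free_module_def poly_ring_def in_keys_iff)
  next
    fix v w :: "nat \<Rightarrow> 'k mpoly"
    assume "v \<in> carrier (free_module n b)" "w \<in> carrier (free_module n b)"
    then show "v \<oplus>\<^bsub>free_module n b\<^esub> w \<in> carrier (free_module n b)"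
      by (simp add: free_module_def poly_ring_add_closed)
  next
    show "\<zero>\<^bsub>free_module n b\<^esub> \<in> carrier (free_module n b :: (_, nat \<Rightarrow> 'k mpoly) module)"
      by (simp add: free_module_def poly_ring_def)
  qed (simp_all add: free_module_def add_ac)
next
  fix f :: "'k mpoly" and v :: "nat \<Rightarrow> 'k mpoly"
  assume "f \<in> carrier (poly_ring n)" "v \<in> carrier (free_module n b)"
  then show "f \<odot>\<^bsub>free_module n b\<^esub> v \<in> carrier (free_module n b)"
    by (simp add: free_module_def poly_ring_mult_closed)
qed (rule poly_ring_cring, simp_all add: free_module_def poly_ring_def distrib_left distrib_right mult.assoc)

lemma ideal_module_module:
  assumes "ideal I (poly_ring n)"
  shows "module (poly_ring n) (ideal_module n I :: (_, 'k::field mpoly) module)"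
proof -
  interpret ideal I "poly_ring n" by fact
  have sub: "f \<in> carrier (poly_ring n)" if "f \<in> I" for f
    using that a_subset by blast
  show ?thesis
  proof (rule moduleI)
    show "abelian_group (ideal_module n I :: (_, 'k mpoly) module)"
    proof (rule abelian_groupI)
      fix f assume "f \<in> carrier (ideal_module n I :: (_, 'k mpoly) module)"
      then have f: "f \<in> I" by (simp add: ideal_module_def)
      then have "\<ominus>\<^bsub>poly_ring n\<^esub> f \<oplus>\<^bsub>poly_ring n\<^esub> f = \<zero>\<^bsub>poly_ring n\<^esub>"
        using sub by (simp add: l_neg)
      moreover have "\<ominus>\<^bsub>poly_ring n\<^esub> f \<in> I"
        using f additive_subgroup.a_inv_closed[OF is_additive_subgroup] by blast
      ultimately show "\<exists>g\<in>carrier (ideal_module n I).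
          g \<oplus>\<^bsub>ideal_module n I\<^esub> f = \<zero>\<^bsub>ideal_module n I\<^esub>"
        by (intro bexI) (auto simp: ideal_module_def poly_ring_def)
    next
      fix f g assume "f \<in> carrier (ideal_module n I :: (_, 'k mpoly) module)"
        "g \<in> carrier (ideal_module n I :: (_, 'k mpoly) module)"
      then show "f \<oplus>\<^bsub>ideal_module n I\<^esub> g \<in> carrier (ideal_module n I)"
        using additive_subgroup.a_closed[OF is_additive_subgroup, of f g] by (simp add: ideal_module_def poly_ring_def)
    next
      show "\<zero>\<^bsub>ideal_module n I\<^esub> \<in> carrier (ideal_module n I :: (_, 'k mpoly) module)"
        using additive_subgroup.zero_closed[OF is_additive_subgroup]
        by (simp add: ideal_module_def poly_ring_def)
    qed (simp_all add: ideal_module_def add_ac)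
  next
    fix f g assume "f \<in> carrier (poly_ring n :: 'k mpoly ring)"
      "g \<in> carrier (ideal_module n I :: (_, 'k mpoly) module)"
    then show "f \<odot>\<^bsub>ideal_module n I\<^esub> g \<in> carrier (ideal_module n I)"
      using I_l_closed[of g f] by (simp add: ideal_module_def poly_ring_def)
  qed (rule poly_ring_cring, simp_all add: ideal_module_def poly_ring_def distrib_left distrib_right mult.assoc)
qed

lemma prod_var_closed:
  assumes "A \<subseteq> {1..n}"
  shows "(\<Prod>i\<in>A. var i :: 'k::field mpoly) \<in> carrier (poly_ring n)"
proof -
  have 1: "(1 :: 'k mpoly) \<in> carrier (poly_ring n)"
    by (simp add: poly_ring_def)
  have v: "(var i :: 'k mpoly) \<in> carrier (poly_ring n)" if "i \<in> {1..n}" for i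
    using that by (simp add: poly_ring_def var_def)
  have "finite A"
    using assms finite_subset by blast
  then show ?thesis
    using assms by induction (auto intro!: poly_ring_mult_closed v simp: 1)
qed

lemma stanley_reisner_broken_circuit_complex:
  assumes "ground M = {1..n}"
  shows "stanley_reisner_ideal n (broken_circuit_complex M R) =
    (genideal (poly_ring n) {\<Prod>i\<in>broken_circuit R C. var i | C. C \<in> circuits M} :: 'k::field mpoly set)"
    (is "_ = genideal ?S ?B")
proof -
  interpret cring ?S by (rule poly_ring_cring)
  let ?N = "{\<Prod>i\<in>F. var i :: 'k mpoly | F. F \<subseteq> {1..n} \<and> F \<notin> broken_circuit_complex M R}"
  have bc: "broken_circuit R C \<subseteq> {1..n}" if "C \<in> circuits M" for C
    using that assms by (auto simp: circuits_def broken_circuit_def)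
  have N: "?N \<subseteq> carrier ?S" and B: "?B \<subseteq> carrier ?S"
    using prod_var_closed bc by blast+
  have "?B \<subseteq> ?N"
    using bc by (auto simp: broken_circuit_complex_def)
  then have 1: "genideal ?S ?B \<subseteq> genideal ?S ?N"
    using genideal_minimal[OF genideal_ideal[OF N]] genideal_self[OF N] by (meson order_trans)
  have "?N \<subseteq> genideal ?S ?B"
  proof
    fix f assume "f \<in> ?N"
    then obtain F where F: "f = (\<Prod>i\<in>F. var i)" "F \<subseteq> {1..n}" "F \<notin> broken_circuit_complex M R"
      by blast
    then obtain C where C: "C \<in> circuits M" "broken_circuit R C \<subseteq> F"
      using assms by (auto simp: broken_circuit_complex_def)
    have "finite F" using F(2) finite_subset by blast
    then have "f = (\<Prod>i\<in>F - broken_circuit R C. var i) \<otimes>\<^bsub>?S\<^esub> (\<Prod>i\<in>broken_circuit R C. var i)"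
      using prod.subset_diff[OF C(2), of var] F(1) by (simp add: poly_ring_def)
    moreover have "(\<Prod>i\<in>broken_circuit R C. var i) \<in> genideal ?S ?B"
      using genideal_self[OF B] C(1) by blast
    moreover have "(\<Prod>i\<in>F - broken_circuit R C. var i) \<in> carrier ?S"
      using F(2) by (intro prod_var_closed) auto
    ultimately show "f \<in> genideal ?S ?B"
      using ideal.I_l_closed[OF genideal_ideal[OF B]] by simp
  qed
  then have "genideal ?S ?N \<subseteq> genideal ?S ?B"
    by (intro genideal_minimal genideal_ideal B)
  with 1 show ?thesis
    by (simp add: stanley_reisner_ideal_def)
qed

end

theory Submission
  imports Defs
begin

text \<open>A \<open>p\<close>-linear resolution of the ideal forces its Koszul homology \<open>Tor\<^sub>i(I, K)\<close> into degree
  \<open>p + i\<close>. In squarefree degrees this homology is the simplicial cohomology of induced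
  subcomplexes \<open>\<Delta>\<^sub>W\<close> of the broken circuit complex (Hochster), so a nonzero top-dimensional cycle on
  sets with \<open>k\<close> elements in some \<open>\<Delta>\<^sub>W\<close> gives \<open>p = k + 1\<close>. Three kinds of cycles are used, all of
  them products \<open>(z\<^sub>1 - b\<^sub>1) \<and> \<dots> \<and> (z\<^sub>k - b\<^sub>k)\<close>: the boundary of a minimal nonface shows that every
  circuit has more than \<open>p\<close> elements; the join of two such boundaries shows that the elements
  lying in circuits form a connected matroid; and a connected matroid of rank \<open>s\<close> carries a cycle
  with \<open>k = s - 1\<close> in the complex with the least element removed, whence \<open>s = p\<close>. A matroid of
  rank \<open>p\<close> whose circuits have more than \<open>p\<close> elements is uniform.

  Conversely, the ideal is then generated by the squarefree monomials of degree \<open>p\<close> in the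
  elements of the uniform summand other than the least one. It is resolved by induction on the
  variables, from \<open>I(q + 1, V \<union> {v}) = I(q + 1, V) + x\<^sub>v I(q, V)\<close> with intersection
  \<open>x\<^sub>v I(q + 1, V)\<close>.\<close>

section \<open>Rank and connectivity of matroids\<close>

text \<open>The least element of a connected matroid lies in no broken circuit, so the broken
  circuit complex is a cone and has no homology of its own. Without the cone point the top homology
  has rank Crapo's beta invariant, which is positive for connected matroids with at least two
  elements; the difficulty is to exhibit a class. Products of differences make this checkable. If
  each \<open>z\<close> occurs in no later pair, the term made of all the \<open>z\<close> arises
  from one choice only, so its coefficient is 1 or -1 in every characteristic, and in the top
  dimension a nonzero cycle cannot bound. On the algebraic side \<open>lin_res\<close> is a
  recursive predicate on submodules of free modules, which permits induction on the length of the
  resolution. Minimality is then automatic: if all generators sit in one degree and the first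
  syzygies in the next, the matrices consist of linear forms. The zero ideal is exceptional: it has
  a linear resolution for every \<open>p\<close>. It occurs exactly when there are no circuits, and
  this case is treated separately.\<close>

definition rk :: "'a set_system \<Rightarrow> 'a set \<Rightarrow> nat" where
  "rk M X = Max (card ` {I \<in> indeps M. I \<subseteq> X})"

definition restriction :: "'a set_system \<Rightarrow> 'a set \<Rightarrow> 'a set_system" where
  "restriction M N = \<lparr>ground = N, indeps = {X \<in> indeps M. X \<subseteq> N}\<rparr>"

definition contraction :: "'a set_system \<Rightarrow> 'a \<Rightarrow> 'a set_system" where
  "contraction M z = \<lparr>ground = ground M - {z}, indeps = {X. z \<notin> X \<and> insert z X \<in> indeps M}\<rparr>"

text \<open>Submodularity always gives \<open>\<le>\<close>, so equality is what marks a direct sum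
  decomposition. A one-element matroid is connected even if its element is a loop; this is why
  \<open>cycle_pairs\<close> asks for positive rank.\<close>

definition connected_matroid :: "'a set_system \<Rightarrow> bool" where
  "connected_matroid M \<longleftrightarrow> (\<forall>A B. A \<union> B = ground M \<longrightarrow> A \<inter> B = {} \<longrightarrow> A \<noteq> {} \<longrightarrow> B \<noteq> {} \<longrightarrow>
     rk M (ground M) < rk M A + rk M B)"

lemma connected_matroidD:
  "connected_matroid M \<Longrightarrow> A \<union> B = ground M \<Longrightarrow> A \<inter> B = {} \<Longrightarrow> A \<noteq> {} \<Longrightarrow> B \<noteq> {} \<Longrightarrow>
    rk M (ground M) < rk M A + rk M B"
  by (simp add: connected_matroid_def)

context matroid
begin

lemma finite_indeps: "finite (indeps M)"
  using finite_ground indeps_subset by (auto intro: finite_subset[of _ "Pow (ground M)"])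

lemma finite_indep: "X \<in> indeps M \<Longrightarrow> finite X"
  using finite_ground indeps_subset finite_subset by blast

lemma rk_ge: "I \<in> indeps M \<Longrightarrow> I \<subseteq> X \<Longrightarrow> card I \<le> rk M X"
  unfolding rk_def using finite_indeps by (intro Max_ge) auto

lemma obtain_rk:
  obtains I where "I \<in> indeps M" "I \<subseteq> X" "card I = rk M X"
proof -
  have "rk M X \<in> card ` {I \<in> indeps M. I \<subseteq> X}"
    unfolding rk_def using finite_indeps empty_indep by (intro Max_in) auto
  then show thesis using that by auto
qed

lemma rk_mono: "X \<subseteq> Y \<Longrightarrow> rk M X \<le> rk M Y"
  by (metis obtain_rk order_trans rk_ge)

lemma rk_le_card: "finite X \<Longrightarrow> rk M X \<le> card X"
  by (metis card_mono obtain_rk)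

lemma rk_indep: "I \<in> indeps M \<Longrightarrow> rk M I = card I"
  by (simp add: finite_indep le_antisym rk_ge rk_le_card)

lemma indep_if_rk: "finite X \<Longrightarrow> rk M X = card X \<Longrightarrow> X \<in> indeps M"
  by (metis card_subset_eq obtain_rk)

lemma extend_to_rk:
  assumes "I \<in> indeps M" "I \<subseteq> X"
  obtains B where "B \<in> indeps M" "I \<subseteq> B" "B \<subseteq> X" "card B = rk M X"
proof -
  let ?S = "{J \<in> indeps M. I \<subseteq> J \<and> J \<subseteq> X}"
  have fin: "finite ?S" using finite_indeps by auto
  have "I \<in> ?S" using assms by auto
  then have "Max (card ` ?S) \<in> card ` ?S" using fin by (intro Max_in) auto
  then obtain J where J: "J \<in> ?S" "card J = Max (card ` ?S)" by auto
  have max: "card J' \<le> card J" if "J' \<in> ?S" for J'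
    unfolding J(2) using fin that by (intro Max_ge) auto
  have "\<not> card J < rk M X"
  proof
    assume less: "card J < rk M X"
    obtain B where B: "B \<in> indeps M" "B \<subseteq> X" "card B = rk M X" by (rule obtain_rk)
    then obtain y where y: "y \<in> B - J" "insert y J \<in> indeps M"
      using augment[of J B] J(1) less by auto
    then have "insert y J \<in> ?S" using J(1) B by auto
    from max[OF this] show False using y(1) J(1) finite_indep[of J] by auto
  qed
  then show thesis
    using that[of J] J(1) rk_ge[of J X] by auto
qed

text \<open>A basis \<open>J\<close> of the intersection extends to a basis \<open>B\<close> of the
  union. Then \<open>B \<inter> X\<close> and \<open>B \<inter> Y\<close> are independent, and their
  sizes add up to at least \<open>card B + card J\<close>.\<close>

lemma rk_submodular: "rk M (X \<union> Y) + rk M (X \<inter> Y) \<le> rk M X + rk M Y"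
proof -
  obtain J where J: "J \<in> indeps M" "J \<subseteq> X \<inter> Y" "card J = rk M (X \<inter> Y)" by (rule obtain_rk)
  then obtain B where B: "B \<in> indeps M" "J \<subseteq> B" "B \<subseteq> X \<union> Y" "card B = rk M (X \<union> Y)"
    using extend_to_rk[of J "X \<union> Y"] by auto
  have fB: "finite B" using B(1) finite_indep by auto
  have "card B + card J \<le> card (B \<inter> X \<union> B \<inter> Y) + card (B \<inter> X \<inter> (B \<inter> Y))"
    using fB J B by (intro add_mono card_mono) auto
  also have "\<dots> = card (B \<inter> X) + card (B \<inter> Y)"
    using fB card_Un_Int[of "B \<inter> X" "B \<inter> Y"] by simp
  also have "\<dots> \<le> rk M X + rk M Y"
    using B(1) indep_mono by (intro add_mono rk_ge) auto
  finally show ?thesis using B J by simp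
qed

lemma finite_circuit: "C \<in> circuits M \<Longrightarrow> finite C"
  using finite_ground finite_subset unfolding circuits_def by auto

lemma rk_circuit: "C \<in> circuits M \<Longrightarrow> rk M C < card C"
  using finite_circuit[of C] indep_if_rk[of C] rk_le_card[of C] by (auto simp: circuits_def le_less)

lemma circuit_subset_ground: "C \<in> circuits M \<Longrightarrow> C \<subseteq> ground M"
  by (simp add: circuits_def)

lemma circuit_not_indep: "C \<in> circuits M \<Longrightarrow> C \<notin> indeps M"
  by (simp add: circuits_def)

lemma circuit_psubset_indep: "C \<in> circuits M \<Longrightarrow> D \<subset> C \<Longrightarrow> D \<in> indeps M"
  by (simp add: circuits_def)

lemma contains_circuit:
  assumes "X \<subseteq> ground M" "X \<notin> indeps M"
  obtains C where "C \<in> circuits M" "C \<subseteq> X"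
proof -
  have "finite X" using assms finite_ground finite_subset by blast
  then have "X \<subseteq> ground M \<longrightarrow> X \<notin> indeps M \<longrightarrow> (\<exists>C\<in>circuits M. C \<subseteq> X)"
  proof (induction X rule: finite_psubset_induct)
    case (psubset X)
    show ?case
    proof (intro impI)
      assume X: "X \<subseteq> ground M" "X \<notin> indeps M"
      show "\<exists>C\<in>circuits M. C \<subseteq> X"
      proof (cases "\<forall>D. D \<subset> X \<longrightarrow> D \<in> indeps M")
        case True
        then show ?thesis using X by (auto simp: circuits_def)
      next
        case False
        then obtain D where D: "D \<subset> X" "D \<notin> indeps M" by auto
        then have "\<exists>C\<in>circuits M. C \<subseteq> D" using psubset.IH[of D] X by auto
        then show ?thesis using D by auto
      qed
    qed
  qed
  then show thesis using assms that by metis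
qed

lemma indep_iff_no_circuit:
  "X \<subseteq> ground M \<Longrightarrow> X \<in> indeps M \<longleftrightarrow> (\<forall>C\<in>circuits M. \<not> C \<subseteq> X)"
proof
  show "\<forall>C\<in>circuits M. \<not> C \<subseteq> X" if "X \<in> indeps M"
    using indep_mono[OF that] circuit_not_indep by auto
  show "X \<in> indeps M" if "X \<subseteq> ground M" "\<forall>C\<in>circuits M. \<not> C \<subseteq> X"
  proof (rule ccontr)
    assume "X \<notin> indeps M"
    with that(1) obtain C where "C \<in> circuits M" "C \<subseteq> X" by (rule contains_circuit)
    with that(2) show False by simp
  qed
qed

lemma bases_card: "B \<in> bases M \<Longrightarrow> card B = rk M (ground M)"
proof -
  assume B: "B \<in> bases M"
  then have "B \<in> indeps M" "B \<subseteq> ground M" using indeps_subset by (auto simp: bases_def)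
  then obtain B' where "B' \<in> indeps M" "B \<subseteq> B'" "card B' = rk M (ground M)"
    by (rule extend_to_rk)
  with B show ?thesis by (auto simp: bases_def)
qed

text \<open>The description operator determines a number only because a basis exists; a largest
  independent set is one.\<close>

lemma matroid_rank_eq_rk: "matroid_rank M = rk M (ground M)"
  unfolding matroid_rank_def
proof (rule the_equality)
  show "\<forall>B\<in>bases M. card B = rk M (ground M)" using bases_card by simp
  obtain B where B: "B \<in> indeps M" "card B = rk M (ground M)" by (rule obtain_rk)
  have "X = B" if "X \<in> indeps M" "B \<subseteq> X" for X
    using B that card_seteq[of X B] finite_indep[of X] rk_ge[of X "ground M"] indeps_subset by auto
  then have "B \<in> bases M" using B by (auto simp: bases_def)
  then show "r = rk M (ground M)" if "\<forall>B\<in>bases M. card B = r" for r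
    using that bases_card by metis
qed

text \<open>If \<open>C\<close> met both sides, both traces would be proper subsets and so
  independent. Submodularity, first for \<open>C\<close> and \<open>A\<close>, then for
  \<open>C \<union> A\<close> and \<open>B\<close>, would give
  \<open>rk M (A \<union> B) + card C \<le> rk M C + rk M A + rk M B\<close>, and
  \<open>rk M C < card C\<close> contradicts the separation.\<close>

lemma separated_circuit:
  assumes C: "C \<in> circuits M" "C \<subseteq> A \<union> B" and sep: "rk M A + rk M B \<le> rk M (A \<union> B)"
    and disj: "A \<inter> B = {}"
  shows "C \<subseteq> A \<or> C \<subseteq> B"
proof (rule ccontr)
  assume not: "\<not> (C \<subseteq> A \<or> C \<subseteq> B)"
  then have sub: "C \<inter> A \<subset> C" "C \<inter> B \<subset> C" using C(2) by auto
  have "rk M (C \<inter> A) = card (C \<inter> A)" "rk M (C \<inter> B) = card (C \<inter> B)"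
    using sub C(1) circuit_psubset_indep rk_indep by metis+
  moreover have "card (C \<inter> A) + card (C \<inter> B) = card C"
    using card_Un_disjoint[of "C \<inter> A" "C \<inter> B"] finite_circuit[OF C(1)] disj C(2)
    by (simp add: Int_Un_distrib[symmetric] inf.absorb1 inf_left_commute Int_assoc)
  moreover have "rk M (C \<union> A) + rk M (C \<inter> A) \<le> rk M C + rk M A"
    by (rule rk_submodular)
  moreover have "rk M (A \<union> B) + rk M (C \<inter> B) \<le> rk M (C \<union> A) + rk M B"
  proof -
    have "C \<union> A \<union> B = A \<union> B" "(C \<union> A) \<inter> B = C \<inter> B" using C(2) disj by auto
    then show ?thesis using rk_submodular[of "C \<union> A" B] by simp
  qed
  ultimately show False using sep rk_circuit[OF C(1)] by linarith
qed

section \<open>Restriction and contraction\<close>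

lemma matroid_restriction: "N \<subseteq> ground M \<Longrightarrow> matroid (restriction M N)"
proof
  assume N: "N \<subseteq> ground M"
  show "finite (ground (restriction M N))"
    using N finite_ground finite_subset by (auto simp: restriction_def)
  show "\<exists>y\<in>Y - X. insert y X \<in> indeps (restriction M N)"
    if "X \<in> indeps (restriction M N)" "Y \<in> indeps (restriction M N)" "card X < card Y" for X Y
    using that augment[of X Y] by (auto simp: restriction_def)
qed (auto simp: restriction_def empty_indep intro: indep_mono)

lemma circuits_restriction:
  "N \<subseteq> ground M \<Longrightarrow> circuits (restriction M N) = {C \<in> circuits M. C \<subseteq> N}"
proof (intro equalityI subsetI)
  assume N: "N \<subseteq> ground M"
  show "C \<in> {C \<in> circuits M. C \<subseteq> N}" if "C \<in> circuits (restriction M N)" for C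
  proof -
    have C: "C \<subseteq> N" "C \<notin> indeps M" using that by (auto simp: circuits_def restriction_def)
    moreover have "D \<in> indeps M" if "D \<subset> C" for D
      using that \<open>C \<in> circuits (restriction M N)\<close> by (simp add: circuits_def restriction_def)
    ultimately show ?thesis using N by (auto simp: circuits_def)
  qed
qed (auto simp: circuits_def restriction_def)

lemma rk_restriction: "X \<subseteq> N \<Longrightarrow> rk (restriction M N) X = rk M X"
  unfolding rk_def restriction_def by (auto intro!: arg_cong[where f = Max] arg_cong[where f = "image card"])

lemma contraction_indep: "X \<in> indeps (contraction M z) \<longleftrightarrow> z \<notin> X \<and> insert z X \<in> indeps M"
  by (simp add: contraction_def)

lemma matroid_contraction:
  assumes z: "{z} \<in> indeps M"
  shows "matroid (contraction M z)"
proof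
  show "finite (ground (contraction M z))"
    using finite_ground by (simp add: contraction_def)
  show "X \<subseteq> ground (contraction M z)" if "X \<in> indeps (contraction M z)" for X
    using that indeps_subset[of "insert z X"] by (auto simp: contraction_def)
  show "{} \<in> indeps (contraction M z)"
    using z by (simp add: contraction_def)
  show "Y \<in> indeps (contraction M z)" if "X \<in> indeps (contraction M z)" "Y \<subseteq> X" for X Y
    using that indep_mono[of "insert z X" "insert z Y"] by (auto simp: contraction_def)
  show "\<exists>y\<in>Y - X. insert y X \<in> indeps (contraction M z)"
    if "X \<in> indeps (contraction M z)" "Y \<in> indeps (contraction M z)" "card X < card Y" for X Y
  proof -
    have "finite X" "finite Y"
      using that finite_indep[of "insert z X"] finite_indep[of "insert z Y"]
      by (auto simp: contraction_def)
    then have "card (insert z X) < card (insert z Y)"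
      using that unfolding contraction_indep by simp
    moreover have "insert z X \<in> indeps M" "insert z Y \<in> indeps M"
      using that unfolding contraction_indep by auto
    ultimately obtain y where "y \<in> insert z Y - insert z X" "insert y (insert z X) \<in> indeps M"
      using augment by metis
    then show ?thesis
      using that by (intro bexI[of _ y]) (auto simp: contraction_def insert_commute)
  qed
qed

lemma rk_contraction:
  assumes z: "{z} \<in> indeps M" and X: "z \<notin> X"
  shows "rk M (insert z X) = Suc (rk (contraction M z) X)"
proof (rule antisym)
  interpret N: matroid "contraction M z" by (rule matroid_contraction[OF z])
  obtain I where I: "I \<in> indeps (contraction M z)" "I \<subseteq> X" "card I = rk (contraction M z) X"
    by (rule N.obtain_rk)
  then show "Suc (rk (contraction M z) X) \<le> rk M (insert z X)"
    using rk_ge[of "insert z I" "insert z X"] N.finite_indep[of I] by (auto simp: contraction_def)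
  obtain B where B: "B \<in> indeps M" "{z} \<subseteq> B" "B \<subseteq> insert z X" "card B = rk M (insert z X)"
    using extend_to_rk[OF z, of "insert z X"] by auto
  then have "B - {z} \<in> indeps (contraction M z)" "B - {z} \<subseteq> X" "insert z B = B"
    unfolding contraction_indep by (auto simp: insert_absorb)
  moreover have "card B = Suc (card (B - {z}))"
    using B finite_indep[of B] by (metis card.remove insert_subset)
  ultimately show "rk M (insert z X) \<le> Suc (rk (contraction M z) X)"
    using N.rk_ge[of "B - {z}" X] B(4) by simp
qed

text \<open>A loop splits off at no cost in rank. The ground set must have a further element, or
  else the complement would be empty and no partition would arise.\<close>

lemma connected_loopless:
  assumes "connected_matroid M" "x \<in> ground M" "ground M \<noteq> {x}"
  shows "{x} \<in> indeps M"
proof (rule ccontr)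
  assume no: "{x} \<notin> indeps M"
  have "rk M (ground M) < rk M {x} + rk M (ground M - {x})"
    using assms by (intro connected_matroidD) auto
  moreover have "rk M {x} \<noteq> 1"
    using no indep_if_rk[of "{x}"] by auto
  then have "rk M {x} = 0"
    using rk_le_card[of "{x}"] by auto
  moreover have "rk M (ground M - {x}) \<le> rk M (ground M)" by (rule rk_mono) auto
  ultimately show False by auto
qed

lemma connected_no_coloop:
  assumes "connected_matroid M" "x \<in> ground M" "ground M \<noteq> {x}"
  shows "rk M (ground M - {x}) = rk M (ground M)"
proof -
  have "rk M (ground M) < rk M {x} + rk M (ground M - {x})"
    using assms by (intro connected_matroidD) auto
  moreover have "rk M {x} \<le> 1" using rk_le_card[of "{x}"] by simp
  moreover have "rk M (ground M - {x}) \<le> rk M (ground M)" by (rule rk_mono) auto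
  ultimately show ?thesis by auto
qed

text \<open>Tutte: uncrossing a separation of the deletion with one of the contraction.\<close>

lemma connected_deletion_or_contraction:
  assumes conn: "connected_matroid M" and z: "z \<in> ground M" "{z} \<in> indeps M"
    and AB: "A \<union> B = ground M - {z}" "A \<inter> B = {}" "A \<noteq> {}" "B \<noteq> {}"
      "rk M A + rk M B \<le> rk M (ground M - {z})"
  shows "connected_matroid (contraction M z)"
  unfolding connected_matroid_def
proof (intro allI impI, rule ccontr)
  fix C D
  assume CD: "C \<union> D = ground (contraction M z)" "C \<inter> D = {}" "C \<noteq> {}" "D \<noteq> {}"
    and "\<not> rk (contraction M z) (ground (contraction M z)) <
      rk (contraction M z) C + rk (contraction M z) D"
  then have le: "rk (contraction M z) C + rk (contraction M z) D
      \<le> rk (contraction M z) (ground M - {z})"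
    by (simp add: contraction_def)
  have CD1: "C \<union> D = ground M - {z}" using CD(1) by (simp add: contraction_def)
  have zn: "z \<notin> A" "z \<notin> B" "z \<notin> C" "z \<notin> D" using AB(1) CD1 by auto
  have "insert z (ground M - {z}) = ground M" using z(1) by auto
  then have r: "rk M (insert z C) + rk M (insert z D) \<le> Suc (rk M (ground M))"
    using le rk_contraction[OF z(2) zn(3)] rk_contraction[OF z(2) zn(4)]
      rk_contraction[OF z(2), of "ground M - {z}"] by simp
  have rAB: "rk M A + rk M B \<le> rk M (ground M)"
    using AB(5) rk_mono[of "ground M - {z}" "ground M"] by auto
  \<comment> \<open>If both opposite corners were nonempty, each would form a partition with its
    complement. The two strict inequalities from connectivity gain 2 in total, while submodularity
    and the two separations allow an excess of only 1, the one coming from the contraction.\<close>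
  have key: "C' \<inter> A' = {} \<or> D' \<inter> B' = {}"
    if CD': "C' \<union> D' = ground M - {z}" "C' \<inter> D' = {}"
      and r': "rk M (insert z C') + rk M (insert z D') \<le> Suc (rk M (ground M))"
      and AB': "A' \<union> B' = ground M - {z}" "A' \<inter> B' = {}"
      and rAB': "rk M A' + rk M B' \<le> rk M (ground M)"
    for A' B' C' D'
  proof (rule ccontr)
    assume "\<not> (C' \<inter> A' = {} \<or> D' \<inter> B' = {})"
    then have ne: "A' \<inter> C' \<noteq> {}" "B' \<inter> D' \<noteq> {}" by auto
    have part: "X \<inter> C \<union> (Y \<union> insert z D) = ground M" "X \<inter> C \<inter> (Y \<union> insert z D) = {}"
      if "X \<union> Y = ground M - {z}" "C \<union> D = ground M - {z}" "X \<inter> Y = {}" "C \<inter> D = {}" for X Y C D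
      using that z(1) by blast+
    have "rk M (ground M) < rk M (A' \<inter> C') + rk M (B' \<union> insert z D')"
      using connected_matroidD[OF conn part[OF AB'(1) CD'(1) AB'(2) CD'(2)] ne(1)] by simp
    moreover have "rk M (ground M) < rk M (B' \<inter> D') + rk M (A' \<union> insert z C')"
    proof -
      have "B' \<union> A' = ground M - {z}" "D' \<union> C' = ground M - {z}" "B' \<inter> A' = {}" "D' \<inter> C' = {}"
        using AB' CD' by auto
      then show ?thesis
        using connected_matroidD[OF conn part[of B' A' D' C'] ne(2)] by simp
    qed
    moreover have "rk M (A' \<union> insert z C') + rk M (A' \<inter> C') \<le> rk M A' + rk M (insert z C')"
    proof -
      have "A' \<inter> insert z C' = A' \<inter> C'" using AB'(1) by auto
      then show ?thesis using rk_submodular[of A' "insert z C'"] by simp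
    qed
    moreover have "rk M (B' \<union> insert z D') + rk M (B' \<inter> D') \<le> rk M B' + rk M (insert z D')"
    proof -
      have "B' \<inter> insert z D' = B' \<inter> D'" using AB'(1) by auto
      then show ?thesis using rk_submodular[of B' "insert z D'"] by simp
    qed
    ultimately show False using r' rAB' by linarith
  qed
  have "C \<inter> A = {} \<or> D \<inter> B = {}"
    by (rule key[OF CD1 CD(2) r AB(1,2) rAB])
  moreover have "C \<inter> B = {} \<or> D \<inter> A = {}"
  proof (rule key[OF CD1 CD(2) r])
    show "B \<union> A = ground M - {z}" "B \<inter> A = {}" "rk M B + rk M A \<le> rk M (ground M)"
      using AB rAB by auto
  qed
  moreover have eq: "A \<union> B = C \<union> D" using AB(1) CD1 by simp
  then have "A = C \<inter> A \<union> D \<inter> A" "B = C \<inter> B \<union> D \<inter> B" "C = C \<inter> A \<union> C \<inter> B" "D = D \<inter> A \<union> D \<inter> B"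
    by (auto simp: set_eq_iff)
  \<comment> \<open>One corner on each diagonal is empty. Any such pair of corners makes up one of
    \<open>A\<close>, \<open>B\<close>, \<open>C\<close>, \<open>D\<close>, which would then be
    empty.\<close>
  ultimately show False
    using AB(3,4) CD(3,4) by (metis Un_empty)
qed

end

section \<open>Cycles of the broken circuit complex\<close>

lemma linear_order_min:
  assumes "linear_order_on A R" "finite C" "C \<noteq> {}" "C \<subseteq> A"
  shows "\<exists>m\<in>C. \<forall>c\<in>C. (m, c) \<in> R"
  using assms(2-4)
proof (induction C rule: finite_ne_induct)
  case (singleton x)
  then show ?case
    using assms(1) by (auto simp: linear_order_on_def partial_order_on_def preorder_on_def refl_on_def)
next
  case (insert x F)
  then obtain m where m: "m \<in> F" "\<forall>c\<in>F. (m, c) \<in> R" by auto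
  have refl: "(x, x) \<in> R" and tr: "trans R" and tot: "total_on A R"
    using assms(1) insert.prems
    by (auto simp: linear_order_on_def partial_order_on_def preorder_on_def refl_on_def)
  have "(x, m) \<in> R \<or> (m, x) \<in> R"
    using tot m(1) insert by (auto simp: total_on_def)
  then show ?case
  proof
    assume xm: "(x, m) \<in> R"
    then have "\<forall>c\<in>insert x F. (x, c) \<in> R"
      using m refl tr by (auto dest: transD)
    then show ?thesis by blast
  next
    assume "(m, x) \<in> R"
    then show ?thesis using m by blast
  qed
qed

lemma linear_order_antisym:
  "linear_order_on A R \<Longrightarrow> (x, y) \<in> R \<Longrightarrow> (y, x) \<in> R \<Longrightarrow> x = y"
  by (auto simp: linear_order_on_def partial_order_on_def antisym_def)

lemma min_wrt_eqI:
  assumes "linear_order_on A R" "m \<in> C" "\<And>c. c \<in> C \<Longrightarrow> (m, c) \<in> R"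
  shows "min_wrt R C = m"
  unfolding min_wrt_def using assms linear_order_antisym[OF assms(1)] by (intro the_equality) auto

lemma min_wrt:
  assumes "linear_order_on A R" "finite C" "C \<noteq> {}" "C \<subseteq> A"
  shows "min_wrt R C \<in> C" "c \<in> C \<Longrightarrow> (min_wrt R C, c) \<in> R"
proof -
  obtain m where m: "m \<in> C" "\<forall>c\<in>C. (m, c) \<in> R" using linear_order_min[OF assms] by auto
  then have "min_wrt R C = m" by (intro min_wrt_eqI[OF assms(1)]) auto
  then show "min_wrt R C \<in> C" "c \<in> C \<Longrightarrow> (min_wrt R C, c) \<in> R" using m by auto
qed

section \<open>Products of differences, as lists of pairs\<close>

definition support :: "('a \<times> 'a) list \<Rightarrow> 'a set" where
  "support ps = fst ` set ps \<union> snd ` set ps"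

text \<open>Only first components must be new; a second component may be repeated, as in the
  boundary of a simplex, where all pairs share the same one. This already ensures that the product
  is nonzero.\<close>

fun fresh_pairs :: "('a \<times> 'a) list \<Rightarrow> bool" where
  "fresh_pairs [] = True"
| "fresh_pairs ((z, b) # ps) \<longleftrightarrow> z \<noteq> b \<and> z \<notin> support ps \<and> fresh_pairs ps"

text \<open>These sets carry the terms of the expanded product. A choice that repeats an element
  yields a set smaller than the number of pairs; its term vanishes in the exterior algebra.\<close>

fun transversals :: "('a \<times> 'a) list \<Rightarrow> 'a set set" where
  "transversals [] = {{}}"
| "transversals ((z, b) # ps) = insert z ` transversals ps \<union> insert b ` transversals ps"

lemma support_simps [simp]: "support [] = {}" "support ((z, b) # ps) = insert z (insert b (support ps))"
  by (auto simp: support_def)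

lemma transversal_subset: "T \<in> transversals ps \<Longrightarrow> T \<subseteq> support ps"
  by (induction ps arbitrary: T rule: transversals.induct) force+

text \<open>Pairs \<open>(z\<^sub>i, b\<^sub>i)\<close> such that \<open>(z\<^sub>1 - b\<^sub>1) \<and> \<dots> \<and> (z\<^sub>k - b\<^sub>k)\<close> is a nonzero cycle of the
  broken circuit complex with the cone point removed. Peeling off the largest element \<open>z\<close>:
  when the deletion of \<open>z\<close> is disconnected, the cycle of the contraction bounds a cone in the
  deletion whose apex is the least element of the component that misses the cone point.\<close>

lemma cycle_pairs:
  assumes "matroid M" "linear_order_on A R" "ground M \<subseteq> A" "connected_matroid M"
    "0 < rk M (ground M)" "ground M \<noteq> {}"
  shows "\<exists>ps. length ps + 1 = rk M (ground M) \<and> fresh_pairs ps \<and>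
    support ps \<subseteq> ground M - {min_wrt R (ground M)} \<and>
    transversals ps \<subseteq> broken_circuit_complex M R"
  using assms
proof (induction "card (ground M)" arbitrary: M rule: less_induct)
  case less
  interpret matroid M by fact
  note lin = less.prems(2) and gA = less.prems(3) and conn = less.prems(4)
  define E where "E = ground M"
  have E: "finite E" "E \<noteq> {}" "E \<subseteq> A"
    using less.prems finite_ground by (auto simp: E_def)
  define a where "a = min_wrt R E"
  have a: "a \<in> E" "\<And>c. c \<in> E \<Longrightarrow> (a, c) \<in> R"
    using min_wrt[OF lin E] by (auto simp: a_def)
  have indep_sing: "{x} \<in> indeps M" if "x \<in> E" for x
  proof (cases "E = {x}")
    case True
    then have "rk M {x} = 1"
      using less.prems(5) rk_le_card[of "{x}"] by (auto simp: E_def)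
    then show ?thesis using indep_if_rk[of "{x}"] by auto
  next
    case False
    then show ?thesis using connected_loopless[OF conn] that by (auto simp: E_def)
  qed
  have cmin: "min_wrt R C \<in> C" "\<And>c. c \<in> C \<Longrightarrow> (min_wrt R C, c) \<in> R" if "C \<in> circuits M" for C
  proof -
    have "finite C" "C \<noteq> {}" "C \<subseteq> A"
      using that finite_circuit circuit_nonempty circuit_subset_ground gA by blast+
    then show "min_wrt R C \<in> C" "\<And>c. c \<in> C \<Longrightarrow> (min_wrt R C, c) \<in> R"
      using min_wrt[OF lin] by blast+
  qed
  have not_sing: "C \<noteq> {x}" if "C \<in> circuits M" for C x
    using that indep_sing[of x] circuit_subset_ground[OF that] circuit_not_indep[OF that]
    by (auto simp: E_def)
  show ?case
  proof (cases "E = {a}")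
    case True
    have "rk M (ground M) = 1"
      using True less.prems(5) rk_le_card[of "{a}"] by (simp add: E_def)
    \<comment> \<open>In rank 1 the cycle is the empty product, with \<open>{}\<close> as its only
      transversal. This is a face because no circuit is a singleton.\<close>
    moreover have "\<not> broken_circuit R C \<subseteq> {}" if "C \<in> circuits M" for C
      using cmin(1)[OF that] not_sing[OF that] by (auto simp: broken_circuit_def)
    ultimately show ?thesis
      by (intro exI[of _ "[]"]) (auto simp: broken_circuit_complex_def)
  next
    case False
    have "linear_order_on A (R\<inverse>)" using lin by simp
    from linear_order_min[OF this E] obtain z where z: "z \<in> E" "\<And>c. c \<in> E \<Longrightarrow> (c, z) \<in> R"
      by auto
    have za: "z \<noteq> a"
    proof
      assume "z = a"
      then have "c = a" if "c \<in> E" for c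
        using z(2)[OF that] a(2)[OF that] linear_order_antisym[OF lin] by auto
      then have "E = {a}" using a(1) by blast
      then show False using False by simp
    qed
    have Ene: "ground M \<noteq> {z}" using za a(1) by (auto simp: E_def)
    define N where "N = restriction M (E - {z})"
    have N: "matroid N" "ground N = E - {z}"
      using matroid_restriction[of "E - {z}"] by (simp_all add: N_def E_def, simp add: restriction_def)
    have rkN: "rk N X = rk M X" if "X \<subseteq> E - {z}" for X
      unfolding N_def using that by (rule rk_restriction)
    have rE: "rk M (E - {z}) = rk M E"
      using connected_no_coloop[OF conn _ Ene] z(1) by (simp add: E_def)
    have minz: "min_wrt R (E - {z}) = a"
      using a za by (intro min_wrt_eqI[OF lin]) auto
    \<comment> \<open>The reason for peeling off the largest element: a circuit through
      \<open>z\<close> whose broken circuit avoids \<open>z\<close> would have \<open>z\<close> as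
      its minimum and hence be \<open>{z}\<close>. So the relevant circuits survive in the
      deletion.\<close>
    have zC: "C \<subseteq> E - {z}" if "C \<in> circuits M" "broken_circuit R C \<subseteq> T" "z \<notin> T" for C T
    proof -
      have "z \<notin> C"
      proof
        assume zC: "z \<in> C"
        then have "z = min_wrt R C" using that by (auto simp: broken_circuit_def)
        then have "c = z" if "c \<in> C" for c
          using cmin(2)[OF \<open>C \<in> circuits M\<close> that] z(2)[of c] that
            circuit_subset_ground[OF \<open>C \<in> circuits M\<close>] linear_order_antisym[OF lin, of c z]
          by (auto simp: E_def)
        then have "C = {z}" using zC by blast
        then show False using not_sing[OF that(1), of z] by simp
      qed
      then show ?thesis using circuit_subset_ground[OF that(1)] by (auto simp: E_def)
    qed
    show ?thesis
    proof (cases "connected_matroid N")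
      case True
      have "card (ground N) < card (ground M)"
        using z(1) E(1) unfolding N(2) E_def[symmetric] by (intro psubset_card_mono) auto
      then obtain ps where ps: "length ps + 1 = rk N (ground N)" "fresh_pairs ps"
        "support ps \<subseteq> ground N - {min_wrt R (ground N)}"
        "transversals ps \<subseteq> broken_circuit_complex N R"
        using less.hyps[OF _ N(1) lin _ True] gA rE rkN[of "E - {z}"] less.prems(5) za a(1)
        unfolding N(2) E_def[symmetric] by auto
      have "T \<in> broken_circuit_complex M R" if "T \<in> transversals ps" for T
      proof -
        have T: "T \<in> broken_circuit_complex N R" using that ps(4) by auto
        then have TE: "T \<subseteq> E - {z}" by (auto simp: broken_circuit_complex_def N(2))
        have "\<not> broken_circuit R C \<subseteq> T" if C: "C \<in> circuits M" for C
        proof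
          assume bT: "broken_circuit R C \<subseteq> T"
          then have "C \<subseteq> E - {z}" using zC[OF C] TE by auto
          then have "C \<in> circuits N"
            using C circuits_restriction[of "E - {z}"] by (auto simp: N_def E_def)
          then show False using T bT by (auto simp: broken_circuit_complex_def)
        qed
        then show ?thesis using TE by (auto simp: broken_circuit_complex_def E_def)
      qed
      then show ?thesis
        using ps rE rkN[of "E - {z}"] minz unfolding N(2) E_def[symmetric] a_def[symmetric]
        by (intro exI[of _ ps]) auto
    next
      case False
      then obtain A' B' where AB': "A' \<union> B' = E - {z}" "A' \<inter> B' = {}" "A' \<noteq> {}" "B' \<noteq> {}"
        "rk N A' + rk N B' \<le> rk N (ground N)"
        unfolding connected_matroid_def N(2) by (auto simp: not_less)
      \<comment> \<open>\<open>A1\<close> is the side containing the cone point \<open>a\<close>;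
        the apex chosen in \<open>B1\<close> is then different from \<open>a\<close>.\<close>
      define A1 where "A1 = (if a \<in> A' then A' else B')"
      define B1 where "B1 = (if a \<in> A' then B' else A')"
      have AB: "A1 \<union> B1 = E - {z}" "A1 \<inter> B1 = {}" "A1 \<noteq> {}" "B1 \<noteq> {}" "a \<in> A1" "a \<notin> B1"
        "rk N A1 + rk N B1 \<le> rk N (ground N)"
        using AB' za a(1) unfolding A1_def B1_def by (auto simp: add.commute)
      have sep: "rk M A1 + rk M B1 \<le> rk M (E - {z})"
      proof -
        have "A1 \<subseteq> E - {z}" "B1 \<subseteq> E - {z}" using AB(1) by auto
        then show ?thesis using AB(7) rkN[of A1] rkN[of B1] rkN[of "E - {z}"] by (simp add: N(2))
      qed
      define L where "L = contraction M z"
      have zi: "{z} \<in> indeps M" using indep_sing z(1) .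
      have L: "matroid L" "ground L = E - {z}"
        unfolding L_def using matroid_contraction[OF zi] by (auto simp: contraction_def E_def)
      interpret L: matroid L by (rule L(1))
      have connL: "connected_matroid L"
        unfolding L_def using connected_deletion_or_contraction[OF conn _ zi, of A1 B1] AB sep z(1)
        unfolding E_def by simp
      have rkL: "rk M E = Suc (rk L (E - {z}))"
        using rk_contraction[OF zi, of "E - {z}"] z(1) by (simp add: L_def insert_absorb)
      define b where "b = min_wrt R B1"
      have B1: "finite B1" "B1 \<subseteq> A" using AB(1) E by (auto intro: finite_subset[of B1 E])
      have b: "b \<in> B1" "\<And>c. c \<in> B1 \<Longrightarrow> (b, c) \<in> R"
        using min_wrt[OF lin B1(1) AB(4) B1(2)] by (auto simp: b_def)
      \<comment> \<open>The two sides together have rank at least 2, so the contraction keeps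
        positive rank and the induction hypothesis applies to it.\<close>
      have "1 \<le> rk M A1" "1 \<le> rk M B1"
        using rk_ge[OF indep_sing, of a A1] rk_ge[OF indep_sing, of b B1] a(1) AB(1,5) b(1) by auto
      then have "0 < rk L (ground L)" using sep rkL rE L(2) by simp
      moreover have "card (ground L) < card (ground M)"
        using z(1) E(1) unfolding L(2) E_def[symmetric] by (intro psubset_card_mono) auto
      ultimately obtain ps where ps: "length ps + 1 = rk L (ground L)" "fresh_pairs ps"
        "support ps \<subseteq> ground L - {min_wrt R (ground L)}"
        "transversals ps \<subseteq> broken_circuit_complex L R"
        using less.hyps[OF _ L(1) lin _ connL] gA za a(1)
        unfolding L(2) E_def[symmetric] by auto
      have zT: "insert z T \<in> broken_circuit_complex M R" if "T \<in> transversals ps" for T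
      proof -
        have T: "T \<in> broken_circuit_complex L R" using that ps(4) by auto
        then have TE: "T \<subseteq> E - {z}" by (auto simp: broken_circuit_complex_def L(2))
        have "\<not> broken_circuit R C \<subseteq> insert z T" if C: "C \<in> circuits M" for C
        proof
          assume bT: "broken_circuit R C \<subseteq> insert z T"
          have "C - {z} \<notin> indeps L"
            using circuit_not_indep[OF C] indep_mono[of "insert z (C - {z})" C]
            unfolding L_def contraction_indep by auto
          moreover have "C - {z} \<subseteq> ground L"
            using circuit_subset_ground[OF C] by (auto simp: L(2) E_def)
          ultimately obtain D where D: "D \<in> circuits L" "D \<subseteq> C - {z}"
            using L.contains_circuit by metis
          \<comment> \<open>If the minimum of \<open>C\<close> belongs to \<open>D\<close>, it is
            also the minimum of \<open>D\<close>; otherwise \<open>D\<close> avoids it altogether.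
            In both cases passing to \<open>D\<close> only shrinks the broken circuit.\<close>
          have "broken_circuit R D \<subseteq> broken_circuit R C - {z}"
          proof (cases "min_wrt R C \<in> D")
            case True
            then have "min_wrt R D = min_wrt R C"
              using D(2) cmin(2)[OF C] by (intro min_wrt_eqI[OF lin]) auto
            then show ?thesis using D(2) by (auto simp: broken_circuit_def)
          next
            case False
            then show ?thesis using D(2) by (auto simp: broken_circuit_def)
          qed
          then have "broken_circuit R D \<subseteq> T" using bT by auto
          then show False using T D(1) by (auto simp: broken_circuit_complex_def)
        qed
        then show ?thesis using TE z(1) by (auto simp: broken_circuit_complex_def E_def)
      qed
      \<comment> \<open>A circuit that avoids \<open>z\<close> lies on one side of the separation.
        On the side \<open>B1\<close> its broken circuit cannot contain the least element
        \<open>b\<close>, and on the other side \<open>b\<close> does not occur. So \<open>b\<close>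
        never helps to complete a broken circuit, and facehood follows from that of
        \<open>insert z T\<close>.\<close>
      have bT: "insert b T \<in> broken_circuit_complex M R" if "T \<in> transversals ps" for T
      proof -
        have TE: "T \<subseteq> E - {z}"
          using that ps(4) by (auto simp: broken_circuit_complex_def L(2))
        have "\<not> broken_circuit R C \<subseteq> insert b T" if C: "C \<in> circuits M" for C
        proof
          assume bC: "broken_circuit R C \<subseteq> insert b T"
          have "z \<notin> insert b T" using TE b(1) AB(1) by auto
          then have "C \<subseteq> A1 \<union> B1" using zC[OF C bC] AB(1) by auto
          then have "C \<subseteq> A1 \<or> C \<subseteq> B1"
            using separated_circuit[OF C] sep AB(1,2) by simp
          then have "b \<notin> broken_circuit R C"
          proof
            assume "C \<subseteq> A1"
            then show ?thesis using b(1) AB(2) by (auto simp: broken_circuit_def)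
          next
            assume CB: "C \<subseteq> B1"
            show ?thesis
            proof
              assume "b \<in> broken_circuit R C"
              then have "b \<in> C" "b \<noteq> min_wrt R C" by (auto simp: broken_circuit_def)
              moreover have "min_wrt R C = b"
                using b CB \<open>b \<in> C\<close> by (intro min_wrt_eqI[OF lin]) auto
              ultimately show False by simp
            qed
          qed
          then have "broken_circuit R C \<subseteq> insert z T" using bC by auto
          then show False using zT[OF \<open>T \<in> transversals ps\<close>] C by (auto simp: broken_circuit_complex_def)
        qed
        then show ?thesis using TE b(1) AB(1) by (auto simp: broken_circuit_complex_def E_def)
      qed
      have "length ((z, b) # ps) + 1 = rk M (ground M)"
        using ps(1) rkL by (simp add: L(2) E_def)
      moreover have "fresh_pairs ((z, b) # ps)"
        using ps(2,3) b(1) AB(1) by (auto simp: L(2))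
      moreover have "support ((z, b) # ps) \<subseteq> ground M - {min_wrt R (ground M)}"
        using ps(3) minz z(1) za b(1) AB(1,6) unfolding L(2) a_def[symmetric] E_def[symmetric] by auto
      moreover have "transversals ((z, b) # ps) \<subseteq> broken_circuit_complex M R"
        using zT bT by auto
      ultimately show ?thesis by blast
    qed
  qed
qed

section \<open>Matroids whose broken circuit complex has homology in one dimension\<close>

lemma transversals_append:
  "X \<in> transversals (ps @ qs) \<Longrightarrow> \<exists>T\<in>transversals ps. \<exists>U\<in>transversals qs. X = T \<union> U"
proof (induction ps arbitrary: X rule: transversals.induct)
  case (2 z b ps)
  from "2.prems" obtain x Y where Y: "X = insert x Y" "x \<in> {z, b}" "Y \<in> transversals (ps @ qs)"
    by auto
  then obtain T U where "T \<in> transversals ps" "U \<in> transversals qs" "Y = T \<union> U"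
    using "2.IH"(1)[of Y] by blast
  then show ?case
    using Y by (intro bexI[of _ "insert x T"] bexI[of _ U]) auto
qed simp

lemma support_append [simp]: "support (ps @ qs) = support ps \<union> support qs"
  by (auto simp: support_def)

lemma fresh_pairs_append:
  "fresh_pairs ps \<Longrightarrow> fresh_pairs qs \<Longrightarrow> support ps \<inter> support qs = {} \<Longrightarrow> fresh_pairs (ps @ qs)"
  by (induction ps rule: fresh_pairs.induct) auto

text \<open>The boundary of the simplex on \<open>F\<close> is \<open>\<And>\<^sub>u (u - u\<^sub>0)\<close>, where \<open>u\<close> runs over \<open>F - {u\<^sub>0}\<close>.\<close>

lemma boundary_pairs:
  assumes "finite F" "F \<noteq> {}"
  obtains ps where "fresh_pairs ps" "support ps \<subseteq> F" "length ps + 1 = card F"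
    "\<And>T. T \<in> transversals ps \<Longrightarrow> T \<subset> F"
proof -
  obtain u where u: "u \<in> F" using assms by auto
  obtain us where us: "set us = F - {u}" "distinct us"
    using assms(1) finite_distinct_list[of "F - {u}"] by auto
  \<comment> \<open>The bound on \<open>card T\<close> is what makes every transversal a proper
    subset: there is one pair fewer than there are elements.\<close>
  have *: "fresh_pairs (map (\<lambda>v. (v, u)) vs) \<and> support (map (\<lambda>v. (v, u)) vs) \<subseteq> insert u (set vs) \<and>
    (\<forall>T\<in>transversals (map (\<lambda>v. (v, u)) vs). T \<subseteq> insert u (set vs) \<and> card T \<le> length vs)"
    if "distinct vs" "u \<notin> set vs" for vs
    using that
  proof (induction vs)
    case (Cons v vs)
    then have IH: "fresh_pairs (map (\<lambda>v. (v, u)) vs)" "support (map (\<lambda>v. (v, u)) vs) \<subseteq> insert u (set vs)"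
      "\<And>T. T \<in> transversals (map (\<lambda>v. (v, u)) vs) \<Longrightarrow> T \<subseteq> insert u (set vs) \<and> card T \<le> length vs"
      by auto
    have "card (insert x T) \<le> Suc (length vs)" if "T \<in> transversals (map (\<lambda>v. (v, u)) vs)" for x T
      using IH(3)[OF that] card_insert_le_m1[of "Suc (length vs)" T x] by auto
    then show ?case using IH Cons.prems by fastforce
  qed auto
  have uns: "u \<notin> set us" using us by auto
  note ** = *[OF us(2) uns]
  have ins: "insert u (set us) = F" using us u by auto
  have cF: "length us + 1 = card F"
    using us u assms(1) by (metis Suc_eq_plus1 card.remove distinct_card)
  show thesis
  proof
    show "fresh_pairs (map (\<lambda>v. (v, u)) us)" "support (map (\<lambda>v. (v, u)) us) \<subseteq> F"
      using ** ins by auto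
    show "length (map (\<lambda>v. (v, u)) us) + 1 = card F" using cF by simp
    fix T assume "T \<in> transversals (map (\<lambda>v. (v, u)) us)"
    then have "T \<subseteq> F" "card T \<le> length us" using ** unfolding ins by auto
    then show "T \<subset> F" using cF by auto
  qed
qed

text \<open>The combinatorial shadow of a \<open>p\<close>-linear resolution: a nonzero top-dimensional cycle on
  sets with \<open>k\<close> elements in an induced subcomplex forces \<open>p = k + 1\<close>.\<close>

definition cycles_in_degree :: "'a set \<Rightarrow> 'a set set \<Rightarrow> nat \<Rightarrow> bool" where
  "cycles_in_degree V \<Delta> p \<longleftrightarrow>
     (\<forall>W ps. W \<subseteq> V \<longrightarrow> fresh_pairs ps \<longrightarrow> support ps \<subseteq> W \<longrightarrow> transversals ps \<subseteq> \<Delta> \<longrightarrow>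
        length ps < card W \<longrightarrow> (\<forall>F\<subseteq>W. card F = length ps + 1 \<longrightarrow> F \<notin> \<Delta>) \<longrightarrow> p = length ps + 1)"

lemma cycles_in_degreeD:
  assumes "cycles_in_degree V \<Delta> p" "W \<subseteq> V" "fresh_pairs ps" "support ps \<subseteq> W" "transversals ps \<subseteq> \<Delta>"
    "length ps < card W" "\<And>F. F \<subseteq> W \<Longrightarrow> card F = length ps + 1 \<Longrightarrow> F \<notin> \<Delta>"
  shows "p = length ps + 1"
  using assms unfolding cycles_in_degree_def by blast

definition minimal_nonface :: "'a set \<Rightarrow> 'a set set \<Rightarrow> 'a set \<Rightarrow> bool" where
  "minimal_nonface V \<Delta> F \<longleftrightarrow> F \<subseteq> V \<and> F \<notin> \<Delta> \<and> (\<forall>G. G \<subset> F \<longrightarrow> G \<in> \<Delta>)"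

lemma obtain_minimal_nonface:
  assumes "finite G" "G \<subseteq> V" "G \<notin> \<Delta>"
  obtains F where "F \<subseteq> G" "minimal_nonface V \<Delta> F"
proof -
  have "\<exists>F\<subseteq>G. minimal_nonface V \<Delta> F"
    using assms
  proof (induction G rule: finite_psubset_induct)
    case (psubset G)
    show ?case
    proof (cases "\<forall>H. H \<subset> G \<longrightarrow> H \<in> \<Delta>")
      case True
      then show ?thesis using psubset.prems by (auto simp: minimal_nonface_def)
    next
      case False
      then obtain H where H: "H \<subset> G" "H \<notin> \<Delta>" by auto
      then have "\<exists>F\<subseteq>H. minimal_nonface V \<Delta> F" using psubset.IH[of H] psubset.prems by auto
      then show ?thesis using H by blast
    qed
  qed
  then show thesis using that by metis
qed

text \<open>With \<open>W = F\<close>, the only subset of \<open>W\<close> that is large enough to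
  violate the condition on faces is \<open>F\<close> itself, which is a nonface.\<close>

lemma minimal_nonface_card:
  assumes lin: "cycles_in_degree V \<Delta> p" and F: "minimal_nonface V \<Delta> F" "finite F" "F \<noteq> {}"
  shows "card F = p"
proof -
  obtain ps where ps: "fresh_pairs ps" "support ps \<subseteq> F" "length ps + 1 = card F"
    "\<And>T. T \<in> transversals ps \<Longrightarrow> T \<subset> F"
    using boundary_pairs[OF F(2,3)] by metis
  have "p = length ps + 1"
  proof (rule cycles_in_degreeD[OF lin _ ps(1,2)])
    show "F \<subseteq> V" using F(1) by (simp add: minimal_nonface_def)
    show "transversals ps \<subseteq> \<Delta>" using ps(4) F(1) by (auto simp: minimal_nonface_def)
    show "length ps < card F" using ps(3) by simp
    show "G \<notin> \<Delta>" if "G \<subseteq> F" "card G = length ps + 1" for G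
      using card_subset_eq[OF F(2) that(1)] that(2) ps(3) F(1) by (simp add: minimal_nonface_def)
  qed
  then show ?thesis using ps(3) by simp
qed

text \<open>\<open>N\<close> is the union of the circuits, so restricting to \<open>N\<close> keeps
  all of them. Minimal nonfaces have exactly \<open>p\<close> elements, but a broken circuit need
  not be a minimal one; hence the circuits only receive a lower bound on their size. The matching
  upper bound is the rank of \<open>N\<close>, found from the cycle of the connected
  matroid.\<close>

theorem uniform_plus_coloops:
  assumes sim: "simple_matroid M" and lin: "linear_order_on (ground M) R"
    and ne: "circuits M \<noteq> {}" and deg: "cycles_in_degree (ground M) (broken_circuit_complex M R) p"
  shows "2 \<le> p \<and> (\<exists>N\<subseteq>ground M. card N + rk M (ground M) = card (ground M) + p \<and>
    (\<forall>X\<subseteq>ground M. X \<in> indeps M \<longleftrightarrow> card (X \<inter> N) \<le> p))"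
proof -
  have M: "matroid M" and simp: "\<And>C. C \<in> circuits M \<Longrightarrow> 3 \<le> card C"
    using sim by (auto simp: simple_matroid_def)
  interpret matroid M by (rule M)
  define E where "E = ground M"
  define \<Delta> where "\<Delta> = broken_circuit_complex M R"
  note deg = deg[folded E_def \<Delta>_def]
  have fE: "finite E" using finite_ground by (simp add: E_def)
  have cE: "C \<subseteq> E" "finite C" "C \<noteq> {}" if "C \<in> circuits M" for C
    using that circuit_subset_ground finite_circuit circuit_nonempty by (auto simp: E_def)
  have cmin: "min_wrt R C \<in> C" if "C \<in> circuits M" for C
    using min_wrt(1)[OF lin] cE[OF that] by (simp add: E_def)
  have bcE: "broken_circuit R C \<subseteq> C" for C by (auto simp: broken_circuit_def)
  have card_bc: "card (broken_circuit R C) + 1 = card C" if "C \<in> circuits M" for C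
    using cmin[OF that] cE[OF that] by (simp add: broken_circuit_def card_Suc_Diff1 card_gt_0_iff)
  have face: "F \<in> \<Delta> \<longleftrightarrow> F \<subseteq> E \<and> (\<forall>C\<in>circuits M. \<not> broken_circuit R C \<subseteq> F)" for F
    by (simp add: \<Delta>_def E_def broken_circuit_complex_def)
  have face_indep: "F \<in> indeps M" if "F \<in> \<Delta>" for F
  proof -
    have "F \<subseteq> ground M" using that by (auto simp: face E_def)
    moreover have "\<not> C \<subseteq> F" if "C \<in> circuits M" for C
      using \<open>F \<in> \<Delta>\<close> that bcE[of C] unfolding face by blast
    ultimately show ?thesis using indep_iff_no_circuit by simp
  qed
  have obt: "\<exists>F. F \<subseteq> broken_circuit R C \<and> minimal_nonface E \<Delta> F" if "C \<in> circuits M" for C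
  proof (rule obtain_minimal_nonface[of "broken_circuit R C" E \<Delta>])
    show "finite (broken_circuit R C)" "broken_circuit R C \<subseteq> E"
      using cE[OF that] bcE[of C] by (auto intro: finite_subset)
    show "broken_circuit R C \<notin> \<Delta>" using that by (auto simp: face)
  qed auto
  \<comment> \<open>Simplicity enters here: circuits have at least three elements, so broken
    circuits have at least two, and \<open>2 \<le> p\<close>.\<close>
  have mnf: "finite F \<and> F \<noteq> {} \<and> card F = p \<and> 2 \<le> p" if F: "minimal_nonface E \<Delta> F" for F
  proof -
    have "F \<subseteq> E" "F \<notin> \<Delta>" using F by (auto simp: minimal_nonface_def)
    then obtain C where C: "C \<in> circuits M" "broken_circuit R C \<subseteq> F" by (auto simp: face)
    have fin: "finite F" using \<open>F \<subseteq> E\<close> fE finite_subset by auto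
    have "2 \<le> card F"
      using card_bc[OF C(1)] simp[OF C(1)] card_mono[OF fin C(2)] by linarith
    moreover from this have "F \<noteq> {}" by auto
    ultimately show ?thesis using minimal_nonface_card[OF deg F fin] fin by auto
  qed
  have circ_card: "p + 1 \<le> card C" if C: "C \<in> circuits M" for C
  proof -
    obtain F where F: "F \<subseteq> broken_circuit R C" "minimal_nonface E \<Delta> F" using obt[OF C] by auto
    have "finite (broken_circuit R C)" using cE(2)[OF C] bcE[of C] finite_subset by blast
    then show ?thesis using card_mono[OF _ F(1)] mnf[OF F(2)] card_bc[OF C] by simp
  qed
  have p2: "2 \<le> p" using ne obt mnf by blast
  define N where "N = \<Union>(circuits M)"
  have NE: "N \<subseteq> E" using cE(1) by (auto simp: N_def)
  have fN: "finite N" using NE fE finite_subset by auto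
  have CN: "C \<subseteq> N" if "C \<in> circuits M" for C using that by (auto simp: N_def)
  define L where "L = restriction M N"
  have L: "matroid L" "ground L = N" "circuits L = circuits M"
    using matroid_restriction[of N] circuits_restriction[of N] NE CN
    by (auto simp: L_def E_def, simp_all add: restriction_def)
  have rkL: "rk L X = rk M X" if "X \<subseteq> N" for X
    using that by (simp add: L_def rk_restriction)
  have conn: "connected_matroid L"
  proof (rule ccontr)
    assume "\<not> connected_matroid L"
    then obtain A B where AB: "A \<union> B = N" "A \<inter> B = {}" "A \<noteq> {}" "B \<noteq> {}" "rk L A + rk L B \<le> rk L N"
      unfolding connected_matroid_def L(2) by (auto simp: not_less)
    have AN: "A \<subseteq> N" "B \<subseteq> N" using AB(1) by auto
    have "rk M A + rk M B \<le> rk M (A \<union> B)"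
      using AB(5) rkL[OF AN(1)] rkL[OF AN(2)] rkL[of N] AB(1) by simp
    then have sep: "C \<subseteq> A \<or> C \<subseteq> B" if "C \<in> circuits M" for C
      using separated_circuit[OF that _ _ AB(2)] CN[OF that] AB(1) by simp
    \<comment> \<open>Every element of \<open>N\<close> lies in a circuit, and a circuit stays on
      one side; so each nonempty side contains a broken circuit and thus a minimal nonface.\<close>
    have ex: "\<exists>F. F \<subseteq> X \<and> minimal_nonface E \<Delta> F"
      if X: "X \<noteq> {}" "X \<subseteq> N" "X \<inter> Y = {}" "\<And>C. C \<in> circuits M \<Longrightarrow> C \<subseteq> X \<or> C \<subseteq> Y" for X Y
    proof -
      obtain x where "x \<in> X" using X(1) by auto
      moreover then have "x \<in> \<Union>(circuits M)" using X(2) by (auto simp: N_def)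
      ultimately obtain C where x: "x \<in> X" "x \<in> C" "C \<in> circuits M" by auto
      then have "C \<subseteq> X" using X(3,4) by blast
      moreover obtain F where "F \<subseteq> broken_circuit R C" "minimal_nonface E \<Delta> F"
        using obt[OF x(3)] by auto
      ultimately show ?thesis using bcE[of C] by blast
    qed
    obtain U where U: "U \<subseteq> A" "minimal_nonface E \<Delta> U" using ex[of A B] AB AN sep by auto
    obtain V where V: "V \<subseteq> B" "minimal_nonface E \<Delta> V" using ex[of B A] AB AN sep by (metis Int_commute)
    note U' = mnf[OF U(2)] and V' = mnf[OF V(2)]
    obtain ps where ps: "fresh_pairs ps" "support ps \<subseteq> U" "length ps + 1 = card U"
      "\<And>T. T \<in> transversals ps \<Longrightarrow> T \<subset> U"
      using boundary_pairs[of U] U' by metis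
    obtain qs where qs: "fresh_pairs qs" "support qs \<subseteq> V" "length qs + 1 = card V"
      "\<And>T. T \<in> transversals qs \<Longrightarrow> T \<subset> V"
      using boundary_pairs[of V] V' by metis
    have UV: "U \<inter> V = {}" using U(1) V(1) AB(2) by blast
    have lp: "length ps + 1 = p" "length qs + 1 = p" using ps(3) qs(3) U' V' by linarith+
    have cUV: "card (U \<union> V) = 2 * p" using U' V' UV by (simp add: card_Un_disjoint)
    \<comment> \<open>The two minimal nonfaces have \<open>p\<close> elements each, so their join
      forces \<open>p = 2 * p - 1\<close>, against \<open>2 \<le> p\<close>. Joins of faces are
      faces because no circuit crosses the separation, and a face inside \<open>U \<union> V\<close>
      omits an element of \<open>U\<close> and one of \<open>V\<close>.\<close>
    have "p = length (ps @ qs) + 1"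
    proof (rule cycles_in_degreeD[OF deg])
      show UVE: "U \<union> V \<subseteq> E" using U V by (auto simp: minimal_nonface_def)
      have "support ps \<inter> support qs = {}" using ps(2) qs(2) UV by blast
      then show "fresh_pairs (ps @ qs)" using ps(1) qs(1) by (intro fresh_pairs_append)
      show "support (ps @ qs) \<subseteq> U \<union> V" using ps(2) qs(2) by auto
      show "length (ps @ qs) < card (U \<union> V)" using lp cUV unfolding length_append by linarith
      show "transversals (ps @ qs) \<subseteq> \<Delta>"
      proof
        fix X assume "X \<in> transversals (ps @ qs)"
        then obtain S T where ST: "X = S \<union> T" "S \<in> transversals ps" "T \<in> transversals qs"
          using transversals_append[of X ps qs] by blast
        have sub: "S \<subset> U" "T \<subset> V" using ps(4) qs(4) ST by auto
        then have faces: "S \<in> \<Delta>" "T \<in> \<Delta>" using U(2) V(2) by (auto simp: minimal_nonface_def)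
        have "\<not> broken_circuit R C \<subseteq> X" if C: "C \<in> circuits M" for C
        proof
          assume b: "broken_circuit R C \<subseteq> X"
          from sep[OF C] show False
          proof
            assume "C \<subseteq> A"
            then have "broken_circuit R C \<subseteq> S" using b ST(1) sub V(1) AB(2) bcE[of C] by blast
            then show False using faces(1) C by (auto simp: face)
          next
            assume "C \<subseteq> B"
            then have "broken_circuit R C \<subseteq> T" using b ST(1) sub U(1) AB(2) bcE[of C] by blast
            then show False using faces(2) C by (auto simp: face)
          qed
        qed
        then show "X \<in> \<Delta>" using sub UVE ST(1) unfolding face by auto
      qed
      show "F \<notin> \<Delta>" if F: "F \<subseteq> U \<union> V" "card F = length (ps @ qs) + 1" for F
      proof
        assume Fd: "F \<in> \<Delta>"
        have down: "G \<in> \<Delta>" if "G \<subseteq> F" for G using Fd that unfolding face by blast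
        have "\<not> U \<subseteq> F" "\<not> V \<subseteq> F" using down U(2) V(2) by (auto simp: minimal_nonface_def)
        then have "F \<inter> U \<subset> U" "F \<inter> V \<subset> V" by auto
        then have "card (F \<inter> U) < card U" "card (F \<inter> V) < card V"
          using psubset_card_mono[of U "F \<inter> U"] psubset_card_mono[of V "F \<inter> V"] U' V' by blast+
        moreover have "card F \<le> card (F \<inter> U) + card (F \<inter> V)"
        proof -
          have "F = F \<inter> U \<union> F \<inter> V" using F(1) by auto
          then show ?thesis using card_Un_le[of "F \<inter> U" "F \<inter> V"] by simp
        qed
        ultimately show False using F(2) ps(3) qs(3) unfolding length_append by linarith
      qed
    qed
    then show False using lp p2 unfolding length_append by linarith
  qed
  obtain C0 where C0: "C0 \<in> circuits M" using ne by auto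
  obtain x where x: "x \<in> C0" using cE(3)[OF C0] by auto
  have "{x} \<subset> C0"
    using x simp[OF C0] card_mono[of "{x}" C0] by auto
  then have "{x} \<in> indeps M" by (rule circuit_psubset_indep[OF C0])
  then have rkpos: "0 < rk M N" using rk_ge[of "{x}" N] x CN[OF C0] by auto
  have Nne: "N \<noteq> {}" using x CN[OF C0] by auto
  have linE: "linear_order_on E R" using lin by (simp add: E_def)
  obtain ps where ps: "length ps + 1 = rk M N" "fresh_pairs ps" "support ps \<subseteq> N - {min_wrt R N}"
    "transversals ps \<subseteq> broken_circuit_complex L R"
    using cycle_pairs[OF L(1) linE _ conn] rkpos Nne NE rkL[of N] unfolding L(2) by auto
  define a where "a = min_wrt R N"
  have a: "a \<in> N" "\<And>c. c \<in> N \<Longrightarrow> (a, c) \<in> R"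
    using min_wrt[OF linE fN Nne NE] by (auto simp: a_def)
  have rkN: "rk M N < card N"
  proof (rule ccontr)
    assume "\<not> rk M N < card N"
    then have "N \<in> indeps M" using indep_if_rk[OF fN] rk_le_card[OF fN] by auto
    then show False using indep_mono[of N C0] CN[OF C0] circuit_not_indep[OF C0] by auto
  qed
  have "p = length ps + 1"
  proof (rule cycles_in_degreeD[OF deg _ ps(2) ps(3)])
    show "N - {min_wrt R N} \<subseteq> E" using NE by auto
    show "transversals ps \<subseteq> \<Delta>"
      using ps(4) NE unfolding \<Delta>_def broken_circuit_complex_def L E_def by blast
    show "length ps < card (N - {min_wrt R N})"
      using rkN ps(1) a(1) fN by (simp add: a_def[symmetric])
    \<comment> \<open>The least element \<open>a\<close> of \<open>N\<close> lies in no broken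
      circuit, so \<open>insert a F\<close> would be a face and therefore independent, although it
      has one element more than the rank of \<open>N\<close>.\<close>
    show "F \<notin> \<Delta>" if F: "F \<subseteq> N - {min_wrt R N}" "card F = length ps + 1" for F
    proof
      assume Fd: "F \<in> \<Delta>"
      have "\<not> broken_circuit R C \<subseteq> insert a F" if C: "C \<in> circuits M" for C
      proof
        assume b: "broken_circuit R C \<subseteq> insert a F"
        have "a \<notin> broken_circuit R C"
        proof
          assume "a \<in> broken_circuit R C"
          then have "a \<in> C" "a \<noteq> min_wrt R C" by (auto simp: broken_circuit_def)
          moreover have "min_wrt R C = a"
            using a(2) CN[OF C] \<open>a \<in> C\<close> by (intro min_wrt_eqI[OF linE]) auto
          ultimately show False by simp
        qed
        then have "broken_circuit R C \<subseteq> F" using b by auto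
        then show False using Fd C by (auto simp: face)
      qed
      then have "insert a F \<in> \<Delta>" using Fd a(1) NE by (auto simp: face)
      then have "insert a F \<in> indeps M" by (rule face_indep)
      moreover have "insert a F \<subseteq> N" using F(1) a(1) by auto
      moreover have "card (insert a F) = rk M N + 1"
      proof -
        have "a \<notin> F" "finite F" using F(1) fN finite_subset[of F N] by (auto simp: a_def[symmetric])
        then show ?thesis using F(2) ps(1) by simp
      qed
      ultimately show False using rk_ge[of "insert a F" N] by simp
    qed
  qed
  then have pN: "p = rk M N" using ps(1) by simp
  have indep: "X \<in> indeps M \<longleftrightarrow> card (X \<inter> N) \<le> p" if X: "X \<subseteq> E" for X
  proof
    assume "X \<in> indeps M"
    then show "card (X \<inter> N) \<le> p" using rk_ge[of "X \<inter> N" N] indep_mono[of X "X \<inter> N"] pN by auto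
  next
    assume le: "card (X \<inter> N) \<le> p"
    show "X \<in> indeps M"
    proof (rule ccontr)
      assume "X \<notin> indeps M"
      then obtain C where C: "C \<in> circuits M" "C \<subseteq> X"
        using X by (auto simp: E_def elim: contains_circuit)
      then have "card C \<le> card (X \<inter> N)" using CN[OF C(1)] fN by (intro card_mono) auto
      then show False using circ_card[OF C(1)] le by simp
    qed
  qed
  \<comment> \<open>All elements outside \<open>N\<close> can be added to a basis of
    \<open>N\<close>; conversely no independent set has more than \<open>p\<close> elements in
    \<open>N\<close>. The additive form avoids truncated subtraction.\<close>
  have "card N + rk M E = card E + p"
  proof (rule antisym)
    obtain B where B: "B \<in> indeps M" "B \<subseteq> E" "card B = rk M E" by (rule obtain_rk)
    have "finite B" using B(1) by (rule finite_indep)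
    have "card B \<le> card (B \<inter> N) + card (E - N)"
    proof -
      have "card B \<le> card ((B \<inter> N) \<union> (E - N))" using B(2) fE fN by (intro card_mono) auto
      then show ?thesis using card_Un_le[of "B \<inter> N" "E - N"] by simp
    qed
    moreover have "card (B \<inter> N) \<le> p" using B(1,2) indep[of B] by auto
    moreover have "card (E - N) + card N = card E"
      using NE fE fN by (simp add: card_Diff_subset card_mono)
    ultimately show "card N + rk M E \<le> card E + p" using B(3) by simp
    obtain J where J: "J \<in> indeps M" "J \<subseteq> N" "card J = rk M N" by (rule obtain_rk)
    have fJ: "finite J" using J(1) by (rule finite_indep)
    have "(J \<union> (E - N)) \<inter> N = J" using J(2) by auto
    then have "J \<union> (E - N) \<in> indeps M"
      using indep[of "J \<union> (E - N)"] J NE pN by auto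
    then have "card (J \<union> (E - N)) \<le> rk M E" using J(2) NE by (intro rk_ge) auto
    moreover have "card (J \<union> (E - N)) = card J + card (E - N)"
      using J(2) fJ fE by (intro card_Un_disjoint) auto
    ultimately show "card E + p \<le> card N + rk M E"
      using J(3) pN \<open>card (E - N) + card N = card E\<close> by simp
  qed
  then show ?thesis using p2 NE indep unfolding E_def by auto
qed

section \<open>Koszul differentials\<close>

text \<open>The sign of sorting \<open>e_j\<close> into its place in front of the larger factors of
  \<open>e_T\<close>, for \<open>j\<close> outside \<open>T\<close>.\<close>

definition ksign :: "nat \<Rightarrow> nat set \<Rightarrow> 'a::comm_ring_1" where
  "ksign j T = (- 1) ^ card {t \<in> T. t < j}"

text \<open>A chain \<open>z\<close> stands for \<open>\<Sum>\<^sub>T z(T) e\<^sub>T\<close>.\<close>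

definition kdiff :: "nat set \<Rightarrow> (nat \<Rightarrow> 'a::comm_ring_1) \<Rightarrow> (nat set \<Rightarrow> 'a) \<Rightarrow> nat set \<Rightarrow> 'a" where
  "kdiff V c z T = (\<Sum>j\<in>V - T. ksign j T * c j * z (insert j T))"

text \<open>Left exterior multiplication by \<open>e_v\<close>, read off at the coefficient of
  \<open>e_T\<close>.\<close>

definition kwedge :: "nat \<Rightarrow> (nat set \<Rightarrow> 'a::comm_ring_1) \<Rightarrow> nat set \<Rightarrow> 'a" where
  "kwedge v z T = (if v \<in> T then ksign v (T - {v}) * z (T - {v}) else 0)"

lemma ksign_insert:
  assumes "finite T" "k \<notin> T"
  shows "ksign j (insert k T) = (if k < j then - ksign j T else ksign j T)"
proof (cases "k < j")
  case True
  then have "{t \<in> insert k T. t < j} = insert k {t \<in> T. t < j}" by auto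
  then show ?thesis using assms True by (simp add: ksign_def)
next
  case False
  then have "{t \<in> insert k T. t < j} = {t \<in> T. t < j}" by auto
  then show ?thesis using False by (simp add: ksign_def)
qed

lemma ksign_square [simp]: "ksign j T * ksign j T = 1"
  by (simp add: ksign_def flip: power_add)

lemma ksign_mult_square [simp]: "ksign j T * (ksign j T * x) = x"
  by (simp flip: mult.assoc)

lemma ksign_cases: "ksign j T = 1 \<or> ksign j T = - 1"
  unfolding ksign_def by (cases "even (card {t \<in> T. t < j})") simp_all

lemma ksign_swap:
  assumes "finite T" "j \<notin> T" "k \<notin> T" "j \<noteq> k"
  shows "ksign j (insert k T) * ksign k (insert j T) = - (ksign j T * ksign k T)"
  using assms by (auto simp: ksign_insert)

lemma kdiff_cong:
  "c = d \<Longrightarrow> (\<And>j. j \<in> V - T \<Longrightarrow> z (insert j T) = w (insert j T)) \<Longrightarrow> kdiff V c z T = kdiff V d w T"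
  by (simp add: kdiff_def)

lemma kdiff_add: "kdiff V c (\<lambda>U. z U + w U) T = kdiff V c z T + kdiff V c w T"
  by (simp add: kdiff_def distrib_left sum.distrib)

lemma kdiff_diff: "kdiff V c (\<lambda>U. z U - w U) T = kdiff V c z T - kdiff V c w T"
  by (simp add: kdiff_def right_diff_distrib sum_subtractf)

lemma kdiff_zero [simp]: "kdiff V c (\<lambda>U. 0) T = 0"
  by (simp add: kdiff_def)

lemma kdiff_sum_mult: "kdiff V c (\<lambda>U. \<Sum>i\<in>I. z i U * f i) T = (\<Sum>i\<in>I. kdiff V c (z i) T * f i)"
  unfolding kdiff_def sum_distrib_left sum_distrib_right
  by (subst sum.swap) (simp add: mult.assoc)

text \<open>The terms for \<open>(j, k)\<close> and \<open>(k, j)\<close> cancel. Splitting the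
  double sum along \<open>j < k\<close> and \<open>k < j\<close> pairs them explicitly; showing that
  the sum equals its negative would fail to conclude in characteristic 2.\<close>

lemma kdiff_kdiff:
  assumes V: "finite V" and T: "finite T"
  shows "kdiff V c (kdiff V c z) T = 0"
proof -
  define f where "f j k = ksign j T * c j * (ksign k (insert j T) * c k * z (insert k (insert j T)))" for j k
  have anti: "f j k = - f k j" if "j \<in> V - T" "k \<in> V - T" "j \<noteq> k" for j k
  proof -
    have "ksign j T * ksign k (insert j T) = - (ksign k T * ksign j (insert k T) :: 'a)"
      using that T by (auto simp: ksign_insert mult.commute)
    then have "ksign j T * ksign k (insert j T) * (c j * c k * z (insert k (insert j T))) =
        - (ksign k T * ksign j (insert k T)) * (c j * c k * z (insert k (insert j T)))"
      by simp
    then show ?thesis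
      unfolding f_def insert_commute[of k j T] by (simp add: mult_ac)
  qed
  have fin: "finite (V - T)" using V by simp
  have "kdiff V c (kdiff V c z) T = (\<Sum>j\<in>V - T. \<Sum>k\<in>V - insert j T. f j k)"
    unfolding kdiff_def f_def by (simp add: sum_distrib_left)
  also have "\<dots> = (\<Sum>j\<in>V - T. \<Sum>k\<in>V - T. if k = j then 0 else f j k)"
  proof (rule sum.cong[OF refl])
    fix j assume j: "j \<in> V - T"
    show "(\<Sum>k\<in>V - insert j T. f j k) = (\<Sum>k\<in>V - T. if k = j then 0 else f j k)"
      using fin by (intro sum.mono_neutral_cong_left) auto
  qed
  also have "\<dots> = (\<Sum>j\<in>V - T. \<Sum>k\<in>V - T. (if j < k then f j k else 0) - (if k < j then f k j else 0))"
  proof (intro sum.cong refl)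
    fix j k assume jk: "j \<in> V - T" "k \<in> V - T"
    show "(if k = j then 0 else f j k) = (if j < k then f j k else 0) - (if k < j then f k j else 0)"
      using anti[OF jk] by (cases j k rule: linorder_cases) auto
  qed
  also have "\<dots> = 0"
    unfolding sum_subtractf by (subst (2) sum.swap) simp
  finally show ?thesis .
qed

text \<open>Wedging with \<open>e_v\<close> as a contracting homotopy. The additive map
  \<open>q\<close> commutes with all coefficients except \<open>c v\<close>. Taking \<open>q\<close>
  as the identity and \<open>c\<close> constantly 1 contracts a simplex; taking \<open>q\<close> as
  \<open>shift v\<close> and \<open>c\<close> as \<open>var\<close> eliminates the variable
  \<open>v\<close> from a Koszul cycle.\<close>

lemma kdiff_kwedge:
  assumes V: "finite V" "v \<in> V" "T \<subseteq> V"
    and q: "\<And>x y. q (x + y) = q x + q y" "\<And>j x. j \<noteq> v \<Longrightarrow> q (c j * x) = c j * q x"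
  shows "kdiff V c (kwedge v (\<lambda>U. q (z U))) T + kwedge v (\<lambda>U. q (kdiff V c z U)) T =
    (if v \<in> T then q (c v * z T) else c v * q (z T))"
proof -
  have q0: "q 0 = 0" using q(1)[of 0 0] by simp
  have qm: "q (- x) = - q x" for x using q(1)[of x "- x"] q0 by (simp add: eq_neg_iff_add_eq_0 add.commute)
  have qs: "q (ksign j U * x) = ksign j U * q x" for j U x
    using ksign_cases[of j U, where 'a = 'a] by (elim disjE) (erule ssubst, simp add: qm)+
  have qsum: "q (sum f A) = (\<Sum>x\<in>A. q (f x))" for f :: "nat \<Rightarrow> 'a" and A
    by (induction A rule: infinite_finite_induct) (auto simp: q0 q(1))
  have fT: "finite T" using V finite_subset by auto
  show ?thesis
  proof (cases "v \<in> T")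
    case True
    define T' where "T' = T - {v}"
    have T': "T = insert v T'" "v \<notin> T'" "finite T'" using True fT by (auto simp: T'_def)
    have V': "V - T' = insert v (V - T)" "finite (V - T)" "v \<notin> V - T"
      using T' V by auto
    have "kwedge v (\<lambda>U. q (kdiff V c z U)) T = ksign v T' * q (kdiff V c z T')"
      using True by (simp add: kwedge_def T'_def)
    also have "kdiff V c z T' = ksign v T' * c v * z T + (\<Sum>j\<in>V - T. ksign j T' * c j * z (insert j T'))"
      unfolding kdiff_def V'(1) using sum.insert[OF V'(2,3), of "\<lambda>j. ksign j T' * c j * z (insert j T')"] by (simp only: T'(1)[symmetric])
    also have "ksign v T' * q \<dots> = q (c v * z T) + ksign v T' * (\<Sum>j\<in>V - T. ksign j T' * (c j * q (z (insert j T'))))"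
    proof -
      have "q (ksign j T' * c j * z (insert j T')) = ksign j T' * (c j * q (z (insert j T')))" if "j \<in> V - T" for j
      proof -
        have "j \<noteq> v" using that V'(3) by metis
        then show ?thesis using q(2)[of j "z (insert j T')"] by (simp add: mult.assoc qs)
      qed
      then have "q (\<Sum>j\<in>V - T. ksign j T' * c j * z (insert j T')) =
          (\<Sum>j\<in>V - T. ksign j T' * (c j * q (z (insert j T'))))"
        unfolding qsum by (rule sum.cong[OF refl])
      then show ?thesis by (simp add: q(1) qs mult.assoc distrib_left)
    qed
    also have "ksign v T' * (\<Sum>j\<in>V - T. ksign j T' * (c j * q (z (insert j T')))) =
        - kdiff V c (kwedge v (\<lambda>U. q (z U))) T"
    proof -
      have "ksign v T' * (ksign j T' * (c j * q (z (insert j T')))) =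
          - (ksign j T * c j * kwedge v (\<lambda>U. q (z U)) (insert j T))" if j: "j \<in> V - T" for j
      proof -
        have jT: "insert j T - {v} = insert j T'" "j \<notin> T'" "j \<noteq> v" using j T' by auto
        have "- (ksign j T * c j * kwedge v (\<lambda>U. q (z U)) (insert j T)) =
            - (ksign j (insert v T') * ksign v (insert j T')) * (c j * q (z (insert j T')))"
          using jT True by (simp add: kwedge_def T'(1)[symmetric] mult_ac)
        then show ?thesis
          using ksign_swap[of T' j v, where 'a = 'a] jT T' by (simp add: mult_ac)
      qed
      then show ?thesis
        unfolding kdiff_def sum_distrib_left sum_negf[symmetric] by (intro sum.cong refl)
    qed
    finally show ?thesis using True by simp
  next
    case False
    have "kdiff V c (kwedge v (\<lambda>U. q (z U))) T = (\<Sum>j\<in>V - T. if j = v then c v * q (z T) else 0)"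
      unfolding kdiff_def
    proof (rule sum.cong[OF refl])
      fix j assume "j \<in> V - T"
      then show "ksign j T * c j * kwedge v (\<lambda>U. q (z U)) (insert j T) = (if j = v then c v * q (z T) else 0)"
        using False by (auto simp: kwedge_def mult_ac)
    qed
    also have "\<dots> = c v * q (z T)" using V False by simp
    finally show ?thesis using False by (simp add: kwedge_def)
  qed
qed

section \<open>Multivariate polynomials\<close>

abbreviation lookup :: "('a \<Rightarrow>\<^sub>0 'b::zero) \<Rightarrow> 'a \<Rightarrow> 'b" where
  "lookup \<equiv> Poly_Mapping.lookup"

abbreviation keys :: "('a \<Rightarrow>\<^sub>0 'b::zero) \<Rightarrow> 'a set" where
  "keys \<equiv> Poly_Mapping.keys"

abbreviation single :: "'a \<Rightarrow> 'b \<Rightarrow> 'a \<Rightarrow>\<^sub>0 'b::zero" where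
  "single \<equiv> Poly_Mapping.single"

abbreviation polys :: "nat \<Rightarrow> 'k::field mpoly set" where
  "polys n \<equiv> carrier (poly_ring n)"

lemma polys_iff: "f \<in> polys n \<longleftrightarrow> (\<forall>m. lookup f m \<noteq> 0 \<longrightarrow> keys m \<subseteq> {1..n})"
  by (auto simp: poly_ring_def in_keys_iff)

lemma polysD: "f \<in> polys n \<Longrightarrow> lookup f m \<noteq> 0 \<Longrightarrow> keys m \<subseteq> {1..n}"
  by (simp add: polys_iff)

lemma polys_0 [simp]: "0 \<in> polys n"
  by (simp add: polys_iff)

lemma polys_1 [simp]: "1 \<in> polys n"
  by (simp add: poly_ring_def)

lemma polys_add [intro]: "f \<in> polys n \<Longrightarrow> g \<in> polys n \<Longrightarrow> f + g \<in> polys n"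
  by (rule poly_ring_add_closed)

lemma polys_mult [intro]: "f \<in> polys n \<Longrightarrow> g \<in> polys n \<Longrightarrow> f * g \<in> polys n"
  by (rule poly_ring_mult_closed)

lemma polys_uminus [intro]: "f \<in> polys n \<Longrightarrow> - f \<in> polys n"
  by (simp add: polys_iff)

lemma polys_diff [intro]: "f \<in> polys n \<Longrightarrow> g \<in> polys n \<Longrightarrow> f - g \<in> polys n"
  using polys_add[OF _ polys_uminus] by fastforce

lemma polys_sum [intro]: "(\<And>i. i \<in> A \<Longrightarrow> f i \<in> polys n) \<Longrightarrow> sum f A \<in> polys n"
  by (induction A rule: infinite_finite_induct) auto

lemma polys_var [intro]: "i \<in> {1..n} \<Longrightarrow> var i \<in> polys n"
  by (simp add: poly_ring_def var_def)

lemma ksign_polys [intro, simp]: "ksign j T \<in> polys n"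
  using ksign_cases[of j T, where 'a = "'a mpoly"] by (elim disjE) (erule ssubst, simp add: polys_uminus)+

lemma kdiff_polys: "(\<And>U. z U \<in> polys n) \<Longrightarrow> kdiff {1..n} var z T \<in> polys n"
  unfolding kdiff_def by (intro polys_sum polys_mult ksign_polys polys_var) auto

lemma lookup_var_mult:
  "lookup (var j * f) m =
    (if lookup m j = 0 then 0 else lookup f (m - single j 1))"
proof -
  let ?x = "single j 1 :: nat \<Rightarrow>\<^sub>0 nat"
  have "lookup (var j * f) m =
      (\<Sum>l. lookup (var j) l * (\<Sum>q. lookup f q when m = l + q))"
    by (rule lookup_mult)
  also have "\<dots> = (\<Sum>l. (\<Sum>q. lookup f q when m = l + q) when ?x = l)"
    unfolding var_def by (rule Sum_any.cong) (simp add: lookup_single when_def)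
  also have "\<dots> = (\<Sum>q. lookup f q when m = ?x + q)"
    by simp
  also have "\<dots> = (if lookup m j = 0 then 0 else lookup f (m - ?x))"
  proof (cases "lookup m j = 0")
    case True
    have "m \<noteq> ?x + q" for q using True by (auto simp: lookup_add)
    then show ?thesis using True by simp
  next
    case False
    have "?x + (m - ?x) = m"
      using False by (intro poly_mapping_eqI) (auto simp: lookup_add lookup_minus lookup_single when_def)
    then have "(m = ?x + q) = (q = m - ?x)" for q by (metis add_diff_cancel_left')
    then show ?thesis using False by simp
  qed
  finally show ?thesis .
qed

text \<open>\<open>shift v f\<close> is the quotient of \<open>f\<close> by \<open>x\<^sub>v\<close>, disregarding the monomials without \<open>x\<^sub>v\<close>.\<close>

definition shift :: "nat \<Rightarrow> 'k::field mpoly \<Rightarrow> 'k mpoly" where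
  "shift v f = Poly_Mapping.map_key (\<lambda>m. m + single v 1) f"

lemma lookup_shift: "lookup (shift v f) m = lookup f (m + single v 1)"
proof -
  have "inj (\<lambda>m :: nat \<Rightarrow>\<^sub>0 nat. m + single v 1)" by (simp add: inj_on_def)
  then show ?thesis by (simp add: shift_def map_key.rep_eq)
qed

lemma shift_add: "shift v (f + g) = shift v f + shift v g"
  by (rule poly_mapping_eqI) (simp add: lookup_shift lookup_add)

lemma shift_var_mult: "shift v (var v * f) = f"
  by (rule poly_mapping_eqI) (simp add: lookup_shift lookup_var_mult lookup_add)

lemma shift_var_mult_other:
  assumes "j \<noteq> v"
  shows "shift v (var j * f) = var j * shift v f"
proof (rule poly_mapping_eqI)
  fix m :: "nat \<Rightarrow>\<^sub>0 nat"
  have "m + single v 1 - single j 1 =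
      m - single j 1 + single v 1" if "lookup m j \<noteq> 0"
    using that assms
    by (intro poly_mapping_eqI) (auto simp: lookup_add lookup_minus lookup_single when_def)
  then show "lookup (shift v (var j * f)) m = lookup (var j * shift v f) m"
    using assms by (simp add: lookup_shift lookup_var_mult lookup_add lookup_single)
qed

lemma polys_shift [intro]:
  assumes "f \<in> polys n"
  shows "shift v f \<in> polys n"
proof -
  have "keys m \<subseteq> {1..n}" if "lookup (shift v f) m \<noteq> 0" for m
  proof -
    have "keys (m + single v 1) \<subseteq> {1..n}"
      using polysD[OF assms] that by (simp add: lookup_shift)
    moreover have "keys m \<subseteq> keys (m + single v 1)"
      by (auto simp: in_keys_iff lookup_add)
    ultimately show ?thesis by blast
  qed
  then show ?thesis by (simp add: polys_iff)
qed

definition part :: "((nat \<Rightarrow>\<^sub>0 nat) \<Rightarrow> bool) \<Rightarrow> 'k::field mpoly \<Rightarrow> 'k mpoly" where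
  "part P f = Poly_Mapping.mapp (\<lambda>m c. if P m then c else 0) f"

lemma lookup_part: "lookup (part P f) m = (if P m then lookup f m else 0)"
  by (simp add: part_def lookup_mapp when_def in_keys_iff)

lemma polys_part [intro]: "f \<in> polys n \<Longrightarrow> part P f \<in> polys n"
  by (simp add: polys_iff lookup_part)

lemma var_mult_shift: "var v * shift v f = part (\<lambda>m. lookup m v \<noteq> 0) f"
proof (rule poly_mapping_eqI)
  fix m :: "nat \<Rightarrow>\<^sub>0 nat"
  have "m - single v 1 + single v 1 = m" if "lookup m v \<noteq> 0"
    using that by (intro poly_mapping_eqI) (auto simp: lookup_add lookup_minus lookup_single when_def)
  then show "lookup (var v * shift v f) m = lookup (part (\<lambda>m. lookup m v \<noteq> 0) f) m"
    by (simp add: lookup_var_mult lookup_shift lookup_part)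
qed

text \<open>The homotopies \<open>f e\<^sub>T \<mapsto> shift v f e\<^sub>v \<and> e\<^sub>T\<close> remove the variables from a Koszul cycle one
  after the other.\<close>

lemma koszul_exact:
  fixes z :: "nat set \<Rightarrow> 'k::field mpoly"
  assumes z: "\<And>T. z T \<in> polys n" and cyc: "\<And>T. T \<subseteq> {1..n} \<Longrightarrow> kdiff {1..n} var z T = 0"
    and const: "lookup (z {}) 0 = 0"
  shows "\<exists>w. (\<forall>T. w T \<in> polys n) \<and> (\<forall>T\<subseteq>{1..n}. kdiff {1..n} var w T = z T)"
proof -
  \<comment> \<open>The invariant: up to a boundary, the cycle involves neither \<open>e_i\<close>
    nor the variable \<open>i\<close> for any \<open>i\<close> up to \<open>k\<close>. For
    \<open>k = n\<close> only the constant term at \<open>{}\<close> could remain.\<close>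
  have "\<exists>w. (\<forall>T. w T \<in> polys n) \<and> (\<forall>T\<subseteq>{1..n}. z T - kdiff {1..n} var w T =
      (if T \<inter> {1..k} = {} then part (\<lambda>m. keys m \<inter> {1..k} = {}) (z T) else 0))"
    if "k \<le> n" for k
    using that
  proof (induction k)
    case 0
    have "part (\<lambda>m. True) (z T) = z T" for T by (rule poly_mapping_eqI) (simp add: lookup_part)
    then show ?case by (intro exI[of _ "\<lambda>_. 0"]) simp
  next
    case (Suc k)
    then obtain w where w: "\<And>T. w T \<in> polys n" "\<And>T. T \<subseteq> {1..n} \<Longrightarrow> z T - kdiff {1..n} var w T =
      (if T \<inter> {1..k} = {} then part (\<lambda>m. keys m \<inter> {1..k} = {}) (z T) else 0)"
      by auto
    define v where "v = Suc k"
    define z' where "z' T = z T - kdiff {1..n} var w T" for T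
    define h where "h = kwedge v (\<lambda>U. shift v (z' U))"
    have v: "v \<in> {1..n}" "{1..v} = insert v {1..k}" using Suc.prems by (auto simp: v_def)
    have z'p: "z' T \<in> polys n" for T
      unfolding z'_def by (intro polys_diff z kdiff_polys w)
    have cyc': "kdiff {1..n} var z' T = 0" if T: "T \<subseteq> {1..n}" for T
    proof -
      have "finite T" using T finite_subset by blast
      then show ?thesis
        unfolding z'_def kdiff_diff using cyc[OF T] by (simp add: kdiff_kdiff)
    qed
    have shift0: "shift v (0 :: 'k mpoly) = 0" by (rule poly_mapping_eqI) (simp add: lookup_shift)
    have main: "kdiff {1..n} var h T = (if v \<in> T then z' T else var v * shift v (z' T))"
      if T: "T \<subseteq> {1..n}" for T
    proof -
      have "kwedge v (\<lambda>U. shift v (kdiff {1..n} var z' U)) T = 0"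
      proof -
        have "T - {v} \<subseteq> {1..n}" using T by auto
        from cyc'[OF this] show ?thesis by (simp add: kwedge_def shift0)
      qed
      then show ?thesis
        using kdiff_kwedge[of "{1..n}" v T "shift v" var z'] v T
        by (simp add: h_def shift_add shift_var_mult shift_var_mult_other)
    qed
    have hp: "h T \<in> polys n" for T
      using z'p by (auto simp: h_def kwedge_def)
    show ?case
    proof (intro exI[of _ "\<lambda>T. w T + h T"] conjI allI impI)
      show "w T + h T \<in> polys n" for T using w(1) hp by auto
      fix T :: "nat set" assume T: "T \<subseteq> {1..n}"
      have eq: "z T - kdiff {1..n} var (\<lambda>T. w T + h T) T = z' T - kdiff {1..n} var h T"
        by (simp add: kdiff_add z'_def)
      show "z T - kdiff {1..n} var (\<lambda>T. w T + h T) T =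
        (if T \<inter> {1..Suc k} = {} then part (\<lambda>m. keys m \<inter> {1..Suc k} = {}) (z T) else 0)"
      proof (cases "v \<in> T")
        case True
        then have "T \<inter> {1..Suc k} \<noteq> {}" by (auto simp: v_def)
        then show ?thesis using eq main[OF T] True by simp
      next
        case False
        have "z' T - kdiff {1..n} var h T = part (\<lambda>m. v \<notin> keys m) (z' T)"
          unfolding main[OF T] using False
          by (intro poly_mapping_eqI) (simp add: var_mult_shift lookup_minus lookup_part in_keys_iff)
        also have "\<dots> = (if T \<inter> {1..Suc k} = {} then part (\<lambda>m. keys m \<inter> {1..Suc k} = {}) (z T) else 0)"
          unfolding z'_def w(2)[OF T] v_def[symmetric] v(2) using False
          by (intro poly_mapping_eqI) (auto simp: lookup_part)
        finally show ?thesis using eq by simp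
      qed
    qed
  qed
  from this[of n] obtain w where w: "\<And>T. w T \<in> polys n" "\<And>T. T \<subseteq> {1..n} \<Longrightarrow> z T - kdiff {1..n} var w T =
      (if T \<inter> {1..n} = {} then part (\<lambda>m. keys m \<inter> {1..n} = {}) (z T) else 0)"
    by auto
  have "kdiff {1..n} var w T = z T" if T: "T \<subseteq> {1..n}" for T
  proof (cases "T = {}")
    case True
    have "part (\<lambda>m. keys m \<inter> {1..n} = {}) (z {}) = 0"
    proof (rule poly_mapping_eqI)
      fix m
      have "m = 0" if "lookup (z {}) m \<noteq> 0" "keys m \<inter> {1..n} = {}"
        using polysD[OF z that(1)] that(2) by (metis Int_absorb2 keys_eq_empty)
      then show "lookup (part (\<lambda>m. keys m \<inter> {1..n} = {}) (z {})) m = lookup 0 m"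
        using const by (auto simp: lookup_part)
    qed
    then show ?thesis using w(2)[OF T] True by simp
  next
    case False
    then have "T \<inter> {1..n} \<noteq> {}" using T by auto
    then show ?thesis using w(2)[OF T] by simp
  qed
  then show ?thesis using w(1) by blast
qed

section \<open>Linear resolutions of submodules of free modules\<close>

definition homog :: "int \<Rightarrow> 'k::field mpoly \<Rightarrow> bool" where
  "homog d f \<longleftrightarrow> (\<forall>m. lookup f m \<noteq> 0 \<longrightarrow> int (mdegree m) = d)"

lemma mdegree_add: "mdegree (a + b) = mdegree a + mdegree b"
  unfolding mdegree_def by (rule setsum_keys_plus_distrib) auto

lemma mdegree_single [simp]: "mdegree (single i k) = k"
  by (simp add: mdegree_def)

lemma lookup_mult_nonzero:
  fixes f g :: "'k::field mpoly"
  assumes "lookup (f * g) m \<noteq> 0"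
  obtains a b where "m = a + b" "lookup f a \<noteq> 0" "lookup g b \<noteq> 0"
proof -
  have "m \<in> keys (f * g)" using assms by (simp add: in_keys_iff)
  then have "m \<in> {a + b | a b. a \<in> keys f \<and> b \<in> keys g}"
    using keys_mult[of f g] by (rule rev_subsetD)
  then show thesis using that by (auto simp: in_keys_iff)
qed

lemma homog_0 [simp]: "homog d 0"
  by (simp add: homog_def)

lemma homog_add: "homog d f \<Longrightarrow> homog d g \<Longrightarrow> homog d (f + g)"
  unfolding homog_def lookup_add by (metis add_cancel_right_right)

lemma homog_uminus: "homog d f \<Longrightarrow> homog d (- f)"
  unfolding homog_def by simp

lemma homog_sum: "(\<And>i. i \<in> A \<Longrightarrow> homog d (f i)) \<Longrightarrow> homog d (sum f A)"
  by (induction A rule: infinite_finite_induct) (auto intro: homog_add)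

lemma homog_mult:
  assumes "homog d f" "homog e g"
  shows "homog (d + e) (f * g)"
  unfolding homog_def
proof (intro allI impI)
  fix m assume "lookup (f * g) m \<noteq> 0"
  then obtain a b where "m = a + b" "lookup f a \<noteq> 0" "lookup g b \<noteq> 0"
    by (rule lookup_mult_nonzero)
  then show "int (mdegree m) = d + e" using assms by (simp add: homog_def mdegree_add)
qed

lemma homog_1 [simp]: "homog 0 1"
  by (auto simp: homog_def lookup_one when_def mdegree_def)

lemma homog_var [simp]: "homog 1 (var i)"
  by (auto simp: homog_def var_def lookup_single when_def)

lemma homog_ksign [simp]: "homog 0 (ksign j T)"
  using ksign_cases[of j T, where 'a = "'a mpoly"] by (elim disjE) (erule ssubst, simp add: homog_uminus)+

lemma homog_const:
  assumes "homog d f" "d \<noteq> 0"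
  shows "lookup f 0 = 0"
proof (rule ccontr)
  assume "lookup f 0 \<noteq> 0"
  then have "int (mdegree 0) = d" using assms(1) unfolding homog_def by blast
  then show False using assms(2) by (simp add: mdegree_def)
qed

section \<open>Homogeneous components\<close>

definition hcomp :: "int \<Rightarrow> 'k::field mpoly \<Rightarrow> 'k mpoly" where
  "hcomp d f = part (\<lambda>m. int (mdegree m) = d) f"

lemma homog_hcomp [simp]: "homog d (hcomp d f)"
  by (simp add: homog_def hcomp_def lookup_part)

lemma hcomp_homog: "homog d f \<Longrightarrow> hcomp d f = f"
  by (rule poly_mapping_eqI) (auto simp: homog_def hcomp_def lookup_part)

lemma polys_hcomp [intro]: "f \<in> polys n \<Longrightarrow> hcomp d f \<in> polys n"
  unfolding hcomp_def by (rule polys_part)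

lemma hcomp_add: "hcomp d (f + g) = hcomp d f + hcomp d g"
  by (rule poly_mapping_eqI) (simp add: hcomp_def lookup_part lookup_add)

lemma hcomp_0 [simp]: "hcomp d 0 = 0"
  by (rule poly_mapping_eqI) (simp add: hcomp_def lookup_part)

lemma hcomp_sum: "hcomp d (sum f A) = (\<Sum>i\<in>A. hcomp d (f i))"
  by (induction A rule: infinite_finite_induct) (auto simp: hcomp_add)

lemma hcomp_mult:
  assumes g: "homog e g"
  shows "hcomp (d + e) (f * g) = hcomp d f * g"
proof -
  have f: "f = hcomp d f + (f - hcomp d f)" by simp
  have "hcomp (d + e) ((f - hcomp d f) * g) = 0"
  proof (rule poly_mapping_eqI)
    fix m
    have False if nz: "lookup ((f - hcomp d f) * g) m \<noteq> 0" and m: "int (mdegree m) = d + e"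
    proof -
      obtain a b where ab: "m = a + b" "lookup (f - hcomp d f) a \<noteq> 0" "lookup g b \<noteq> 0"
        using nz by (rule lookup_mult_nonzero)
      have "int (mdegree b) = e" using g ab(3) by (simp add: homog_def)
      then have "int (mdegree a) = d" using m ab(1) by (simp add: mdegree_add)
      then show False using ab(2) by (simp add: lookup_minus hcomp_def lookup_part)
    qed
    then show "lookup (hcomp (d + e) ((f - hcomp d f) * g)) m = lookup 0 m"
      unfolding hcomp_def[of "d + e"] lookup_part by auto
  qed
  moreover have "hcomp (d + e) (hcomp d f * g) = hcomp d f * g"
    by (intro hcomp_homog homog_mult homog_hcomp g)
  ultimately have "hcomp (d + e) (hcomp d f * g + (f - hcomp d f) * g) = hcomp d f * g"
    by (simp add: hcomp_add)
  then show ?thesis using f by (simp flip: distrib_right)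
qed

section \<open>Vectors of polynomials and their syzygies\<close>

type_synonym 'k vec = "nat \<Rightarrow> 'k mpoly"

text \<open>Vectors of every length share one type by being zero from position \<open>k\<close> on.
  Iterated syzygy modules can then be arguments of a single recursive predicate.\<close>

definition free_vecs :: "nat \<Rightarrow> nat \<Rightarrow> 'k::field vec set" where
  "free_vecs n k = {v. (\<forall>j. v j \<in> polys n) \<and> (\<forall>j\<ge>k. v j = 0)}"

definition vhomog :: "int \<Rightarrow> 'k::field vec \<Rightarrow> bool" where
  "vhomog d v \<longleftrightarrow> (\<forall>j. homog d (v j))"

definition comb :: "nat \<Rightarrow> (nat \<Rightarrow> 'k::field vec) \<Rightarrow> 'k vec \<Rightarrow> 'k vec" where
  "comb k G v = (\<lambda>i. \<Sum>j<k. v j * G j i)"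

definition syzygies :: "nat \<Rightarrow> nat \<Rightarrow> (nat \<Rightarrow> 'k::field vec) \<Rightarrow> 'k vec set" where
  "syzygies n k G = {v \<in> free_vecs n k. comb k G v = (\<lambda>i. 0)}"

definition gens :: "nat \<Rightarrow> int \<Rightarrow> nat \<Rightarrow> (nat \<Rightarrow> 'k::field vec) \<Rightarrow> bool" where
  "gens n e k G \<longleftrightarrow> (\<forall>j<k. vhomog e (G j) \<and> (\<forall>i. G j i \<in> polys n))"

text \<open>\<open>W\<close> has a linear resolution of length less than \<open>l\<close> with generators in degree \<open>e\<close>.
  The vectors of coefficients carry the degrees of their entries, so that the first syzygies
  are generated in degree 1.\<close>

fun lin_res :: "nat \<Rightarrow> nat \<Rightarrow> int \<Rightarrow> 'k::field vec set \<Rightarrow> bool" where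
  "lin_res n 0 e W \<longleftrightarrow> W = {\<lambda>i. 0}"
| "lin_res n (Suc l) e W \<longleftrightarrow>
    (\<exists>k G. gens n e k G \<and> W = comb k G ` free_vecs n k \<and> lin_res n l 1 (syzygies n k G))"

definition submod :: "nat \<Rightarrow> 'k::field vec set \<Rightarrow> bool" where
  "submod n W \<longleftrightarrow> (\<lambda>i. 0) \<in> W \<and> (\<forall>v\<in>W. \<forall>w\<in>W. (\<lambda>i. v i + w i) \<in> W) \<and>
    (\<forall>f\<in>polys n. \<forall>v\<in>W. (\<lambda>i. f * v i) \<in> W) \<and> (\<forall>v\<in>W. \<forall>i. v i \<in> polys n)"

lemma submod_0: "submod n W \<Longrightarrow> (\<lambda>i. 0) \<in> W"
  and submod_add: "submod n W \<Longrightarrow> v \<in> W \<Longrightarrow> w \<in> W \<Longrightarrow> (\<lambda>i. v i + w i) \<in> W"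
  and submod_mult: "submod n W \<Longrightarrow> f \<in> polys n \<Longrightarrow> v \<in> W \<Longrightarrow> (\<lambda>i. f * v i) \<in> W"
  and submod_polys: "submod n W \<Longrightarrow> v \<in> W \<Longrightarrow> v i \<in> polys n"
  by (simp_all add: submod_def)

lemma submod_sum:
  assumes "submod n W" "\<And>j. j \<in> A \<Longrightarrow> f j \<in> W"
  shows "(\<lambda>i. \<Sum>j\<in>A. f j i) \<in> W"
  using assms(2)
proof (induction A rule: infinite_finite_induct)
  case (insert x F)
  then show ?case using submod_add[OF assms(1), of "f x" "\<lambda>i. \<Sum>j\<in>F. f j i"] by simp
qed (simp_all add: submod_0[OF assms(1)])

lemma submod_comb:
  assumes "submod n W" "\<And>j. j < k \<Longrightarrow> G j \<in> W" "\<And>j. v j \<in> polys n"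
  shows "comb k G v \<in> W"
  unfolding comb_def using assms
  by (intro submod_sum[OF assms(1)] submod_mult[OF assms(1)]) auto

lemma submod_diff:
  assumes "submod n W" "v \<in> W" "w \<in> W"
  shows "(\<lambda>i. v i - w i) \<in> W"
proof -
  have "(- 1 :: 'a mpoly) \<in> polys n" by (intro polys_uminus polys_1)
  from submod_mult[OF assms(1) this assms(3)] show ?thesis
    using submod_add[OF assms(1,2), of "\<lambda>i. - 1 * w i"] by simp
qed

lemma free_vecs_polys: "v \<in> free_vecs n k \<Longrightarrow> v j \<in> polys n"
  by (simp add: free_vecs_def)

lemma comb_add: "comb k G (\<lambda>j. v j + w j) = (\<lambda>i. comb k G v i + comb k G w i)"
  by (simp add: comb_def distrib_right sum.distrib)

lemma comb_mult: "comb k G (\<lambda>j. f * v j) = (\<lambda>i. f * comb k G v i)"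
  by (simp add: comb_def sum_distrib_left mult.assoc)

lemma comb_zero [simp]: "comb k G (\<lambda>j. 0) = (\<lambda>i. 0)"
  by (simp add: comb_def)

lemma comb_uminus: "comb k G (\<lambda>j. - v j) = (\<lambda>i. - comb k G v i)"
  by (simp add: comb_def sum_negf)

lemma comb_cong: "(\<And>j. j < k \<Longrightarrow> v j = w j) \<Longrightarrow> comb k G v = comb k G w"
  by (simp add: comb_def)

lemma comb_polys:
  "gens n e k G \<Longrightarrow> (\<And>j. v j \<in> polys n) \<Longrightarrow> comb k G v i \<in> polys n"
  unfolding comb_def gens_def by (intro polys_sum polys_mult) auto

lemma vhomog_comb:
  "gens n e k G \<Longrightarrow> vhomog d v \<Longrightarrow> vhomog (d + e) (comb k G v)"
  unfolding comb_def gens_def vhomog_def by (auto intro!: homog_sum homog_mult)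

lemma comb_hcomp:
  assumes "gens n e k G"
  shows "comb k G (\<lambda>j. hcomp d (v j)) = (\<lambda>i. hcomp (d + e) (comb k G v i))"
proof
  fix i
  have "homog e (G j i)" if "j < k" for j
    using assms that by (simp add: gens_def vhomog_def)
  then show "comb k G (\<lambda>j. hcomp d (v j)) i = hcomp (d + e) (comb k G v i)"
    unfolding comb_def hcomp_sum by (intro sum.cong) (auto simp: hcomp_mult)
qed

lemma free_vecs_hcomp: "v \<in> free_vecs n k \<Longrightarrow> (\<lambda>j. hcomp d (v j)) \<in> free_vecs n k"
  by (auto simp: free_vecs_def)

text \<open>The generators all have degree \<open>e\<close>, so \<open>comb\<close> carries
  components of degree \<open>d\<close> to components of degree \<open>d + e\<close>; the degree
  \<open>d\<close> part of any preimage is again a preimage.\<close>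

lemma homogeneous_preimage:
  assumes G: "gens n e k G" and w: "w \<in> comb k G ` free_vecs n k" "vhomog (d + e) w"
  obtains v where "v \<in> free_vecs n k" "vhomog d v" "comb k G v = w"
proof -
  obtain u where u: "u \<in> free_vecs n k" "w = comb k G u" using w(1) by auto
  show thesis
  proof
    show "(\<lambda>j. hcomp d (u j)) \<in> free_vecs n k" using u(1) by (rule free_vecs_hcomp)
    show "vhomog d (\<lambda>j. hcomp d (u j))" by (simp add: vhomog_def)
    show "comb k G (\<lambda>j. hcomp d (u j)) = w"
      using w(2) unfolding comb_hcomp[OF G] u(2)[symmetric] by (simp add: vhomog_def hcomp_homog)
  qed
qed

lemma submod_free_vecs: "submod n (free_vecs n k)"
  by (auto simp: submod_def free_vecs_def)

lemma submod_syzygies: "submod n (syzygies n k G)"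
  unfolding submod_def
proof (intro conjI ballI allI)
  show "(\<lambda>i. 0) \<in> syzygies n k G" by (simp add: syzygies_def free_vecs_def)
  show "(\<lambda>i. v i + w i) \<in> syzygies n k G" if "v \<in> syzygies n k G" "w \<in> syzygies n k G" for v w
    using that submod_add[OF submod_free_vecs, of v n k w] by (simp add: syzygies_def comb_add)
  show "(\<lambda>i. f * v i) \<in> syzygies n k G" if "f \<in> polys n" "v \<in> syzygies n k G" for f v
    using that submod_mult[OF submod_free_vecs, of f n v k] by (simp add: syzygies_def comb_mult)
  show "v i \<in> polys n" if "v \<in> syzygies n k G" for v i
    using that by (simp add: syzygies_def free_vecs_def)
qed

lemma comb_basis: "j < k \<Longrightarrow> comb k G (\<lambda>i. if i = j then 1 else 0) = G j"
  unfolding comb_def by (rule ext) (simp add: if_distrib[of "\<lambda>x. x * _"] cong: if_cong)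

lemma basis_free_vecs: "j < k \<Longrightarrow> (\<lambda>i. if i = j then 1 else 0) \<in> free_vecs n k"
  by (auto simp: free_vecs_def)

lemma gens_in_image: "j < k \<Longrightarrow> G j \<in> comb k G ` free_vecs n k"
  using comb_basis[of j k G] basis_free_vecs[of j k n] by (metis image_eqI)

lemma free_vecs_0 [simp]: "free_vecs n 0 = {\<lambda>i. 0}"
  by (auto simp: free_vecs_def)

lemma lin_res_zero: "lin_res n l e {\<lambda>i. 0}"
proof (induction l arbitrary: e)
  case (Suc l)
  have "syzygies n 0 G = {\<lambda>i. 0}" for G :: "nat \<Rightarrow> 'a vec" by (auto simp: syzygies_def)
  then have "gens n e 0 (\<lambda>j. (\<lambda>i. 0 :: 'a mpoly))" "lin_res n l 1 (syzygies n 0 (\<lambda>j. (\<lambda>i. 0 :: 'a mpoly)))"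
    using Suc.IH by (simp_all add: gens_def)
  then show ?case
    by (auto intro!: exI[of _ 0] exI[of _ "\<lambda>j. (\<lambda>i. 0)"])
qed simp

text \<open>Padding by zero modules turns the length into an upper bound, so that resolutions of
  different lengths can be combined.\<close>

lemma lin_res_Suc: "lin_res n l e W \<Longrightarrow> lin_res n (Suc l) e W"
proof (induction l arbitrary: e W)
  case 0
  then show ?case using lin_res_zero[of n 1 e] by (simp del: lin_res.simps(2))
next
  case (Suc l)
  then show ?case by (metis lin_res.simps(2))
qed

lemma lin_res_mono: "l \<le> l' \<Longrightarrow> lin_res n l e W \<Longrightarrow> lin_res n l' e W"
  by (induction l' rule: dec_induct) (auto simp del: lin_res.simps intro: lin_res_Suc)

section \<open>Concatenation of vectors and of generating families\<close>

definition vappend :: "nat \<Rightarrow> (nat \<Rightarrow> 'b) \<Rightarrow> (nat \<Rightarrow> 'b) \<Rightarrow> nat \<Rightarrow> 'b" where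
  "vappend s v w = (\<lambda>j. if j < s then v j else w (j - s))"

definition tail :: "nat \<Rightarrow> (nat \<Rightarrow> 'b) \<Rightarrow> nat \<Rightarrow> 'b" where
  "tail s v = (\<lambda>j. v (j + s))"

lemma tail_vappend [simp]: "tail s (vappend s v w) = w"
  by (simp add: tail_def vappend_def)

lemma comb_vappend_gens: "comb (s + t) (vappend s G H) v = (\<lambda>i. comb s G v i + comb t H (tail s v) i)"
proof
  fix i
  have "(\<Sum>j<s + t. v j * vappend s G H j i) =
      (\<Sum>j<s. v j * vappend s G H j i) + (\<Sum>j<t. v (s + j) * vappend s G H (s + j) i)"
    by (induction t) (simp_all add: add.assoc)
  then show "comb (s + t) (vappend s G H) v i = comb s G v i + comb t H (tail s v) i"
    by (simp add: comb_def vappend_def tail_def add.commute)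
qed

lemma comb_vappend: "comb s G (vappend s v w) = comb s G v"
  by (rule comb_cong) (simp add: vappend_def)

lemma vappend_free_vecs: "v \<in> free_vecs n s \<Longrightarrow> w \<in> free_vecs n t \<Longrightarrow> vappend s v w \<in> free_vecs n (s + t)"
  by (auto simp: free_vecs_def vappend_def)

lemma tail_free_vecs: "v \<in> free_vecs n (s + t) \<Longrightarrow> tail s v \<in> free_vecs n t"
  by (auto simp: free_vecs_def tail_def)

lemma vhomog_vappend: "vhomog d v \<Longrightarrow> vhomog d w \<Longrightarrow> vhomog d (vappend s v w)"
  by (simp add: vhomog_def vappend_def)

lemma vhomog_uminus: "vhomog d v \<Longrightarrow> vhomog d (\<lambda>i. - v i)"
  by (simp add: vhomog_def homog_uminus)

lemma uminus_free_vecs: "v \<in> free_vecs n s \<Longrightarrow> (\<lambda>i. - v i) \<in> free_vecs n s"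
  by (auto simp: free_vecs_def)

lemma zero_free_vecs: "(\<lambda>i. 0) \<in> free_vecs n s"
  by (simp add: free_vecs_def)

lemma vhomog_zero: "vhomog d (\<lambda>i. 0)"
  by (simp add: vhomog_def)

lemma gens_vappend: "gens n e s G \<Longrightarrow> gens n e t H \<Longrightarrow> gens n e (s + t) (vappend s G H)"
  by (auto simp: gens_def vappend_def)

definition module_map :: "nat \<Rightarrow> 'k::field vec set \<Rightarrow> ('k vec \<Rightarrow> 'k vec) \<Rightarrow> bool" where
  "module_map n W h \<longleftrightarrow> (\<forall>v\<in>W. \<forall>w\<in>W. h (\<lambda>i. v i + w i) = (\<lambda>i. h v i + h w i)) \<and>
    (\<forall>f\<in>polys n. \<forall>v\<in>W. h (\<lambda>i. f * v i) = (\<lambda>i. f * h v i))"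

lemma module_map_add: "module_map n W h \<Longrightarrow> v \<in> W \<Longrightarrow> w \<in> W \<Longrightarrow> h (\<lambda>i. v i + w i) = (\<lambda>i. h v i + h w i)"
  and module_map_mult: "module_map n W h \<Longrightarrow> f \<in> polys n \<Longrightarrow> v \<in> W \<Longrightarrow> h (\<lambda>i. f * v i) = (\<lambda>i. f * h v i)"
  by (simp_all add: module_map_def)

lemma module_map_0:
  assumes "module_map n W h" "submod n W"
  shows "h (\<lambda>i. 0) = (\<lambda>i. 0)"
  using module_map_mult[OF assms(1) polys_0 submod_0[OF assms(2)]] by simp

lemma module_map_comb:
  assumes h: "module_map n W h" and W: "submod n W" and G: "\<And>j. j < k \<Longrightarrow> G j \<in> W"
    and v: "\<And>j. v j \<in> polys n"
  shows "h (comb k G v) = comb k (\<lambda>j. h (G j)) v"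
  using G
proof (induction k)
  case 0
  then show ?case using module_map_0[OF h W] by (simp add: comb_def)
next
  case (Suc k)
  have 1: "comb k G v \<in> W" using Suc.prems v by (intro submod_comb[OF W]) auto
  have 2: "(\<lambda>i. v k * G k i) \<in> W" using Suc.prems v by (intro submod_mult[OF W]) auto
  have "comb (Suc k) G v = (\<lambda>i. comb k G v i + v k * G k i)" by (simp add: comb_def)
  then show ?case
    using module_map_add[OF h 1 2] Suc module_map_mult[OF h v, of "G k" k] by (simp add: comb_def)
qed

text \<open>Horseshoe lemma: generators of the kernel and lifts of generators of the image generate
  \<open>W\<close>, and the hypotheses pass to the syzygies.\<close>

lemma lin_res_extension:
  assumes "submod n W" "module_map n W h" "h ` W \<subseteq> A"
    and "\<And>a. a \<in> A \<Longrightarrow> vhomog e' a \<Longrightarrow> \<exists>w\<in>W. vhomog e w \<and> h w = a"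
    and "lin_res n l e {w \<in> W. h w = (\<lambda>i. 0)}" "lin_res n l e' A"
  shows "lin_res n l e W"
  using assms
proof (induction l arbitrary: e e' W A h)
  case 0
  then have "w = (\<lambda>i. 0)" if "w \<in> W" for w
    using that 0(3,5,6) by auto
  moreover have "(\<lambda>i. 0) \<in> W" using 0(1) by (rule submod_0)
  ultimately have "W = {\<lambda>i. 0}" by blast
  then show ?case by simp
next
  case (Suc l)
  note W = Suc.prems(1) and h = Suc.prems(2) and hA = Suc.prems(3) and lift = Suc.prems(4)
  obtain s GK where K: "gens n e s GK" "{w \<in> W. h w = (\<lambda>i. 0)} = comb s GK ` free_vecs n s"
    "lin_res n l 1 (syzygies n s GK)"
    using Suc.prems(5) by auto
  obtain t GA where A: "gens n e' t GA" "A = comb t GA ` free_vecs n t"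
    "lin_res n l 1 (syzygies n t GA)"
    using Suc.prems(6) by auto
  have "\<exists>w\<in>W. vhomog e w \<and> h w = GA j" if "j < t" for j
    using lift[of "GA j"] gens_in_image[OF that, of GA n] A(1,2) that by (simp add: gens_def)
  then obtain L where L: "\<And>j. j < t \<Longrightarrow> L j \<in> W" "\<And>j. j < t \<Longrightarrow> vhomog e (L j)" "\<And>j. j < t \<Longrightarrow> h (L j) = GA j"
    by metis
  have GKW: "GK j \<in> W" "h (GK j) = (\<lambda>i. 0)" if "j < s" for j
    using gens_in_image[OF that, of GK n] unfolding K(2)[symmetric] by auto
  define G where "G = vappend s GK L"
  have gL: "gens n e t L" using L(1,2) submod_polys[OF W] by (auto simp: gens_def)
  have gG: "gens n e (s + t) G" unfolding G_def by (rule gens_vappend[OF K(1) gL])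
  have cG: "comb (s + t) G v = (\<lambda>i. comb s GK v i + comb t L (tail s v) i)" for v
    unfolding G_def by (rule comb_vappend_gens)
  have hL: "h (comb t L c) = comb t GA c" if "\<And>j. c j \<in> polys n" for c
  proof -
    have "h (comb t L c) = comb t (\<lambda>j. h (L j)) c" using L(1) that by (intro module_map_comb[OF h W])
    also have "\<dots> = comb t GA c" using L(3) by (simp add: comb_def)
    finally show ?thesis .
  qed
  have hK: "h (comb s GK c) = (\<lambda>i. 0)" if "\<And>j. c j \<in> polys n" for c
  proof -
    have "h (comb s GK c) = comb s (\<lambda>j. h (GK j)) c" using GKW(1) that by (intro module_map_comb[OF h W])
    also have "\<dots> = (\<lambda>i. 0)" using GKW(2) by (simp add: comb_def)
    finally show ?thesis .
  qed
  have LW: "comb t L c \<in> W" if "\<And>j. c j \<in> polys n" for c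
    using L(1) that by (intro submod_comb[OF W])
  have KW: "comb s GK c \<in> W" if "\<And>j. c j \<in> polys n" for c
    using GKW(1) that by (intro submod_comb[OF W])
  have hG: "h (comb (s + t) G v) = comb t GA (tail s v)" if v: "\<And>j. v j \<in> polys n" for v
    unfolding cG using module_map_add[OF h KW[OF v] LW[of "tail s v"]] hK[OF v] hL[of "tail s v"] v
    by (simp add: tail_def)
  have "W = comb (s + t) G ` free_vecs n (s + t)"
  proof (intro equalityI subsetI)
    fix w assume w: "w \<in> W"
    then obtain c where c: "c \<in> free_vecs n t" "h w = comb t GA c" using hA A(2) by blast
    define u where "u = (\<lambda>i. w i - comb t L c i)"
    have cp: "\<And>j. c j \<in> polys n" using c(1) by (rule free_vecs_polys)
    have u: "u \<in> W" unfolding u_def using w LW[OF cp] by (rule submod_diff[OF W])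
    have "w = (\<lambda>i. u i + comb t L c i)" by (simp add: u_def)
    then have "h w = (\<lambda>i. h u i + h (comb t L c) i)" using module_map_add[OF h u LW[OF cp]] by simp
    then have "h u = (\<lambda>i. 0)" using c(2) hL[OF cp] by (simp add: fun_eq_iff)
    then have "u \<in> comb s GK ` free_vecs n s" using u K(2) by blast
    then obtain d where d: "d \<in> free_vecs n s" "u = comb s GK d" by auto
    have "w = comb (s + t) G (vappend s d c)"
      unfolding cG comb_vappend tail_vappend d(2)[symmetric] by (simp add: u_def)
    then show "w \<in> comb (s + t) G ` free_vecs n (s + t)"
      using vappend_free_vecs[OF d(1) c(1)] by blast
  next
    fix w assume "w \<in> comb (s + t) G ` free_vecs n (s + t)"
    then obtain v where v: "v \<in> free_vecs n (s + t)" "w = comb (s + t) G v" by auto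
    have "G j \<in> W" if "j < s + t" for j using that GKW(1) L(1) by (simp add: G_def vappend_def)
    then show "w \<in> W" unfolding v(2) using free_vecs_polys[OF v(1)] by (intro submod_comb[OF W])
  qed
  \<comment> \<open>Forgetting the first \<open>s\<close> coefficients maps the syzygies of the
    joint family to those of \<open>GA\<close>, with kernel the syzygies of \<open>GK\<close>. This
    is the situation of the lemma again, now with both degrees equal to 1.\<close>
  moreover have "lin_res n l 1 (syzygies n (s + t) G)"
  proof (rule Suc.IH[of _ "tail s" "syzygies n t GA" 1])
    show "submod n (syzygies n (s + t) G)" by (rule submod_syzygies)
    show "module_map n (syzygies n (s + t) G) (tail s)" by (simp add: module_map_def tail_def)
    show "tail s ` syzygies n (s + t) G \<subseteq> syzygies n t GA"
    proof
      fix x assume "x \<in> tail s ` syzygies n (s + t) G"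
      then obtain v where v: "x = tail s v" "v \<in> free_vecs n (s + t)" "comb (s + t) G v = (\<lambda>i. 0)"
        by (auto simp: syzygies_def)
      have "comb t GA x = (\<lambda>i. 0)"
        using hG[of v, OF free_vecs_polys[OF v(2)]] v(1,3) module_map_0[OF h W] by simp
      then show "x \<in> syzygies n t GA" using tail_free_vecs[OF v(2)] v(1) by (simp add: syzygies_def)
    qed
    \<comment> \<open>A syzygy \<open>c\<close> of \<open>GA\<close> makes the combination of the
      lifts fall into the kernel, where it is a combination of \<open>GK\<close> with coefficients
      \<open>d\<close>. Since lifts and kernel generators share the degree \<open>e\<close>,
      \<open>d\<close> is linear like \<open>c\<close>, and \<open>-d\<close> followed by
      \<open>c\<close> is the lift.\<close>
    show "\<exists>w\<in>syzygies n (s + t) G. vhomog 1 w \<and> tail s w = c" if c: "c \<in> syzygies n t GA" "vhomog 1 c" for c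
    proof -
      have cf: "c \<in> free_vecs n t" and c0: "comb t GA c = (\<lambda>i. 0)" using c(1) by (auto simp: syzygies_def)
      note cp = free_vecs_polys[OF cf]
      have "comb t L c \<in> {w \<in> W. h w = (\<lambda>i. 0)}" using LW[OF cp] hL[OF cp] c0 by simp
      moreover have "vhomog (1 + e) (comb t L c)" by (rule vhomog_comb[OF gL c(2)])
      ultimately obtain d where d: "d \<in> free_vecs n s" "vhomog 1 d" "comb s GK d = comb t L c"
        unfolding K(2) by (rule homogeneous_preimage[OF K(1)])
      let ?v = "vappend s (\<lambda>i. - d i) c"
      have "?v \<in> free_vecs n (s + t)" by (intro vappend_free_vecs uminus_free_vecs d(1) cf)
      moreover have "comb (s + t) G ?v = (\<lambda>i. 0)"
        unfolding cG comb_vappend tail_vappend by (simp add: comb_uminus d(3))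
      ultimately show ?thesis
        using vhomog_vappend[OF vhomog_uminus[OF d(2)] c(2)]
        by (intro bexI[of _ ?v]) (simp_all add: syzygies_def)
    qed
    have "{w \<in> syzygies n (s + t) G. tail s w = (\<lambda>i. 0)} = syzygies n s GK"
    proof (intro equalityI subsetI)
      fix v assume "v \<in> {w \<in> syzygies n (s + t) G. tail s w = (\<lambda>i. 0)}"
      then have v: "v \<in> free_vecs n (s + t)" "comb (s + t) G v = (\<lambda>i. 0)" "tail s v = (\<lambda>i. 0)"
        by (auto simp: syzygies_def)
      have "v j = 0" if "s \<le> j" for j using fun_cong[OF v(3), of "j - s"] that by (simp add: tail_def)
      then have "v \<in> free_vecs n s" using v(1) by (simp add: free_vecs_def)
      then show "v \<in> syzygies n s GK" using v(2,3) by (simp add: syzygies_def cG)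
    next
      fix v assume "v \<in> syzygies n s GK"
      then have v: "v \<in> free_vecs n s" "comb s GK v = (\<lambda>i. 0)" by (auto simp: syzygies_def)
      then have "v \<in> free_vecs n (s + t)" "tail s v = (\<lambda>i. 0)" by (auto simp: free_vecs_def tail_def)
      then show "v \<in> {w \<in> syzygies n (s + t) G. tail s w = (\<lambda>i. 0)}"
        using v(2) by (simp add: syzygies_def cG)
    qed
    then show "lin_res n l 1 {w \<in> syzygies n (s + t) G. tail s w = (\<lambda>i. 0)}" using K(3) by simp
    show "lin_res n l 1 (syzygies n t GA)" by (rule A(3))
  qed
  ultimately show ?case using gG by auto
qed

text \<open>A syzygy of the joint family is a pair of coefficient vectors giving an element of
  \<open>Y\<close> and its negative in \<open>Z\<close>. So \<open>comb s G\<close> maps these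
  syzygies to \<open>Y \<inter> Z\<close>, and the kernel \<open>K\<close> is made of the syzygies
  of \<open>G\<close> and of \<open>H\<close>. Two extensions build the resolution. As
  \<open>comb s G\<close> raises degrees by \<open>e\<close>, linear syzygies correspond to elements
  of degree \<open>e + 1\<close>, which explains the degree required of the intersection.\<close>

lemma lin_res_plus:
  assumes Y: "lin_res n (Suc l) e Y" and Z: "lin_res n (Suc l) e Z" and YZ: "lin_res n l (e + 1) (Y \<inter> Z)"
  shows "lin_res n (Suc l) e {\<lambda>i. y i + z i | y z. y \<in> Y \<and> z \<in> Z}"
proof -
  obtain s G where G: "gens n e s G" "Y = comb s G ` free_vecs n s" "lin_res n l 1 (syzygies n s G)"
    using Y by auto
  obtain t H where H: "gens n e t H" "Z = comb t H ` free_vecs n t" "lin_res n l 1 (syzygies n t H)"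
    using Z by auto
  define W where "W = syzygies n (s + t) (vappend s G H)"
  have cJ: "comb (s + t) (vappend s G H) v = (\<lambda>i. comb s G v i + comb t H (tail s v) i)" for v
    by (rule comb_vappend_gens)
  have Wiff: "v \<in> W \<longleftrightarrow> v \<in> free_vecs n (s + t) \<and> (\<forall>i. comb s G v i + comb t H (tail s v) i = 0)" for v
    by (simp add: W_def syzygies_def cJ fun_eq_iff)
  have W: "submod n W" unfolding W_def by (rule submod_syzygies)
  define K where "K = {w \<in> W. comb s G w = (\<lambda>i. 0)}"
  have K: "submod n K"
    using W by (auto simp: submod_def K_def comb_add comb_mult)
  have head: "vappend s v (\<lambda>i. 0) \<in> free_vecs n s" if "v \<in> free_vecs n m" for v :: "'a vec" and m
    using that by (auto simp: free_vecs_def vappend_def)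
  have "lin_res n l 1 K"
  proof (rule lin_res_extension[OF K, of "tail s" "syzygies n t H" 1])
    show "module_map n K (tail s)" by (simp add: module_map_def tail_def)
    show "tail s ` K \<subseteq> syzygies n t H"
      using tail_free_vecs by (auto simp: K_def Wiff syzygies_def fun_eq_iff)
    show "\<exists>w\<in>K. vhomog 1 w \<and> tail s w = a" if "a \<in> syzygies n t H" "vhomog 1 a" for a
      using that vappend_free_vecs[OF zero_free_vecs, of a n t s] vhomog_vappend[OF vhomog_zero that(2), of s]
      by (intro bexI[of _ "vappend s (\<lambda>i. 0) a"]) (auto simp: K_def Wiff syzygies_def comb_vappend)
    have "{w \<in> K. tail s w = (\<lambda>i. 0)} = syzygies n s G"
    proof (intro equalityI subsetI)
      fix v assume "v \<in> {w \<in> K. tail s w = (\<lambda>i. 0)}"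
      then have v: "v \<in> free_vecs n (s + t)" "comb s G v = (\<lambda>i. 0)" "tail s v = (\<lambda>i. 0)"
        by (auto simp: K_def Wiff)
      have "v j = 0" if "s \<le> j" for j using fun_cong[OF v(3), of "j - s"] that by (simp add: tail_def)
      then have "v \<in> free_vecs n s" using v(1) by (simp add: free_vecs_def)
      then show "v \<in> syzygies n s G" using v(2) by (simp add: syzygies_def)
    next
      fix v assume "v \<in> syzygies n s G"
      then have v: "v \<in> free_vecs n s" "comb s G v = (\<lambda>i. 0)" by (auto simp: syzygies_def)
      then have "v \<in> free_vecs n (s + t)" "tail s v = (\<lambda>i. 0)" by (auto simp: free_vecs_def tail_def)
      then show "v \<in> {w \<in> K. tail s w = (\<lambda>i. 0)}"
        using v(2) by (simp add: K_def Wiff)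
    qed
    then show "lin_res n l 1 {w \<in> K. tail s w = (\<lambda>i. 0)}" using G(3) by simp
  qed (rule H(3))
  have "lin_res n l 1 W"
  proof (rule lin_res_extension[OF W, of "comb s G" "Y \<inter> Z" "e + 1"])
    show "module_map n W (comb s G)" by (simp add: module_map_def comb_add comb_mult)
    show "comb s G ` W \<subseteq> Y \<inter> Z"
    proof
      fix y assume "y \<in> comb s G ` W"
      then obtain v where v: "y = comb s G v" "v \<in> W" by auto
      then have vf: "v \<in> free_vecs n (s + t)" by (simp add: Wiff)
      have "y = comb s G (vappend s v (\<lambda>i. 0))" by (simp add: comb_vappend v(1))
      then have "y \<in> Y" using head[OF vf] G(2) by blast
      moreover have "y = comb t H (\<lambda>i. - tail s v i)"
        using v by (auto simp: Wiff comb_uminus fun_eq_iff eq_neg_iff_add_eq_0)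
      then have "y \<in> Z" using uminus_free_vecs[OF tail_free_vecs[OF vf]] H(2) by blast
      ultimately show "y \<in> Y \<inter> Z" by simp
    qed
    show "\<exists>w\<in>W. vhomog 1 w \<and> comb s G w = a" if a: "a \<in> Y \<inter> Z" "vhomog (e + 1) a" for a
    proof -
      have a': "vhomog (1 + e) a" using a(2) by (simp add: add.commute)
      obtain v where v: "v \<in> free_vecs n s" "vhomog 1 v" "comb s G v = a"
        using homogeneous_preimage[OF G(1) _ a'] a(1) G(2) by blast
      obtain w where w: "w \<in> free_vecs n t" "vhomog 1 w" "comb t H w = a"
        using homogeneous_preimage[OF H(1) _ a'] a(1) H(2) by blast
      show ?thesis
        using vappend_free_vecs[OF v(1) uminus_free_vecs[OF w(1)]] vhomog_vappend[OF v(2) vhomog_uminus[OF w(2)]] v w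
        by (intro bexI[of _ "vappend s v (\<lambda>i. - w i)"]) (simp_all add: Wiff comb_vappend comb_uminus)
    qed
    show "lin_res n l 1 {w \<in> W. comb s G w = (\<lambda>i. 0)}" using \<open>lin_res n l 1 K\<close> by (simp add: K_def)
  qed (rule YZ)
  moreover have "{\<lambda>i. y i + z i | y z. y \<in> Y \<and> z \<in> Z} = comb (s + t) (vappend s G H) ` free_vecs n (s + t)"
  proof (intro equalityI subsetI)
    fix x assume "x \<in> {\<lambda>i. y i + z i | y z. y \<in> Y \<and> z \<in> Z}"
    then obtain v w where vw: "v \<in> free_vecs n s" "w \<in> free_vecs n t" "x = (\<lambda>i. comb s G v i + comb t H w i)"
      unfolding G(2) H(2) by auto
    have "x = comb (s + t) (vappend s G H) (vappend s v w)" by (simp add: vw(3) cJ comb_vappend)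
    then show "x \<in> comb (s + t) (vappend s G H) ` free_vecs n (s + t)"
      using vappend_free_vecs[OF vw(1,2)] by blast
  next
    fix x assume "x \<in> comb (s + t) (vappend s G H) ` free_vecs n (s + t)"
    then obtain v where v: "v \<in> free_vecs n (s + t)" "x = comb (s + t) (vappend s G H) v" by auto
    have "x = (\<lambda>i. comb s G (vappend s v (\<lambda>i. 0)) i + comb t H (tail s v) i)"
      by (simp add: v(2) cJ comb_vappend)
    then show "x \<in> {\<lambda>i. y i + z i | y z. y \<in> Y \<and> z \<in> Z}"
      using head[OF v(1)] tail_free_vecs[OF v(1)] unfolding G(2) H(2) by blast
  qed
  ultimately show ?thesis
    using gens_vappend[OF G(1) H(1)] unfolding W_def by auto
qed

lemma var_mult_eq_0: "var v * f = 0 \<Longrightarrow> f = 0"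
  by (metis mult_zero_right shift_var_mult)

text \<open>Multiplication by a variable is injective, so the multiplied generators have the same
  syzygies and only the initial degree moves.\<close>

lemma lin_res_var_mult:
  assumes v: "v \<in> {1..n}" and Y: "lin_res n l e Y"
  shows "lin_res n l (e + 1) ((\<lambda>y i. var v * y i) ` Y)"
proof (cases l)
  case 0
  then show ?thesis using Y by auto
next
  case (Suc l')
  obtain k G where G: "gens n e k G" "Y = comb k G ` free_vecs n k" "lin_res n l' 1 (syzygies n k G)"
    using Y Suc by auto
  define H where "H j = (\<lambda>i. var v * G j i)" for j
  have cH: "comb k H u = (\<lambda>i. var v * comb k G u i)" for u
    by (simp add: comb_def H_def sum_distrib_left mult_ac)
  have "gens n (e + 1) k H"
    using G(1) polys_var[OF v] homog_mult[OF homog_var, of e _ v]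
    by (auto simp: gens_def H_def vhomog_def add.commute)
  moreover have "(\<lambda>y i. var v * y i) ` Y = comb k H ` free_vecs n k"
    unfolding G(2) image_image cH ..
  moreover have "syzygies n k H = syzygies n k G"
    unfolding syzygies_def cH using var_mult_eq_0 by (fastforce simp: fun_eq_iff)
  ultimately show ?thesis
    unfolding Suc lin_res.simps(2) using G(3) by (intro exI[of _ k] exI[of _ H]) simp
qed

section \<open>Koszul homology of modules with a linear resolution\<close>

definition vkdiff :: "nat \<Rightarrow> (nat set \<Rightarrow> 'k::field vec) \<Rightarrow> nat set \<Rightarrow> 'k vec" where
  "vkdiff n z T = (\<lambda>c. kdiff {1..n} var (\<lambda>U. z U c) T)"

lemma vkdiff_cong:
  "(\<And>j. j \<in> {1..n} - T \<Longrightarrow> z (insert j T) = w (insert j T)) \<Longrightarrow> vkdiff n z T = vkdiff n w T"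
  unfolding vkdiff_def by (rule ext, rule kdiff_cong) auto

lemma vkdiff_vkdiff: "T \<subseteq> {1..n} \<Longrightarrow> vkdiff n (vkdiff n z) T = (\<lambda>c. 0)"
  unfolding vkdiff_def by (rule ext, rule kdiff_kdiff) (auto intro: finite_subset)

lemma vkdiff_diff: "vkdiff n (\<lambda>U c. z U c - w U c) T = (\<lambda>c. vkdiff n z T c - vkdiff n w T c)"
  by (simp add: vkdiff_def kdiff_diff)

lemma vkdiff_zero [simp]: "vkdiff n (\<lambda>U c. 0) T = (\<lambda>c. 0)"
  by (simp add: vkdiff_def)

lemma vkdiff_comb: "vkdiff n (\<lambda>U. comb k G (v U)) T = comb k G (vkdiff n v T)"
  unfolding vkdiff_def comb_def by (rule ext) (rule kdiff_sum_mult)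

lemma vkdiff_free_vecs:
  assumes "\<And>U. v U \<in> free_vecs n k"
  shows "vkdiff n v T \<in> free_vecs n k"
proof -
  have p: "v U j \<in> polys n" for U j using assms free_vecs_polys by blast
  moreover have "v U j = 0" if "k \<le> j" for U j using assms that by (simp add: free_vecs_def)
  moreover have "kdiff {1..n} var (\<lambda>U. v U j) T \<in> polys n" for j
    by (intro kdiff_polys p)
  ultimately show ?thesis by (simp add: free_vecs_def vkdiff_def)
qed

lemma homog_kdiff:
  assumes "\<And>U. homog d (z U)"
  shows "homog (d + 1) (kdiff V var z T)"
  unfolding kdiff_def
proof (rule homog_sum)
  fix j
  have "homog (0 + 1 + d) (ksign j T * var j * z (insert j T))"
    by (intro homog_mult homog_ksign homog_var assms)
  then show "homog (d + 1) (ksign j T * var j * z (insert j T))" by (simp add: add.commute)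
qed

text \<open>Componentwise exactness. The constant terms at \<open>{}\<close> are the only
  obstruction: they record the Koszul homology of a free module in homological degree 0.\<close>

lemma vkoszul_exact:
  assumes z: "\<And>T. z T \<in> free_vecs n k" and cyc: "\<And>T. T \<subseteq> {1..n} \<Longrightarrow> vkdiff n z T = (\<lambda>c. 0)"
    and const: "\<And>j. lookup (z {} j) 0 = 0"
  shows "\<exists>w. (\<forall>T. w T \<in> free_vecs n k) \<and> (\<forall>T\<subseteq>{1..n}. vkdiff n w T = z T)"
proof -
  have "\<exists>w. (\<forall>T. w T \<in> polys n) \<and> (\<forall>T\<subseteq>{1..n}. kdiff {1..n} var w T = z T j)" for j
  proof (rule koszul_exact)
    show "z T j \<in> polys n" for T using z by (rule free_vecs_polys)
    show "kdiff {1..n} var (\<lambda>T. z T j) T = 0" if "T \<subseteq> {1..n}" for T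
      using cyc[OF that] by (simp add: vkdiff_def fun_eq_iff)
  qed (rule const)
  then obtain w where w: "\<And>j T. w j T \<in> polys n" "\<And>j T. T \<subseteq> {1..n} \<Longrightarrow> kdiff {1..n} var (w j) T = z T j"
    by metis
  define w' where "w' T = (\<lambda>j. if j < k then w j T else 0)" for T
  have "w' T \<in> free_vecs n k" for T using w(1) by (simp add: w'_def free_vecs_def)
  moreover have "vkdiff n w' T = z T" if T: "T \<subseteq> {1..n}" for T
  proof
    fix j
    show "vkdiff n w' T j = z T j"
    proof (cases "j < k")
      case True
      then show ?thesis using w(2)[OF T] by (simp add: vkdiff_def w'_def)
    next
      case False
      then show ?thesis using z[of T] by (simp add: vkdiff_def w'_def free_vecs_def)
    qed
  qed
  ultimately show ?thesis by blast
qed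

text \<open>\<open>Tor\<^sub>i(W, K)\<close> is concentrated in degree \<open>e + i\<close>, computed by the Koszul complex.\<close>

lemma koszul_vanishing:
  assumes "lin_res n l e W" "\<And>T. z T \<in> W"
    and "\<And>T. z T \<noteq> (\<lambda>c. 0) \<Longrightarrow> T \<subseteq> {1..n} \<and> card T = i"
    and "\<And>T. vhomog (d - int i) (z T)" "\<And>T. T \<subseteq> {1..n} \<Longrightarrow> vkdiff n z T = (\<lambda>c. 0)"
    and "d \<noteq> e + int i"
  shows "\<exists>w. (\<forall>T. w T \<in> W) \<and> (\<forall>T\<subseteq>{1..n}. vkdiff n w T = z T)"
  using assms
proof (induction l arbitrary: e W i d z)
  case 0
  then have "z T = (\<lambda>c. 0)" for T by simp
  then show ?case using 0(1) by (intro exI[of _ "\<lambda>T c. 0"]) simp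
next
  case (Suc l)
  note zW = Suc.prems(2) and supp = Suc.prems(3) and hom = Suc.prems(4)
    and cyc = Suc.prems(5) and d = Suc.prems(6)
  obtain k G where G: "gens n e k G" "W = comb k G ` free_vecs n k" "lin_res n l 1 (syzygies n k G)"
    using Suc.prems(1) by auto
  \<comment> \<open>Zero is lifted to zero, so that the lifted chain stays in homological degree
    \<open>i\<close>.\<close>
  have "\<exists>v. v \<in> free_vecs n k \<and> vhomog (d - int i - e) v \<and> comb k G v = z T \<and> (z T = (\<lambda>c. 0) \<longrightarrow> v = (\<lambda>c. 0))" for T
  proof (cases "z T = (\<lambda>c. 0)")
    case True
    then show ?thesis by (intro exI[of _ "\<lambda>c. 0"]) (simp add: zero_free_vecs vhomog_zero)
  next
    case False
    have "z T \<in> comb k G ` free_vecs n k" "vhomog (d - int i - e + e) (z T)"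
      using zW[of T] hom[of T] G(2) by simp_all
    then obtain v where "v \<in> free_vecs n k" "vhomog (d - int i - e) v" "comb k G v = z T"
      by (rule homogeneous_preimage[OF G(1)])
    then show ?thesis using False by blast
  qed
  then obtain v where v: "\<And>T. v T \<in> free_vecs n k" "\<And>T. vhomog (d - int i - e) (v T)"
    "\<And>T. comb k G (v T) = z T" "\<And>T. z T = (\<lambda>c. 0) \<Longrightarrow> v T = (\<lambda>c. 0)"
    by metis
  have vsupp: "T \<subseteq> {1..n} \<and> card T = i" if "v T \<noteq> (\<lambda>c. 0)" for T
    using supp[of T] v(4)[of T] that by blast
  \<comment> \<open>The connecting homomorphism. The differential of the lift \<open>v\<close> is a
    cycle of syzygies, one homological degree lower and shifted by \<open>e\<close> internally.
    Bounding it by a chain \<open>u\<close> of syzygies makes \<open>v - u\<close> a cycle in a free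
    module, hence a boundary, and \<open>comb\<close> does not see \<open>u\<close>. For
    \<open>i = 0\<close> one takes \<open>u = 0\<close>: the entries of \<open>v\<close> have degree
    \<open>d - e\<close>, which is nonzero, and so have no constant term.\<close>
  have "\<exists>u. (\<forall>T. u T \<in> free_vecs n k) \<and> (\<forall>T\<subseteq>{1..n}. vkdiff n u T = vkdiff n v T) \<and>
    (\<forall>T\<subseteq>{1..n}. comb k G (u T) = (\<lambda>c. 0)) \<and> (\<forall>j. lookup (v {} j - u {} j) 0 = 0)"
  proof (cases i)
    case 0
    have "vkdiff n v T = (\<lambda>c. 0)" if T: "T \<subseteq> {1..n}" for T
    proof -
      have "v (insert j T) = (\<lambda>c. 0)" for j
      proof (rule ccontr)
        assume "v (insert j T) \<noteq> (\<lambda>c. 0)"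
        then have "card (insert j T) = 0" "finite (insert j T)"
          using vsupp[of "insert j T"] 0 finite_subset by auto
        then show False by simp
      qed
      then have "vkdiff n v T = vkdiff n (\<lambda>U c. 0) T" by (intro vkdiff_cong) simp
      then show ?thesis by simp
    qed
    moreover have "lookup (v {} j) 0 = 0" for j
      using v(2)[of "{}"] d 0 by (intro homog_const[of "d - int i - e"]) (auto simp: vhomog_def)
    ultimately show ?thesis
      by (intro exI[of _ "\<lambda>T c. 0"]) (simp add: zero_free_vecs)
  next
    case (Suc i')
    define y where "y T = (if T \<subseteq> {1..n} then vkdiff n v T else (\<lambda>c. 0))" for T
    have "\<exists>w. (\<forall>T. w T \<in> syzygies n k G) \<and> (\<forall>T\<subseteq>{1..n}. vkdiff n w T = y T)"
    proof (rule Suc.IH[OF G(3), of y i' "d - e"])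
      show "y T \<in> syzygies n k G" for T
      proof (cases "T \<subseteq> {1..n}")
        case True
        have "comb k G (vkdiff n v T) = vkdiff n z T"
          unfolding vkdiff_comb[symmetric] v(3) by simp
        then show ?thesis
          using True cyc[OF True] vkdiff_free_vecs[OF v(1)] by (simp add: y_def syzygies_def)
      next
        case False
        then show ?thesis using submod_0[OF submod_syzygies[of n k G]] by (simp add: y_def)
      qed
      show "T \<subseteq> {1..n} \<and> card T = i'" if "y T \<noteq> (\<lambda>c. 0)" for T
      proof -
        have T: "T \<subseteq> {1..n}" using that by (auto simp: y_def split: if_splits)
        have "\<exists>j\<in>{1..n} - T. v (insert j T) \<noteq> (\<lambda>c. 0)"
        proof (rule ccontr)
          assume "\<not> ?thesis"
          then have "vkdiff n v T = vkdiff n (\<lambda>U c. 0) T" by (intro vkdiff_cong) simp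
          then show False using that T by (simp add: y_def)
        qed
        then obtain j where "j \<in> {1..n} - T" "v (insert j T) \<noteq> (\<lambda>c. 0)" by blast
        then have "card (insert j T) = i" "j \<notin> T" "finite T"
          using vsupp T finite_subset[of T "{1..n}"] by auto
        then show ?thesis using T Suc by simp
      qed
      show "vhomog (d - e - int i') (y T)" for T
      proof -
        have "homog (d - int i - e + 1) (kdiff {1..n} var (\<lambda>U. v U c) T)" for c
          using v(2) by (intro homog_kdiff) (simp add: vhomog_def)
        moreover have "d - int i - e + 1 = d - e - int i'" using Suc by simp
        ultimately show ?thesis by (simp add: y_def vhomog_def vkdiff_def)
      qed
      show "vkdiff n y T = (\<lambda>c. 0)" if T: "T \<subseteq> {1..n}" for T
      proof -
        have "vkdiff n y T = vkdiff n (vkdiff n v) T"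
          using T by (intro vkdiff_cong) (simp add: y_def)
        then show ?thesis using vkdiff_vkdiff[OF T] by simp
      qed
      show "d - e \<noteq> 1 + int i'" using d Suc by simp
    qed
    then obtain w where w: "\<And>T. w T \<in> syzygies n k G" "\<And>T. T \<subseteq> {1..n} \<Longrightarrow> vkdiff n w T = y T"
      by blast
    \<comment> \<open>The chain \<open>w\<close> may have parts in other homological degrees.
      Discarding them preserves the differential and makes the chain vanish at
      \<open>{}\<close>.\<close>
    define u where "u T = (if card T = i then w T else (\<lambda>c. 0))" for T
    have u: "u T \<in> syzygies n k G" for T
      using w(1)[of T] submod_0[OF submod_syzygies[of n k G]] by (simp add: u_def)
    have "vkdiff n u T = vkdiff n v T" if T: "T \<subseteq> {1..n}" for T
    proof (cases "card T = i'")
      case True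
      have "finite T" using T finite_subset by auto
      then have "vkdiff n u T = vkdiff n w T" using True Suc by (intro vkdiff_cong) (simp add: u_def)
      then show ?thesis using w(2)[OF T] T by (simp add: y_def)
    next
      case False
      have cT: "card (insert j T) \<noteq> i" if "j \<in> {1..n} - T" for j
        using that T finite_subset[of T "{1..n}"] False Suc by simp
      have "vkdiff n u T = vkdiff n (\<lambda>U c. 0) T"
        using cT by (intro vkdiff_cong) (simp add: u_def)
      moreover have "vkdiff n v T = vkdiff n (\<lambda>U c. 0) T"
        using cT vsupp by (intro vkdiff_cong) blast
      ultimately show ?thesis by simp
    qed
    moreover have "v {} = (\<lambda>c. 0)" using vsupp[of "{}"] Suc by auto
    moreover have "u {} = (\<lambda>c. 0)" using Suc by (simp add: u_def)
    ultimately show ?thesis using u by (intro exI[of _ u]) (simp add: syzygies_def)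
  qed
  then obtain u where u: "\<And>T. u T \<in> free_vecs n k" "\<And>T. T \<subseteq> {1..n} \<Longrightarrow> vkdiff n u T = vkdiff n v T"
    "\<And>T. T \<subseteq> {1..n} \<Longrightarrow> comb k G (u T) = (\<lambda>c. 0)" "\<And>j. lookup (v {} j - u {} j) 0 = 0"
    by blast
  have "\<exists>x. (\<forall>T. x T \<in> free_vecs n k) \<and> (\<forall>T\<subseteq>{1..n}. vkdiff n x T = (\<lambda>c. v T c - u T c))"
  proof (rule vkoszul_exact)
    show "(\<lambda>c. v T c - u T c) \<in> free_vecs n k" for T
      using submod_diff[OF submod_free_vecs v(1) u(1)] .
    show "vkdiff n (\<lambda>T c. v T c - u T c) T = (\<lambda>c. 0)" if "T \<subseteq> {1..n}" for T
      unfolding vkdiff_diff u(2)[OF that] by simp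
  qed (rule u(4))
  then obtain x where x: "\<And>T. x T \<in> free_vecs n k" "\<And>T. T \<subseteq> {1..n} \<Longrightarrow> vkdiff n x T = (\<lambda>c. v T c - u T c)"
    by blast
  show ?case
  proof (intro exI[of _ "\<lambda>T. comb k G (x T)"] conjI allI impI)
    show "comb k G (x T) \<in> W" for T using x(1) G(2) by blast
    fix T :: "nat set" assume T: "T \<subseteq> {1..n}"
    have "v T = (\<lambda>c. (v T c - u T c) + u T c)" by simp
    then have "z T = (\<lambda>i. comb k G (\<lambda>c. v T c - u T c) i + comb k G (u T) i)"
      using v(3)[of T] comb_add[of k G "\<lambda>c. v T c - u T c" "u T"] by simp
    then show "vkdiff n (\<lambda>T. comb k G (x T)) T = z T"
      unfolding vkdiff_comb x(2)[OF T] u(3)[OF T] by simp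
  qed
qed

section \<open>Cycles obstructing a linear resolution\<close>

text \<open>Left multiplication by the product of the differences. Evaluated at a full set
  \<open>W\<close> it is, up to signs, the pairing of the product with the cochain sending
  \<open>F\<close> to \<open>g (W - F)\<close>.\<close>

fun pairs_op :: "(nat \<times> nat) list \<Rightarrow> (nat set \<Rightarrow> 'a::comm_ring_1) \<Rightarrow> nat set \<Rightarrow> 'a" where
  "pairs_op [] g = g"
| "pairs_op ((z, b) # ps) g = (\<lambda>T. kwedge z (pairs_op ps g) T - kwedge b (pairs_op ps g) T)"

text \<open>For coefficients 1 the homotopy formula says that wedging a cycle with any vertex and
  then differentiating returns the cycle. The contributions of \<open>z\<close> and \<open>b\<close>
  therefore cancel.\<close>

lemma kdiff_pairs_op:
  assumes V: "finite V" and "support ps \<subseteq> V" and g: "\<And>T. T \<subseteq> V \<Longrightarrow> kdiff V (\<lambda>_. 1) g T = 0" and "T \<subseteq> V"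
  shows "kdiff V (\<lambda>_. 1) (pairs_op ps g) T = 0"
  using assms(2,4)
proof (induction ps arbitrary: T rule: fresh_pairs.induct)
  case 1
  then show ?case using g by simp
next
  case (2 z b ps)
  have "kdiff V (\<lambda>_. 1) (kwedge v (pairs_op ps g)) T = pairs_op ps g T" if v: "v \<in> V" for v
  proof -
    have "kdiff V (\<lambda>_. 1) (pairs_op ps g) (T - {v}) = 0"
      using 2 by (intro "2.IH") auto
    then have "kwedge v (kdiff V (\<lambda>_. 1) (pairs_op ps g)) T = 0" by (simp add: kwedge_def)
    then show ?thesis
      using kdiff_kwedge[of V v T "\<lambda>x. x" "\<lambda>_. 1" "pairs_op ps g"] V v "2.prems"(2) by simp
  qed
  then show ?case using "2.prems"(1) by (simp add: kdiff_diff)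
qed

text \<open>Only transversals of full size need to be tested, since \<open>kwedge\<close> kills
  repeated choices.\<close>

lemma pairs_op_0:
  assumes "\<And>F. F \<in> transversals ps \<Longrightarrow> F \<subseteq> U \<Longrightarrow> card F = length ps \<Longrightarrow> g (U - F) = 0" "finite U"
  shows "pairs_op ps g U = 0"
  using assms
proof (induction ps arbitrary: U rule: fresh_pairs.induct)
  case 1
  then show ?case by simp
next
  case (2 z b ps)
  have "pairs_op ps g (U - {v}) = 0" if v: "v \<in> U" "v = z \<or> v = b" for v
  proof (rule "2.IH")
    show "g (U - {v} - F) = 0" if F: "F \<in> transversals ps" "F \<subseteq> U - {v}" "card F = length ps" for F
    proof -
      have "v \<notin> F" "finite F" using F(2) "2.prems"(2) finite_subset[of F U] by auto
      then have "g (U - insert v F) = 0"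
        using F v by (intro "2.prems"(1)) auto
      then show ?thesis unfolding Diff_insert2[of U v F] .
    qed
    show "finite (U - {v})" using "2.prems"(2) by simp
  qed
  then show ?case by (simp add: kwedge_def)
qed

text \<open>Choosing \<open>b\<close> in the first pair loses \<open>z\<close> for good, because
  \<open>z\<close> occurs nowhere later; such a choice cannot give the set of first components.
  Exactly one term survives, and its coefficient is a sign.\<close>

lemma pairs_op_firsts:
  assumes "fresh_pairs ps" "fst ` set ps \<subseteq> U" "finite U"
    and "\<And>F. F \<in> transversals ps \<Longrightarrow> F \<subseteq> U \<Longrightarrow> card F = length ps \<Longrightarrow>
      g (U - F) = (if F = fst ` set ps then 1 else 0)"
  shows "pairs_op ps g U = 1 \<or> pairs_op ps g U = - 1"
  using assms
proof (induction ps arbitrary: U rule: fresh_pairs.induct)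
  case 1
  then show ?case by simp
next
  case (2 z b ps)
  have fresh: "z \<noteq> b" "z \<notin> support ps" "fresh_pairs ps" using "2.prems"(1) by auto
  have z: "z \<in> U" "z \<notin> fst ` set ps" using "2.prems"(2) fresh(2) by (auto simp: support_def)
  have zF: "z \<notin> F" if "F \<in> transversals ps" for F
    using transversal_subset[OF that] fresh(2) by auto
  have fin: "finite F" if "F \<subseteq> U" for F using that "2.prems"(3) finite_subset by auto
  have 1: "pairs_op ps g (U - {z}) = 1 \<or> pairs_op ps g (U - {z}) = - 1"
  proof (rule "2.IH"[OF fresh(3)])
    show "fst ` set ps \<subseteq> U - {z}" using "2.prems"(2) z(2) by auto
    show "finite (U - {z})" using "2.prems"(3) by simp
    show "g (U - {z} - F) = (if F = fst ` set ps then 1 else 0)"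
      if F: "F \<in> transversals ps" "F \<subseteq> U - {z}" "card F = length ps" for F
    proof -
      have "z \<notin> F" "F \<subseteq> U" "finite F" using F(2) fin[of F] by auto
      then have "g (U - insert z F) = (if insert z F = fst ` set ((z, b) # ps) then 1 else 0)"
        using F z by (intro "2.prems"(4)) auto
      moreover have "insert z F = fst ` set ((z, b) # ps) \<longleftrightarrow> F = fst ` set ps"
        using zF[OF F(1)] z(2) by (auto simp: insert_ident)
      ultimately show ?thesis unfolding Diff_insert2[of U z F] by simp
    qed
  qed
  have 0: "pairs_op ps g (U - {b}) = 0" if b: "b \<in> U"
  proof (rule pairs_op_0)
    show "g (U - {b} - F) = 0" if F: "F \<in> transversals ps" "F \<subseteq> U - {b}" "card F = length ps" for F
    proof -
      have "b \<notin> F" "finite F" using F(2) fin[of F] by auto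
      then have "g (U - insert b F) = (if insert b F = fst ` set ((z, b) # ps) then 1 else 0)"
        using F b by (intro "2.prems"(4)) auto
      moreover have "insert b F \<noteq> fst ` set ((z, b) # ps)"
        using zF[OF F(1)] fresh(1) by auto
      ultimately show ?thesis unfolding Diff_insert2[of U b F] by simp
    qed
    show "finite (U - {b})" using "2.prems"(3) by simp
  qed
  have eq: "pairs_op ((z, b) # ps) g U = ksign z (U - {z}) * pairs_op ps g (U - {z})"
    using 0 z(1) by (simp add: kwedge_def)
  have "ksign z (U - {z}) = (1 :: 'a) \<or> ksign z (U - {z}) = (- 1 :: 'a)" by (rule ksign_cases)
  then show ?case
  proof
    assume s: "ksign z (U - {z}) = (1 :: 'a)"
    show ?thesis unfolding eq s using 1 by simp
  next
    assume s: "ksign z (U - {z}) = (- 1 :: 'a)"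
    show ?thesis unfolding eq s using 1 by auto
  qed
qed

lemma card_firsts: "fresh_pairs ps \<Longrightarrow> card (fst ` set ps) = length ps"
proof (induction ps rule: fresh_pairs.induct)
  case (2 z b ps)
  then have "z \<notin> fst ` set ps" by (auto simp: support_def)
  then show ?case using 2 by simp
qed simp

section \<open>Squarefree monomials and ideals of nonfaces\<close>

definition expo :: "nat set \<Rightarrow> nat \<Rightarrow>\<^sub>0 nat" where
  "expo F = (\<Sum>i\<in>F. single i 1)"

lemma lookup_expo: "finite F \<Longrightarrow> lookup (expo F) j = (if j \<in> F then 1 else 0)"
  by (simp add: expo_def lookup_sum lookup_single when_def)

lemma keys_expo: "finite F \<Longrightarrow> keys (expo F) = F"
  by (auto simp: in_keys_iff lookup_expo split: if_splits)

lemma mdegree_expo: "finite F \<Longrightarrow> mdegree (expo F) = card F"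
  by (simp add: mdegree_def keys_expo lookup_expo)

lemma expo_insert: "finite F \<Longrightarrow> j \<notin> F \<Longrightarrow> expo (insert j F) = single j 1 + expo F"
  by (simp add: expo_def)

lemma expo_diff_single:
  assumes "finite F" "j \<in> F"
  shows "expo F - single j 1 = expo (F - {j})"
  using expo_insert[of "F - {j}" j] assms by (simp add: insert_absorb)

text \<open>For a simplicial complex this is its Stanley-Reisner ideal, in a form where membership
  is tested monomial by monomial.\<close>

definition mono_ideal :: "nat \<Rightarrow> nat set set \<Rightarrow> 'k::field mpoly set" where
  "mono_ideal n \<Delta> = {f \<in> polys n. \<forall>m. lookup f m \<noteq> 0 \<longrightarrow> keys m \<notin> \<Delta>}"

text \<open>An ideal viewed as a submodule of the free module of rank 1, so that
  \<open>lin_res\<close> applies to it.\<close>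

definition vec_embed :: "'k::field mpoly set \<Rightarrow> 'k vec set" where
  "vec_embed I = {v. v 0 \<in> I \<and> (\<forall>j>0. v j = 0)}"

lemma mono_ideal_sum: "(\<And>i. i \<in> A \<Longrightarrow> f i \<in> mono_ideal n \<Delta>) \<Longrightarrow> sum f A \<in> mono_ideal n \<Delta>"
proof (induction A rule: infinite_finite_induct)
  case (insert x F)
  then have *: "f x \<in> mono_ideal n \<Delta>" "sum f F \<in> mono_ideal n \<Delta>" by auto
  then have "f x + sum f F \<in> polys n" by (auto simp: mono_ideal_def)
  moreover have "keys m \<notin> \<Delta>" if "lookup (f x + sum f F) m \<noteq> 0" for m
  proof -
    have "lookup (f x) m \<noteq> 0 \<or> lookup (sum f F) m \<noteq> 0"
      using that by (auto simp: lookup_add)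
    then show ?thesis using * by (auto simp: mono_ideal_def)
  qed
  ultimately show ?case using insert by (simp add: mono_ideal_def)
qed (simp_all add: mono_ideal_def)

lemma lookup_ksign_mult: "lookup (ksign j T * f) m = ksign j T * lookup f m"
  unfolding ksign_def by (cases "even (card {t \<in> T. t < j})") simp_all

text \<open>In squarefree multidegree \<open>W\<close> the basis element \<open>e_T\<close> is
  accompanied by the monomial of \<open>W - T\<close>. Multiplication by a variable only moves the
  index from \<open>W - T\<close> to \<open>T\<close>, so on coefficients the Koszul differential
  becomes the simplicial one.\<close>

lemma lookup_kdiff_expo:
  fixes y :: "nat set \<Rightarrow> 'k::field mpoly"
  assumes W: "W \<subseteq> {1..n}" and T: "T \<subseteq> W"
  shows "lookup (kdiff {1..n} var y T) (expo (W - T)) =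
    kdiff W (\<lambda>_. 1) (\<lambda>T. lookup (y T) (expo (W - T))) T"
proof -
  have fin: "finite (W - T)" using W finite_subset by blast
  have "lookup (kdiff {1..n} var y T) (expo (W - T)) =
      (\<Sum>j\<in>{1..n} - T. ksign j T * lookup (var j * y (insert j T)) (expo (W - T)))"
    by (simp add: kdiff_def lookup_sum lookup_ksign_mult mult.assoc)
  also have "\<dots> = (\<Sum>j\<in>W - T. ksign j T * lookup (y (insert j T)) (expo (W - insert j T)))"
  proof (rule sum.mono_neutral_cong_right)
    show "W - T \<subseteq> {1..n} - T" using W by auto
    show "\<forall>j\<in>{1..n} - T - (W - T). ksign j T * lookup (var j * y (insert j T)) (expo (W - T)) = 0"
    proof
      fix j assume "j \<in> {1..n} - T - (W - T)"
      then have "lookup (expo (W - T)) j = 0" unfolding lookup_expo[OF fin] by auto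
      then show "ksign j T * lookup (var j * y (insert j T)) (expo (W - T)) = 0"
        by (simp add: lookup_var_mult)
    qed
    show "ksign j T * lookup (var j * y (insert j T)) (expo (W - T)) =
        ksign j T * lookup (y (insert j T)) (expo (W - insert j T))" if j: "j \<in> W - T" for j
    proof -
      have "expo (W - T) - single j 1 = expo (W - insert j T)"
        using expo_diff_single[OF fin j] by (simp add: Diff_insert[of W j T])
      then show ?thesis using fin j by (simp add: lookup_var_mult lookup_expo)
    qed
  qed simp
  finally show ?thesis by (simp add: kdiff_def)
qed

text \<open>Hochster's formula made explicit for one class. The cochain dual to the set of first
  components has a Koszul differential inside the ideal. Were this differential the boundary of a
  chain in the ideal, correcting the cochain by that chain would give a simplicial cycle on the full
  simplex whose pairing with the product is a sign; but the result of that pairing is a top-degree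
  chain killed by the differential, hence zero.\<close>

theorem lin_res_cycles_in_degree:
  fixes \<Delta> :: "nat set set"
  assumes lin: "lin_res n l p (vec_embed (mono_ideal n \<Delta>) :: 'k::field vec set)"
  shows "cycles_in_degree {1..n} \<Delta> (nat p)"
  unfolding cycles_in_degree_def
proof (intro allI impI, rule ccontr)
  fix W ps
  assume W: "W \<subseteq> {1..n}" and ps: "fresh_pairs ps" "support ps \<subseteq> W" "transversals ps \<subseteq> \<Delta>"
    and len: "length ps < card W" and nonface: "\<forall>F\<subseteq>W. card F = length ps + 1 \<longrightarrow> F \<notin> \<Delta>"
    and "nat p \<noteq> length ps + 1"
  then have p: "p \<noteq> int (length ps) + 1" by auto
  define k where "k = length ps"
  define F where "F = fst ` set ps"
  have fW: "finite W" using W finite_subset by auto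
  have F: "F \<subseteq> W" "card F = k" "finite F"
    using ps(2) card_firsts[OF ps(1)] by (auto simp: F_def k_def support_def)
  \<comment> \<open>The monomial of \<open>F\<close> times \<open>e_(W - F)\<close>. Each nonzero
    term of its differential carries the monomial of \<open>insert j F\<close> with \<open>j\<close>
    in \<open>W\<close>, a set of \<open>k + 1\<close> elements and so a nonface.\<close>
  define x where "x T = (if T = W - F then single (expo F) 1 else 0 :: 'k mpoly)" for T
  define \<zeta> where "\<zeta> T = (if T \<subseteq> {1..n} then kdiff {1..n} var x T else 0)" for T
  have in_ideal: "ksign j T * var j * x (insert j T) \<in> mono_ideal n \<Delta>" if "j \<notin> T" for j T
  proof (cases "insert j T = W - F")
    case True
    then have j: "j \<in> W" "j \<notin> F" by auto
    have "var j * x (insert j T) = single (expo (insert j F)) 1"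
      using True F(3) j(2) by (simp add: x_def var_def mult_single expo_insert)
    moreover have "insert j F \<notin> \<Delta>"
      using nonface F j by (auto simp: k_def)
    moreover have "insert j F \<subseteq> {1..n}" using F(1) j(1) W by auto
    ultimately show ?thesis
      using F(3) by (auto simp: mono_ideal_def polys_iff mult.assoc lookup_ksign_mult lookup_single when_def keys_expo)
  next
    case False
    then show ?thesis by (simp add: x_def mono_ideal_def)
  qed
  have \<zeta>I: "\<zeta> T \<in> mono_ideal n \<Delta>" for T
  proof (cases "T \<subseteq> {1..n}")
    case True
    then show ?thesis unfolding \<zeta>_def kdiff_def by (auto intro!: mono_ideal_sum in_ideal)
  next
    case False
    then show ?thesis by (simp add: \<zeta>_def mono_ideal_def)
  qed
  \<comment> \<open>The cycle sits in homological degree \<open>i\<close> and internal degree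
    \<open>card W\<close>. The one degree that a linear resolution allows,
    \<open>card W = p + i\<close>, means \<open>p = k + 1\<close>.\<close>
  define i where "i = card W - k - 1"
  have i: "card W = i + k + 1" using len by (simp add: i_def k_def)
  have cWF: "card (W - F) = i + 1" using F fW i by (simp add: card_Diff_subset)
  have \<zeta>supp: "T \<subseteq> {1..n} \<and> card T = i" if "\<zeta> T \<noteq> 0" for T
  proof -
    have T: "T \<subseteq> {1..n}" using that by (auto simp: \<zeta>_def split: if_splits)
    have "\<exists>j\<in>{1..n} - T. x (insert j T) \<noteq> 0"
    proof (rule ccontr)
      assume "\<not> ?thesis"
      then have "kdiff {1..n} var x T = kdiff {1..n} var (\<lambda>U. 0) T" by (intro kdiff_cong) auto
      then show False using that T by (simp add: \<zeta>_def)
    qed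
    then obtain j where j: "j \<notin> T" "x (insert j T) \<noteq> 0" by blast
    then have "insert j T = W - F" by (auto simp: x_def split: if_splits)
    moreover have "finite T" using T finite_subset by auto
    ultimately show ?thesis using T cWF j(1) by (metis Suc_eq_plus1 card_insert_disjoint add_right_cancel)
  qed
  have xhom: "homog (int k) (x T)" for T
    using F by (auto simp: x_def homog_def lookup_single when_def mdegree_expo)
  have \<zeta>hom: "homog (int k + 1) (\<zeta> T)" for T
    using homog_kdiff[of "int k" x "{1..n}" T] xhom by (simp add: \<zeta>_def)
  have \<zeta>cyc: "kdiff {1..n} var \<zeta> T = 0" if T: "T \<subseteq> {1..n}" for T
  proof -
    have "kdiff {1..n} var \<zeta> T = kdiff {1..n} var (kdiff {1..n} var x) T"
      using T by (intro kdiff_cong) (auto simp: \<zeta>_def)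
    also have "\<dots> = 0" using T finite_subset by (intro kdiff_kdiff) auto
    finally show ?thesis .
  qed
  define z where "z T = (\<lambda>j. if j = (0 :: nat) then \<zeta> T else 0)" for T
  have "\<exists>w. (\<forall>T. w T \<in> vec_embed (mono_ideal n \<Delta>)) \<and> (\<forall>T\<subseteq>{1..n}. vkdiff n w T = z T)"
  proof (rule koszul_vanishing[OF lin, of z i "int (card W)"])
    show "z T \<in> vec_embed (mono_ideal n \<Delta>)" for T using \<zeta>I by (simp add: vec_embed_def z_def)
    show "T \<subseteq> {1..n} \<and> card T = i" if "z T \<noteq> (\<lambda>c. 0)" for T
      using that by (intro \<zeta>supp) (auto simp: z_def)
    show "vhomog (int (card W) - int i) (z T)" for T
      using \<zeta>hom[of T] i by (simp add: vhomog_def z_def add.commute)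
    show "vkdiff n z T = (\<lambda>c. 0)" if "T \<subseteq> {1..n}" for T
      unfolding vkdiff_def
    proof
      show "kdiff {1..n} var (\<lambda>U. z U c) T = 0" for c
        using \<zeta>cyc[OF that] by (cases "c = 0") (simp_all add: z_def)
    qed
    show "int (card W) \<noteq> p + int i" using p i by (simp add: k_def)
  qed
  then obtain w where w: "\<And>T. w T \<in> vec_embed (mono_ideal n \<Delta>)" "\<And>T. T \<subseteq> {1..n} \<Longrightarrow> vkdiff n w T = z T"
    by blast
  define w0 where "w0 = (\<lambda>T. w T 0)"
  have w0I: "w0 T \<in> mono_ideal n \<Delta>" for T using w(1)[of T] by (simp add: w0_def vec_embed_def)
  have w0: "kdiff {1..n} var w0 T = kdiff {1..n} var x T" if "T \<subseteq> {1..n}" for T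
    using fun_cong[OF w(2)[OF that], of 0] that by (simp add: vkdiff_def w0_def z_def \<zeta>_def)
  \<comment> \<open>A Koszul cycle over the whole ring. Elements of the ideal have no face among the
    supports of their monomials, so on transversals, which are faces, the correction
    \<open>w0\<close> is invisible.\<close>
  define y where "y = (\<lambda>T. x T - w0 T)"
  define g where "g = (\<lambda>T. lookup (y T) (expo (W - T)))"
  have gcyc: "kdiff W (\<lambda>_. 1) g T = 0" if T: "T \<subseteq> W" for T
  proof -
    have "kdiff {1..n} var y T = 0"
      unfolding y_def kdiff_diff using w0[of T] T W by auto
    then show ?thesis using lookup_kdiff_expo[OF W T, of y] by (simp add: g_def)
  qed
  have gF: "g (W - G) = (if G = F then 1 else 0)" if G: "G \<in> transversals ps" "G \<subseteq> W" for G
  proof -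
    have "finite G" using G(2) fW finite_subset by auto
    moreover have "W - (W - G) = G" using G(2) by auto
    moreover have "G \<in> \<Delta>" using G(1) ps(3) by auto
    ultimately have "g (W - G) = lookup (x (W - G)) (expo G)"
      using w0I[of "W - G"] by (auto simp: g_def y_def lookup_minus mono_ideal_def keys_expo)
    moreover have "W - G = W - F \<longleftrightarrow> G = F" using G(2) F(1) by blast
    ultimately show ?thesis by (simp add: x_def)
  qed
  have pm: "pairs_op ps g W = 1 \<or> pairs_op ps g W = - 1"
    using gF F(1) fW by (intro pairs_op_firsts[OF ps(1)]) (auto simp: F_def)
  obtain j where j: "j \<in> W" using len by (metis card.empty equals0I less_nat_zero_code)
  \<comment> \<open>On a set missing just one element the differential has a single term, namely the
    value at \<open>W\<close> up to sign.\<close>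
  have "kdiff W (\<lambda>_. 1) (pairs_op ps g) (W - {j}) = 0"
    using gcyc by (intro kdiff_pairs_op[OF fW ps(2)]) auto
  moreover have "W - (W - {j}) = {j}" "insert j (W - {j}) = W" using j by auto
  ultimately have "ksign j (W - {j}) * pairs_op ps g W = 0" by (simp add: kdiff_def)
  then have "pairs_op ps g W = 0"
    using ksign_mult_square[of j "W - {j}" "pairs_op ps g W"] by (simp only: mult_zero_right)
  then show False using pm by simp
qed

section \<open>Monomial ideals\<close>

lemma carrier_free_module: "carrier (free_module n k) = free_vecs n k"
  by (auto simp: free_module_def free_vecs_def not_less) (metis polys_0 not_less)

lemma poly_ring_simps:
  "f \<otimes>\<^bsub>poly_ring n\<^esub> g = f * g" "f \<oplus>\<^bsub>poly_ring n\<^esub> g = f + g" "\<zero>\<^bsub>poly_ring n\<^esub> = 0"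
  by (simp_all add: poly_ring_def)

lemma poly_ring_minus:
  assumes "f \<in> polys n"
  shows "\<ominus>\<^bsub>poly_ring n\<^esub> f = - f"
proof -
  interpret cring "poly_ring n :: 'a mpoly ring" by (rule poly_ring_cring)
  show ?thesis using assms by (intro minus_equality) (auto simp: poly_ring_simps)
qed

lemma ideal_sum:
  assumes I: "ideal I (poly_ring n)" and f: "\<And>i. i \<in> A \<Longrightarrow> f i \<in> I"
  shows "sum f A \<in> I"
proof -
  interpret ideal I "poly_ring n" by (rule I)
  show ?thesis using f
  proof (induction A rule: infinite_finite_induct)
    case (insert x F)
    then have "f x \<in> I" "sum f F \<in> I" by blast+
    then show ?case
      using insert.hyps additive_subgroup.a_closed[OF is_additive_subgroup, of "f x" "sum f F"]
      by (simp add: poly_ring_simps)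
  qed (use additive_subgroup.zero_closed[OF is_additive_subgroup] in \<open>simp_all add: poly_ring_simps\<close>)
qed

lemma ideal_mult: "ideal I (poly_ring n) \<Longrightarrow> f \<in> polys n \<Longrightarrow> g \<in> I \<Longrightarrow> f * g \<in> I"
  using ideal.I_l_closed[of I "poly_ring n" g f] by (simp add: poly_ring_simps)

lemma ideal_mono_ideal:
  assumes down: "\<And>F G. F \<in> \<Delta> \<Longrightarrow> G \<subseteq> F \<Longrightarrow> G \<in> \<Delta>"
  shows "ideal (mono_ideal n \<Delta>) (poly_ring n :: 'k::field mpoly ring)"
proof -
  interpret cring "poly_ring n :: 'k mpoly ring" by (rule poly_ring_cring)
  have mult: "f * g \<in> mono_ideal n \<Delta>" if f: "f \<in> mono_ideal n \<Delta>" and g: "g \<in> polys n" for f g :: "'k mpoly"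
  proof -
    have "keys m \<notin> \<Delta>" if "lookup (f * g) m \<noteq> 0" for m
    proof -
      obtain a b where ab: "m = a + b" "lookup f a \<noteq> 0"
        using \<open>lookup (f * g) m \<noteq> 0\<close> by (rule lookup_mult_nonzero)
      have "keys a \<subseteq> keys m" by (auto simp: ab(1) in_keys_iff lookup_add)
      moreover have "keys a \<notin> \<Delta>" using f ab(2) by (simp add: mono_ideal_def)
      ultimately show ?thesis using down by blast
    qed
    then show ?thesis using f g by (auto simp: mono_ideal_def)
  qed
  show ?thesis
  proof (rule idealI)
    show "ring (poly_ring n :: 'k mpoly ring)" by (rule ring_axioms)
    show "subgroup (mono_ideal n \<Delta>) (add_monoid (poly_ring n :: 'k mpoly ring))"
    proof (rule subgroup.intro)
      show "mono_ideal n \<Delta> \<subseteq> carrier (add_monoid (poly_ring n :: 'k mpoly ring))"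
        by (auto simp: mono_ideal_def)
      show "f \<otimes>\<^bsub>add_monoid (poly_ring n)\<^esub> g \<in> mono_ideal n \<Delta>"
        if "f \<in> mono_ideal n \<Delta>" "g \<in> mono_ideal n \<Delta>" for f g :: "'k mpoly"
        using mono_ideal_sum[of "{True, False}" "\<lambda>b. if b then f else g" n \<Delta>] that
        by (simp add: poly_ring_simps)
      show "\<one>\<^bsub>add_monoid (poly_ring n)\<^esub> \<in> (mono_ideal n \<Delta> :: 'k mpoly set)"
        by (simp add: poly_ring_simps mono_ideal_def)
      show "inv\<^bsub>add_monoid (poly_ring n)\<^esub> f \<in> mono_ideal n \<Delta>" if "f \<in> mono_ideal n \<Delta>" for f :: "'k mpoly"
        using that poly_ring_minus[of f n] by (simp add: a_inv_def mono_ideal_def polys_uminus)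
    qed
    show "g \<otimes>\<^bsub>poly_ring n\<^esub> f \<in> mono_ideal n \<Delta>" "f \<otimes>\<^bsub>poly_ring n\<^esub> g \<in> mono_ideal n \<Delta>"
      if "f \<in> mono_ideal n \<Delta>" "g \<in> polys n" for f g :: "'k mpoly"
      using mult[OF that] by (simp_all add: poly_ring_simps mult.commute)
  qed
qed

lemma prod_var: "finite F \<Longrightarrow> (\<Prod>i\<in>F. var i) = single (expo F) 1"
proof (induction F rule: finite_induct)
  case (insert x F)
  then show ?case by (simp add: var_def mult_single expo_insert)
qed (simp add: expo_def)

lemma sum_monomials: "(\<Sum>m\<in>keys f. single m (lookup f m)) = f"
  by (rule poly_mapping_eqI) (auto simp: lookup_sum lookup_single when_def in_keys_iff)

text \<open>Every monomial is divisible by the squarefree monomial of its support, and that support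
  is a nonface for the monomials in question.\<close>

lemma stanley_reisner_ideal_eq:
  assumes down: "\<And>F G. F \<in> \<Delta> \<Longrightarrow> G \<subseteq> F \<Longrightarrow> G \<in> \<Delta>"
  shows "stanley_reisner_ideal n \<Delta> = (mono_ideal n \<Delta> :: 'k::field mpoly set)"
proof -
  interpret cring "poly_ring n :: 'k mpoly ring" by (rule poly_ring_cring)
  let ?N = "{\<Prod>i\<in>F. var i :: 'k mpoly | F. F \<subseteq> {1..n} \<and> F \<notin> \<Delta>}"
  have fin: "finite F" if "F \<subseteq> {1..n}" for F using that finite_subset by auto
  have N: "?N \<subseteq> polys n" using prod_var_closed by blast
  have I: "ideal (genideal (poly_ring n) ?N) (poly_ring n)" using N by (rule genideal_ideal)
  have "genideal (poly_ring n) ?N \<subseteq> mono_ideal n \<Delta>"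
  proof (intro genideal_minimal ideal_mono_ideal)
    show "?N \<subseteq> mono_ideal n \<Delta>"
    proof
      fix f assume "f \<in> ?N"
      then obtain F where F: "f = (\<Prod>i\<in>F. var i)" "F \<subseteq> {1..n}" "F \<notin> \<Delta>" by blast
      have "f = single (expo F) 1" unfolding F(1) by (rule prod_var[OF fin[OF F(2)]])
      then show "f \<in> mono_ideal n \<Delta>"
        using F(2,3) keys_expo[OF fin[OF F(2)]]
        by (auto simp: mono_ideal_def polys_iff lookup_single when_def split: if_splits)
    qed
  qed (rule down)
  moreover have "mono_ideal n \<Delta> \<subseteq> genideal (poly_ring n) ?N"
  proof
    fix f :: "'k mpoly" assume f: "f \<in> mono_ideal n \<Delta>"
    have "single m (lookup f m) \<in> genideal (poly_ring n) ?N"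
      if m: "m \<in> keys f" for m
    proof -
      define F where "F = keys m"
      have F: "F \<notin> \<Delta>" "F \<subseteq> {1..n}" "finite F"
        using f m by (auto simp: mono_ideal_def in_keys_iff F_def polys_iff)
      have eq: "m = (m - expo F) + expo F"
        using F(3) by (intro poly_mapping_eqI) (auto simp: lookup_add lookup_minus lookup_expo F_def in_keys_iff)
      have "keys (m - expo F) \<subseteq> {1..n}"
        using F(2) by (auto simp: in_keys_iff lookup_minus F_def)
      then have "single (m - expo F) (lookup f m) \<in> polys n"
        by (auto simp: polys_iff lookup_single when_def)
      moreover have "(\<Prod>i\<in>F. var i) \<in> genideal (poly_ring n) ?N"
        using genideal_self[OF N] F(1,2) by blast
      ultimately have "single (m - expo F) (lookup f m) * (\<Prod>i\<in>F. var i)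
          \<in> genideal (poly_ring n) ?N"
        by (rule ideal_mult[OF I])
      then show ?thesis using eq by (simp add: prod_var[OF F(3)] mult_single)
    qed
    then have "(\<Sum>m\<in>keys f. single m (lookup f m)) \<in> genideal (poly_ring n) ?N"
      by (rule ideal_sum[OF I])
    then show "f \<in> genideal (poly_ring n) ?N" by (simp add: sum_monomials)
  qed
  ultimately show ?thesis by (simp add: stanley_reisner_ideal_def)
qed

lemma lookup_mult_const:
  fixes f g :: "'k::field mpoly"
  assumes "lookup g 0 = 0"
  shows "lookup (f * g) 0 = 0"
proof (rule ccontr)
  assume "lookup (f * g) 0 \<noteq> 0"
  then obtain a b where ab: "0 = a + b" "lookup g b \<noteq> 0" by (rule lookup_mult_nonzero)
  have "lookup b k = 0" for k
    using arg_cong[OF ab(1), of "\<lambda>m. lookup m k"] by (simp add: lookup_add)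
  then have "b = 0" by (intro poly_mapping_eqI) simp
  then show False using ab(2) assms by simp
qed

text \<open>Koszul exactness in homological degree 0: a polynomial without constant term, placed at
  \<open>{}\<close>, is a boundary, that is, a combination of the variables.\<close>

lemma irrelevant_idealI:
  assumes f: "f \<in> polys n" "lookup f 0 = 0"
  shows "f \<in> irrelevant_ideal n"
proof -
  interpret cring "poly_ring n :: 'a mpoly ring" by (rule poly_ring_cring)
  have V: "(var ` {1..n} :: 'a mpoly set) \<subseteq> polys n" by auto
  have I: "ideal (irrelevant_ideal n :: 'a mpoly set) (poly_ring n)"
    unfolding irrelevant_ideal_def using V by (rule genideal_ideal)
  have var: "(var j :: 'a mpoly) \<in> irrelevant_ideal n" if "j \<in> {1..n}" for j
    unfolding irrelevant_ideal_def using genideal_self[OF V] that by blast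
  define z where "z T = (if T = {} then f else 0)" for T :: "nat set"
  have "\<exists>w. (\<forall>T. w T \<in> polys n) \<and> (\<forall>T\<subseteq>{1..n}. kdiff {1..n} var w T = z T)"
    using f by (intro koszul_exact) (auto simp: z_def kdiff_def)
  then obtain w where w: "\<And>T. w T \<in> polys n" and "\<And>T. T \<subseteq> {1..n} \<Longrightarrow> kdiff {1..n} var w T = z T"
    by blast
  from this(2)[of "{}"] have wf: "kdiff {1..n} var w {} = f" by (simp add: z_def)
  have "(\<Sum>j\<in>{1..n} - {}. ksign j {} * var j * w (insert j {})) \<in> irrelevant_ideal n"
  proof (rule ideal_sum[OF I])
    fix j assume "j \<in> {1..n} - {}"
    then have "w {j} * var j \<in> irrelevant_ideal n" using var w by (intro ideal_mult[OF I]) auto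
    then show "ksign j {} * var j * w (insert j {}) \<in> irrelevant_ideal n"
      by (simp add: ksign_def mult.commute)
  qed
  then show ?thesis using wf by (simp add: kdiff_def)
qed

section \<open>Comparison with graded free resolutions\<close>

lemma poly_homog_iff: "f \<in> poly_homog n d \<longleftrightarrow> f \<in> polys n \<and> homog d f"
  by (auto simp: poly_homog_def homog_def in_keys_iff)

lemma free_homog_iff:
  "v \<in> free_homog n b a d \<longleftrightarrow> v \<in> free_vecs n b \<and> (\<forall>j<b. homog (d - a j) (v j))"
  by (auto simp: free_homog_def carrier_free_module poly_homog_iff free_vecs_polys)

lemma free_module_simps:
  "v \<oplus>\<^bsub>free_module n k\<^esub> w = (\<lambda>j. v j + w j)" "f \<odot>\<^bsub>free_module n k\<^esub> v = (\<lambda>j. f * v j)"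
  "\<zero>\<^bsub>free_module n k\<^esub> = (\<lambda>j. 0)"
  by (simp_all add: free_module_def)

lemma ideal_module_simps:
  "carrier (ideal_module n I) = I" "f \<oplus>\<^bsub>ideal_module n I\<^esub> g = f + g"
  "f \<odot>\<^bsub>ideal_module n I\<^esub> g = f * g" "\<zero>\<^bsub>ideal_module n I\<^esub> = 0"
  by (simp_all add: ideal_module_def)

lemma module_homs_free_iff:
  "h \<in> module_homs (poly_ring n) (free_module n k) (free_module n k') \<longleftrightarrow>
    h ` free_vecs n k \<subseteq> free_vecs n k' \<and> module_map n (free_vecs n k) h"
  by (simp add: module_homs_def hom_def module_map_def carrier_free_module image_subset_iff_funcset
      free_module_simps)

text \<open>Writing the value into entry 0 turns a map to the ideal into a map of vectors, to which
  \<open>module_map_comb\<close> applies.\<close>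

lemma module_homs_ideal_iff:
  "h \<in> module_homs (poly_ring n) (free_module n k) (ideal_module n I) \<longleftrightarrow>
    h ` free_vecs n k \<subseteq> I \<and> module_map n (free_vecs n k) (\<lambda>v j. if j = 0 then h v else 0)"
proof -
  have "((\<lambda>j::nat. if j = 0 then x else 0) = (\<lambda>i. (if i = 0 then y else 0) + (if i = 0 then z else 0))) = (x = y + z)"
    "((\<lambda>j::nat. if j = 0 then x else 0) = (\<lambda>i. f * (if i = 0 then y else 0))) = (x = f * y)"
    for x y z f :: "'a mpoly"
    by (auto simp: fun_eq_iff)
  then show ?thesis
    by (simp add: module_homs_def hom_def module_map_def carrier_free_module image_subset_iff_funcset
        free_module_simps ideal_module_simps)
qed

definition unit_vec :: "nat \<Rightarrow> 'k::field vec" where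
  "unit_vec j = (\<lambda>i. if i = j then 1 else 0)"

lemma comb_unit_vec:
  assumes "v \<in> free_vecs n k"
  shows "comb k unit_vec v = v"
proof
  fix i
  have "comb k unit_vec v i = (\<Sum>j<k. if j = i then v j else 0)"
    unfolding comb_def unit_vec_def by (intro sum.cong) auto
  then show "comb k unit_vec v i = v i"
    using assms by (auto simp: free_vecs_def not_less)
qed

lemma module_map_eq_comb:
  assumes "module_map n (free_vecs n k) h" "v \<in> free_vecs n k"
  shows "h v = comb k (\<lambda>j. h (unit_vec j)) v"
proof -
  have "h (comb k unit_vec v) = comb k (\<lambda>j. h (unit_vec j)) v"
    using assms free_vecs_polys[OF assms(2)]
    by (intro module_map_comb[OF assms(1) submod_free_vecs]) (auto simp: unit_vec_def basis_free_vecs)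
  then show ?thesis using comb_unit_vec[OF assms(2)] by simp
qed

lemma unit_vec_free_homog: "j < k \<Longrightarrow> (\<And>i. i < k \<Longrightarrow> a i = d) \<Longrightarrow> unit_vec j \<in> free_homog n k a d"
  using basis_free_vecs[of j k n] by (simp add: free_homog_iff unit_vec_def)

text \<open>The generators of each stage are the images of the unit vectors. Basis vectors of
  consecutive stages have degrees \<open>p + i + 1\<close> and \<open>p + i\<close>, so the matrix
  entries are linear forms, in agreement with the degree 1 in \<open>lin_res\<close>.\<close>

lemma lin_res_if_linear_resolution:
  fixes I :: "'k::field mpoly set"
  assumes "has_linear_resolution n (ideal_module n I) (ideal_homog n I) p"
  shows "\<exists>l. lin_res n l p (vec_embed I)"
proof -
  obtain b a \<epsilon> \<phi> where res: "minimal_graded_free_resolution n (ideal_module n I) (ideal_homog n I) b a \<epsilon> \<phi>"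
    and a: "\<And>i j. j < b i \<Longrightarrow> a i j = p + int i"
    using assms unfolding has_linear_resolution_def by blast
  note res = res[unfolded minimal_graded_free_resolution_def Let_def carrier_free_module module_homs_free_iff module_homs_ideal_iff]
  note q1 = res[THEN conjunct2] note q2 = q1[THEN conjunct2] note q3 = q2[THEN conjunct2]
  note q4 = q3[THEN conjunct2] note q5 = q4[THEN conjunct2] note q6 = q5[THEN conjunct2]
  note q7 = q6[THEN conjunct2]
  note len = res[THEN conjunct1] and \<epsilon>_hom = q1[THEN conjunct1] and \<phi>_hom = q2[THEN conjunct1]
    and \<epsilon>_gr = q3[THEN conjunct1] and \<phi>_gr = q4[THEN conjunct1] and \<epsilon>_onto = q5[THEN conjunct1]
    and exact0 = q6[THEN conjunct1] and exact = q7[THEN conjunct1]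
  obtain m where m: "\<And>i. i > m \<Longrightarrow> b i = 0" using len by blast
  define E where "E v = (\<lambda>j. if j = (0 :: nat) then \<epsilon> v else 0)" for v
  have E: "module_map n (free_vecs n (b 0)) E" using \<epsilon>_hom unfolding E_def by blast
  have \<phi>: "module_map n (free_vecs n (b (Suc i))) (\<phi> i)" for i using \<phi>_hom by blast
  define G where "G i = (case i of 0 \<Rightarrow> (\<lambda>j. E (unit_vec j)) | Suc i' \<Rightarrow> (\<lambda>j. \<phi> i' (unit_vec j)))" for i
  have Ecomb: "E v = comb (b 0) (G 0) v" if "v \<in> free_vecs n (b 0)" for v
    using module_map_eq_comb[OF E that] by (simp add: G_def)
  have \<phi>comb: "\<phi> i v = comb (b (Suc i)) (G (Suc i)) v" if "v \<in> free_vecs n (b (Suc i))" for i v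
    using module_map_eq_comb[OF \<phi> that] by (simp add: G_def)
  have E0: "E v = (\<lambda>i. 0) \<longleftrightarrow> \<epsilon> v = 0" for v by (auto simp: E_def fun_eq_iff)
  have gens0: "gens n p (b 0) (G 0)"
  proof -
    have "\<epsilon> (unit_vec j) \<in> ideal_homog n I p" if "j < b 0" for j
    proof -
      have "unit_vec j \<in> free_homog n (b 0) (a 0) p" using that a[of _ 0] by (intro unit_vec_free_homog) auto
      then show ?thesis using \<epsilon>_gr by blast
    qed
    then show ?thesis by (auto simp: gens_def G_def E_def vhomog_def ideal_homog_def poly_homog_iff)
  qed
  have gens1: "gens n 1 (b (Suc i)) (G (Suc i))" for i
  proof -
    have "\<phi> i (unit_vec j) \<in> free_homog n (b i) (a i) (p + int (Suc i))" if "j < b (Suc i)" for j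
    proof -
      have "unit_vec j \<in> free_homog n (b (Suc i)) (a (Suc i)) (p + int (Suc i))"
        using that a[of _ "Suc i"] by (intro unit_vec_free_homog) auto
      then show ?thesis using \<phi>_gr by blast
    qed
    then have *: "\<phi> i (unit_vec j) \<in> free_vecs n (b i)"
      "c < b i \<Longrightarrow> homog (p + int (Suc i) - a i c) (\<phi> i (unit_vec j) c)" if "j < b (Suc i)" for j c
      using that by (auto simp: free_homog_iff)
    have "homog 1 (\<phi> i (unit_vec j) c)" if "j < b (Suc i)" for j c
    proof (cases "c < b i")
      case True
      then show ?thesis using *(2)[OF that True] a[OF True] by simp
    next
      case False
      then show ?thesis using *(1)[OF that] by (simp add: free_vecs_def)
    qed
    then show ?thesis using free_vecs_polys[OF *(1)] by (auto simp: gens_def G_def vhomog_def)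
  qed
  have syz0: "syzygies n (b 0) (G 0) = \<phi> 0 ` free_vecs n (b 1)"
  proof -
    have "\<phi> 0 ` free_vecs n (b 1) = {v \<in> free_vecs n (b 0). \<epsilon> v = 0}"
      using exact0 by (simp add: ideal_module_simps)
    moreover have "comb (b 0) (G 0) v = (\<lambda>i. 0) \<longleftrightarrow> \<epsilon> v = 0" if "v \<in> free_vecs n (b 0)" for v
      using Ecomb[OF that] E0[of v] by simp
    ultimately show ?thesis unfolding syzygies_def by blast
  qed
  have syz1: "syzygies n (b (Suc i)) (G (Suc i)) = \<phi> (Suc i) ` free_vecs n (b (Suc (Suc i)))" for i
  proof -
    have "\<phi> (Suc i) ` free_vecs n (b (Suc (Suc i))) = {v \<in> free_vecs n (b (Suc i)). \<phi> i v = (\<lambda>j. 0)}"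
      using exact by (simp add: free_module_simps)
    moreover have "comb (b (Suc i)) (G (Suc i)) v = (\<lambda>j. 0) \<longleftrightarrow> \<phi> i v = (\<lambda>j. 0)"
      if "v \<in> free_vecs n (b (Suc i))" for v
      using \<phi>comb[OF that] by simp
    ultimately show ?thesis unfolding syzygies_def by blast
  qed
  have syz: "syzygies n (b i) (G i) = comb (b (Suc i)) (G (Suc i)) ` free_vecs n (b (Suc i))" for i
    using syz0 syz1 \<phi>comb by (cases i) (auto simp: image_def)
  \<comment> \<open>Induction from the end of the resolution: for \<open>l = 0\<close> the condition
    \<open>m < i + l\<close> makes the rank \<open>b i\<close> zero.\<close>
  have "lin_res n l 1 (syzygies n (b i) (G i))" if "m < i + l" for i l
    using that
  proof (induction l arbitrary: i)
    case 0
    then have "b i = 0" using m by simp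
    then show ?case by (auto simp: syzygies_def)
  next
    case (Suc l)
    then have "lin_res n l 1 (syzygies n (b (Suc i)) (G (Suc i)))" by simp
    then show ?case using gens1[of i] syz[of i] by auto
  qed
  then have "lin_res n (Suc m) 1 (syzygies n (b 0) (G 0))" by (simp del: lin_res.simps)
  moreover have "vec_embed I = comb (b 0) (G 0) ` free_vecs n (b 0)"
  proof -
    have I: "\<epsilon> ` free_vecs n (b 0) = I" using \<epsilon>_onto by (simp add: ideal_module_simps)
    have "vec_embed I = E ` free_vecs n (b 0)"
    proof (intro equalityI subsetI)
      fix v assume v: "v \<in> vec_embed I"
      then obtain u where u: "u \<in> free_vecs n (b 0)" "v 0 = \<epsilon> u" using I by (auto simp: vec_embed_def)
      then have "v = E u" using v by (auto simp: E_def vec_embed_def fun_eq_iff)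
      then show "v \<in> E ` free_vecs n (b 0)" using u(1) by blast
    qed (use I in \<open>auto simp: vec_embed_def E_def\<close>)
    then show ?thesis using Ecomb by (auto simp: image_def)
  qed
  ultimately show ?thesis using gens0 by (intro exI[of _ "Suc (Suc m)"]) auto
qed

text \<open>The recursion is unrolled into infinite sequences, with rank 0 from \<open>l\<close> on,
  which is the format of \<open>minimal_graded_free_resolution\<close>.\<close>

lemma lin_res_chain:
  assumes "lin_res n l e W"
  shows "\<exists>b G. (\<forall>i\<ge>l. b i = 0) \<and> gens n e (b 0) (G 0) \<and> W = comb (b 0) (G 0) ` free_vecs n (b 0) \<and>
    (\<forall>i. gens n 1 (b (Suc i)) (G (Suc i)) \<and>
      comb (b (Suc i)) (G (Suc i)) ` free_vecs n (b (Suc i)) = syzygies n (b i) (G i))"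
  using assms
proof (induction l arbitrary: e W)
  case 0
  then show ?case
    by (intro exI[of _ "\<lambda>_. 0"] exI[of _ "\<lambda>_ _ _. 0"]) (auto simp: gens_def syzygies_def)
next
  case (Suc l)
  then obtain k H where H: "gens n e k H" "W = comb k H ` free_vecs n k" "lin_res n l 1 (syzygies n k H)"
    by auto
  from Suc.IH[OF H(3)] obtain b G where
    "(\<forall>i\<ge>l. b i = 0) \<and> gens n 1 (b 0) (G 0) \<and> syzygies n k H = comb (b 0) (G 0) ` free_vecs n (b 0) \<and>
      (\<forall>i. gens n 1 (b (Suc i)) (G (Suc i)) \<and>
        comb (b (Suc i)) (G (Suc i)) ` free_vecs n (b (Suc i)) = syzygies n (b i) (G i))"
    by (elim exE)
  then have bG: "\<And>i. i \<ge> l \<Longrightarrow> b i = 0" "gens n 1 (b 0) (G 0)"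
    "syzygies n k H = comb (b 0) (G 0) ` free_vecs n (b 0)"
    "\<And>i. gens n 1 (b (Suc i)) (G (Suc i))"
    "\<And>i. comb (b (Suc i)) (G (Suc i)) ` free_vecs n (b (Suc i)) = syzygies n (b i) (G i)"
    by simp_all
  show ?case
  proof (intro exI[of _ "case_nat k b"] exI[of _ "case_nat H G"] conjI allI impI)
    show "case_nat k b i = 0" if "Suc l \<le> i" for i using that bG(1) by (cases i) auto
    show "gens n e (case_nat k b 0) (case_nat H G 0)" "W = comb (case_nat k b 0) (case_nat H G 0) ` free_vecs n (case_nat k b 0)"
      using H by auto
    fix i
    show "gens n 1 (case_nat k b (Suc i)) (case_nat H G (Suc i))"
      "comb (case_nat k b (Suc i)) (case_nat H G (Suc i)) ` free_vecs n (case_nat k b (Suc i)) =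
        syzygies n (case_nat k b i) (case_nat H G i)"
      using bG by (cases i; simp)+
  qed
qed

text \<open>Exactness is the statement that each stage generates the syzygies of the previous one.
  Minimality holds because the matrix entries are linear forms and so have no constant term.\<close>

lemma linear_resolution_if_lin_res:
  fixes I :: "'k::field mpoly set"
  assumes "lin_res n l p (vec_embed I)"
  shows "has_linear_resolution n (ideal_module n I) (ideal_homog n I) p"
proof -
  obtain b G where
    "(\<forall>i\<ge>l. b i = 0) \<and> gens n p (b 0) (G 0) \<and> vec_embed I = comb (b 0) (G 0) ` free_vecs n (b 0) \<and>
      (\<forall>i. gens n 1 (b (Suc i)) (G (Suc i)) \<and>
        comb (b (Suc i)) (G (Suc i)) ` free_vecs n (b (Suc i)) = syzygies n (b i) (G i))"
    using lin_res_chain[OF assms] by (elim exE)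
  then have b: "\<And>i. i \<ge> l \<Longrightarrow> b i = 0" and g0: "gens n p (b 0) (G 0)"
    and I: "vec_embed I = comb (b 0) (G 0) ` free_vecs n (b 0)"
    and g1: "\<And>i. gens n 1 (b (Suc i)) (G (Suc i))"
    and syz: "\<And>i. comb (b (Suc i)) (G (Suc i)) ` free_vecs n (b (Suc i)) = syzygies n (b i) (G i)"
    by simp_all
  define a where "a i j = p + int i" for i j :: nat
  define \<epsilon> where "\<epsilon> v = comb (b 0) (G 0) v 0" for v
  define \<phi> where "\<phi> i = comb (b (Suc i)) (G (Suc i))" for i
  have inI: "comb (b 0) (G 0) v \<in> vec_embed I" if "v \<in> free_vecs n (b 0)" for v using I that by blast
  have E: "(\<lambda>j. if j = 0 then \<epsilon> v else 0) = comb (b 0) (G 0) v" if "v \<in> free_vecs n (b 0)" for v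
    using inI[OF that] by (auto simp: \<epsilon>_def vec_embed_def fun_eq_iff)
  have \<epsilon>I: "\<epsilon> v \<in> I" if "v \<in> free_vecs n (b 0)" for v
    using inI[OF that] by (simp add: \<epsilon>_def vec_embed_def)
  have \<phi>free: "\<phi> i ` free_vecs n (b (Suc i)) \<subseteq> free_vecs n (b i)" for i
    unfolding \<phi>_def syz by (auto simp: syzygies_def)
  have "minimal_graded_free_resolution n (ideal_module n I) (ideal_homog n I) b a \<epsilon> \<phi>"
    unfolding minimal_graded_free_resolution_def Let_def carrier_free_module module_homs_free_iff module_homs_ideal_iff
  proof (intro conjI allI ballI impI)
    show "\<exists>m. \<forall>i>m. b i = 0" using b by (intro exI[of _ l]) auto
    show "\<epsilon> ` free_vecs n (b 0) \<subseteq> I" using \<epsilon>I by auto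
    show "module_map n (free_vecs n (b 0)) (\<lambda>v j. if j = 0 then \<epsilon> v else 0)"
      by (auto simp: module_map_def \<epsilon>_def comb_add comb_mult fun_eq_iff)
    show "\<phi> i ` free_vecs n (b (Suc i)) \<subseteq> free_vecs n (b i)" for i by (rule \<phi>free)
    show "module_map n (free_vecs n (b (Suc i))) (\<phi> i)" for i
      by (simp add: \<phi>_def module_map_def comb_add comb_mult)
    show "\<epsilon> ` free_homog n (b 0) (a 0) d \<subseteq> ideal_homog n I d" for d
    proof
      fix f assume "f \<in> \<epsilon> ` free_homog n (b 0) (a 0) d"
      then obtain v where v: "f = \<epsilon> v" "v \<in> free_vecs n (b 0)" "\<And>j. j < b 0 \<Longrightarrow> homog (d - p) (v j)"
        by (auto simp: free_homog_iff a_def)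
      have "vhomog (d - p) v"
        using v(2,3) by (auto simp: vhomog_def free_vecs_def) (metis homog_0 not_less)
      then have "vhomog d (comb (b 0) (G 0) v)" using vhomog_comb[OF g0, of "d - p" v] by simp
      then show "f \<in> ideal_homog n I d"
        using \<epsilon>I[OF v(2)] comb_polys[OF g0 free_vecs_polys[OF v(2)]] v(1)
        by (simp add: ideal_homog_def poly_homog_iff vhomog_def \<epsilon>_def)
    qed
    show "\<phi> i ` free_homog n (b (Suc i)) (a (Suc i)) d \<subseteq> free_homog n (b i) (a i) d" for i d
    proof
      fix w assume "w \<in> \<phi> i ` free_homog n (b (Suc i)) (a (Suc i)) d"
      then obtain v where v: "w = \<phi> i v" "v \<in> free_vecs n (b (Suc i))"
        "\<And>j. j < b (Suc i) \<Longrightarrow> homog (d - (p + int (Suc i))) (v j)"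
        by (auto simp: free_homog_iff a_def)
      have "vhomog (d - (p + int (Suc i))) v"
        using v(2,3) by (auto simp: vhomog_def free_vecs_def) (metis homog_0 not_less)
      then have "vhomog (d - (p + int (Suc i)) + 1) w"
        unfolding v(1) \<phi>_def by (rule vhomog_comb[OF g1])
      moreover have "d - (p + int (Suc i)) + 1 = d - a i j" for j by (simp add: a_def)
      ultimately have "homog (d - a i j) (w j)" for j unfolding vhomog_def by metis
      then show "w \<in> free_homog n (b i) (a i) d"
        using \<phi>free[of i] v(1,2) by (auto simp: free_homog_iff)
    qed
    show "\<epsilon> ` free_vecs n (b 0) = carrier (ideal_module n I)"
    proof -
      have "\<exists>v\<in>free_vecs n (b 0). f = \<epsilon> v" if "f \<in> I" for f
      proof -
        have "(\<lambda>j. if j = 0 then f else 0) \<in> vec_embed I" using that by (simp add: vec_embed_def)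
        then obtain v where v: "v \<in> free_vecs n (b 0)" "(\<lambda>j. if j = 0 then f else 0) = comb (b 0) (G 0) v"
          unfolding I by blast
        then show ?thesis using fun_cong[OF v(2), of 0] by (auto simp: \<epsilon>_def)
      qed
      then show ?thesis using \<epsilon>I by (auto simp: ideal_module_def)
    qed
    show "\<phi> 0 ` free_vecs n (b 1) = {v \<in> free_vecs n (b 0). \<epsilon> v = \<zero>\<^bsub>ideal_module n I\<^esub>}"
    proof -
      have "comb (b 0) (G 0) v = (\<lambda>i. 0) \<longleftrightarrow> \<epsilon> v = 0" if "v \<in> free_vecs n (b 0)" for v
        using E[OF that] by (auto simp: fun_eq_iff split: if_splits)
      then show ?thesis
        using syz[of 0] by (auto simp: \<phi>_def syzygies_def ideal_module_def)
    qed
    show "\<phi> (Suc i) ` free_vecs n (b (Suc (Suc i))) =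
        {v \<in> free_vecs n (b (Suc i)). \<phi> i v = \<zero>\<^bsub>free_module n (b i)\<^esub>}" for i
      using syz[of "Suc i"] by (simp add: \<phi>_def syzygies_def free_module_def)
    show "\<phi> i v j \<in> irrelevant_ideal n" if v: "v \<in> free_vecs n (b (Suc i))" for i v j
    proof (rule irrelevant_idealI)
      show "\<phi> i v j \<in> polys n" unfolding \<phi>_def by (intro comb_polys[OF g1] free_vecs_polys[OF v])
      have "homog 1 (G (Suc i) k j)" if "k < b (Suc i)" for k
        using g1[of i] that by (simp add: gens_def vhomog_def)
      then have "lookup (G (Suc i) k j) 0 = 0" if "k < b (Suc i)" for k
        using that homog_const by fastforce
      then show "lookup (\<phi> i v j) 0 = 0"
        by (simp add: \<phi>_def comb_def lookup_sum lookup_mult_const)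
    qed
  qed
  then show ?thesis unfolding has_linear_resolution_def a_def by blast
qed

section \<open>Squarefree Veronese ideals\<close>

text \<open>The complex is a skeleton of the simplex on \<open>V\<close>, coned over all other
  variables. For \<open>q = 0\<close> the ideal is the whole ring; for empty \<open>V\<close> and
  positive \<open>q\<close> it is zero. These are the base cases of the induction.\<close>

abbreviation veronese :: "nat \<Rightarrow> nat set \<Rightarrow> nat \<Rightarrow> 'k::field mpoly set" where
  "veronese n V q \<equiv> mono_ideal n {F. card (F \<inter> V) < q}"

lemma veroneseD: "f \<in> veronese n V q \<Longrightarrow> lookup f m \<noteq> 0 \<Longrightarrow> q \<le> card (keys m \<inter> V)"
  by (auto simp: mono_ideal_def not_less)

lemma veroneseI:
  "f \<in> polys n \<Longrightarrow> (\<And>m. lookup f m \<noteq> 0 \<Longrightarrow> q \<le> card (keys m \<inter> V)) \<Longrightarrow> f \<in> veronese n V q"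
  by (auto simp: mono_ideal_def not_less)

lemma veronese_polys: "f \<in> veronese n V q \<Longrightarrow> f \<in> polys n"
  by (simp add: mono_ideal_def)

text \<open>Monomials are sorted by whether they already have \<open>q + 1\<close> variables in
  \<open>V\<close>; the others must contain the variable \<open>v\<close>, which can be divided
  out.\<close>

lemma veronese_insert:
  fixes f :: "'k::field mpoly"
  assumes V: "finite V" "v \<notin> V" and v: "v \<in> {1..n}"
  shows "f \<in> veronese n (insert v V) (Suc q) \<longleftrightarrow>
    (\<exists>y\<in>veronese n V (Suc q). \<exists>z\<in>veronese n V q. f = y + var v * z)"
proof
  assume f: "f \<in> veronese n (insert v V) (Suc q)"
  let ?P = "\<lambda>m. Suc q \<le> card (keys m \<inter> V)"
  define z where "z = shift v (part (\<lambda>m. \<not> ?P m) f)"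
  have "part ?P f \<in> veronese n V (Suc q)"
    using veronese_polys[OF f] by (intro veroneseI) (auto simp: lookup_part split: if_splits)
  moreover have keys: "lookup m v \<noteq> 0 \<and> q \<le> card (keys m \<inter> V)"
    if "lookup (part (\<lambda>m. \<not> ?P m) f) m \<noteq> 0" for m
  proof -
    have m: "\<not> ?P m" "lookup f m \<noteq> 0" using that by (auto simp: lookup_part split: if_splits)
    have "Suc q \<le> card (keys m \<inter> insert v V)" using veroneseD[OF f m(2)] .
    then show ?thesis using m(1) V by (auto simp: in_keys_iff Int_insert_right split: if_splits)
  qed
  have "z \<in> veronese n V q"
  proof (rule veroneseI)
    show "z \<in> polys n" unfolding z_def using veronese_polys[OF f] by (intro polys_shift polys_part)
    fix m assume "lookup z m \<noteq> 0"
    then have "q \<le> card (keys (m + single v 1) \<inter> V)"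
      using keys by (simp add: z_def lookup_shift)
    moreover have "keys (m + single v 1) \<inter> V = keys m \<inter> V"
      using V(2) by (auto simp: in_keys_iff lookup_add lookup_single when_def split: if_splits)
    ultimately show "q \<le> card (keys m \<inter> V)" by simp
  qed
  moreover have "f = part ?P f + var v * z"
  proof (rule poly_mapping_eqI)
    fix m
    show "lookup f m = lookup (part ?P f + var v * z) m"
      unfolding z_def var_mult_shift using keys[of m]
      by (cases "lookup f m = 0") (auto simp: lookup_add lookup_part)
  qed
  ultimately show "\<exists>y\<in>veronese n V (Suc q). \<exists>z\<in>veronese n V q. f = y + var v * z" by blast
next
  assume "\<exists>y\<in>veronese n V (Suc q). \<exists>z\<in>veronese n V q. f = y + var v * z"
  then obtain y z where y: "y \<in> veronese n V (Suc q)" and z: "z \<in> veronese n V q" and f: "f = y + var v * z"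
    by blast
  show "f \<in> veronese n (insert v V) (Suc q)"
  proof (rule veroneseI)
    show "f \<in> polys n" unfolding f by (intro polys_add polys_mult polys_var veronese_polys[OF y] veronese_polys[OF z] v)
    fix m assume "lookup f m \<noteq> 0"
    then have "lookup y m \<noteq> 0 \<or> lookup (var v * z) m \<noteq> 0"
      unfolding f by (auto simp: lookup_add)
    then show "Suc q \<le> card (keys m \<inter> insert v V)"
    proof
      assume "lookup y m \<noteq> 0"
      then have "Suc q \<le> card (keys m \<inter> V)" by (rule veroneseD[OF y])
      also have "\<dots> \<le> card (keys m \<inter> insert v V)" using V by (intro card_mono) auto
      finally show ?thesis .
    next
      assume "lookup (var v * z) m \<noteq> 0"
      then have m: "v \<in> keys m" "lookup z (m - single v 1) \<noteq> 0"
        by (auto simp: lookup_var_mult in_keys_iff split: if_splits)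
      have "q \<le> card (keys (m - single v 1) \<inter> V)" by (rule veroneseD[OF z m(2)])
      also have "\<dots> \<le> card (keys m \<inter> V)"
        using V by (intro card_mono) (auto simp: in_keys_iff lookup_minus)
      finally show ?thesis using m(1) V by simp
    qed
  qed
qed

text \<open>Since \<open>v\<close> is outside \<open>V\<close>, multiplication by its variable does
  not change which variables of \<open>V\<close> occur in a monomial.\<close>

lemma veronese_Int:
  assumes V: "v \<notin> V" "v \<in> {1..n}" "finite V"
  shows "f \<in> veronese n V (Suc q) \<and> (\<exists>z\<in>veronese n V q. f = var v * z) \<longleftrightarrow>
    (\<exists>y\<in>veronese n V (Suc q). f = var v * y)"
proof
  assume "f \<in> veronese n V (Suc q) \<and> (\<exists>z\<in>veronese n V q. f = var v * z)"
  then obtain z where f: "f \<in> veronese n V (Suc q)" and z: "z \<in> veronese n V q" "f = var v * z" by blast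
  have "z \<in> veronese n V (Suc q)"
  proof (rule veroneseI)
    show "z \<in> polys n" by (rule veronese_polys[OF z(1)])
    fix m assume "lookup z m \<noteq> 0"
    then have "lookup f (m + single v 1) \<noteq> 0"
      by (simp add: z(2) lookup_var_mult lookup_add)
    then have "Suc q \<le> card (keys (m + single v 1) \<inter> V)"
      by (rule veroneseD[OF f])
    moreover have "keys (m + single v 1) \<inter> V = keys m \<inter> V"
      using V(1) by (auto simp: in_keys_iff lookup_add lookup_single when_def split: if_splits)
    ultimately show "Suc q \<le> card (keys m \<inter> V)" by simp
  qed
  then show "\<exists>y\<in>veronese n V (Suc q). f = var v * y" using z(2) by blast
next
  assume "\<exists>y\<in>veronese n V (Suc q). f = var v * y"
  then obtain y where y: "y \<in> veronese n V (Suc q)" "f = var v * y" by blast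
  have "y \<in> veronese n V q"
    using veronese_polys[OF y(1)] veroneseD[OF y(1)] by (intro veroneseI) (auto dest: Suc_leD)
  moreover have "f \<in> veronese n V (Suc q)"
  proof -
    have "ideal (veronese n V (Suc q) :: 'a mpoly set) (poly_ring n)"
    proof (rule ideal_mono_ideal)
      fix F G :: "nat set" assume FG: "F \<in> {F. card (F \<inter> V) < Suc q}" "G \<subseteq> F"
      have "card (G \<inter> V) \<le> card (F \<inter> V)" using FG(2) V(3) by (intro card_mono) auto
      then show "G \<in> {F. card (F \<inter> V) < Suc q}" using FG(1) by simp
    qed
    then show ?thesis unfolding y(2) by (rule ideal_mult[OF _ polys_var[OF V(2)] y(1)])
  qed
  ultimately show "f \<in> veronese n V (Suc q) \<and> (\<exists>z\<in>veronese n V q. f = var v * z)" using y(2) by blast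
qed

lemma lin_res_polys: "lin_res n 1 0 (vec_embed (polys n) :: 'k::field vec set)"
proof -
  have comb: "comb 1 (\<lambda>_. unit_vec 0) v = (\<lambda>i. if i = 0 then v 0 else 0)" for v :: "'k vec"
    by (auto simp: comb_def unit_vec_def)
  have free: "v \<in> free_vecs n 1 \<longleftrightarrow> v 0 \<in> polys n \<and> (\<forall>j>0. v j = 0)" for v :: "'k vec"
    unfolding free_vecs_def by (auto simp: Suc_le_eq) (metis neq0_conv polys_0)
  have "gens n 0 1 (\<lambda>_. unit_vec 0 :: 'k vec)"
    by (simp add: gens_def vhomog_def unit_vec_def)
  moreover have "(vec_embed (polys n) :: 'k vec set) = comb 1 (\<lambda>_. unit_vec 0) ` free_vecs n 1"
  proof -
    have "comb 1 (\<lambda>_. unit_vec 0) v = v" if "v \<in> free_vecs n 1" for v :: "'k vec"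
      using that unfolding free comb by (auto simp: fun_eq_iff)
    moreover have "vec_embed (polys n) = (free_vecs n 1 :: 'k vec set)"
      unfolding vec_embed_def using free by blast
    ultimately show ?thesis by (simp cong: image_cong_simp del: One_nat_def)
  qed
  moreover have "syzygies n 1 (\<lambda>_. unit_vec 0 :: 'k vec) = {\<lambda>i. 0}"
  proof (intro equalityI subsetI)
    fix v :: "'k vec" assume "v \<in> syzygies n 1 (\<lambda>_. unit_vec 0)"
    then have v: "v \<in> free_vecs n 1" "(\<lambda>i :: nat. if i = 0 then v 0 else 0) = (\<lambda>i. 0)"
      unfolding syzygies_def comb by auto
    have "v j = 0" for j
      using v(1) fun_cong[OF v(2), of 0] unfolding free by (cases "j = 0") auto
    then show "v \<in> {\<lambda>i. 0}" by auto
  qed (use submod_0[OF submod_syzygies] in auto)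
  ultimately have "\<exists>k G. gens n 0 k G \<and> (vec_embed (polys n) :: 'k vec set) = comb k G ` free_vecs n k \<and>
      lin_res n 0 1 (syzygies n k G)"
    by (intro exI[of _ 1] exI[of _ "\<lambda>_. unit_vec 0"]) simp
  then show ?thesis unfolding One_nat_def lin_res.simps(2)[of n 0] .
qed

text \<open>The degrees fit \<open>lin_res_plus\<close>: both summands start in degree
  \<open>q' + 1\<close>, and their intersection is the first summand times a variable, so it starts
  one degree higher.\<close>

lemma lin_res_veronese:
  assumes "finite V" "V \<subseteq> {1..n}"
  shows "\<exists>l. lin_res n l (int q) (vec_embed (veronese n V q) :: 'k::field vec set)"
  using assms
proof (induction V arbitrary: q rule: finite_induct)
  case empty
  show ?case
  proof (cases "q = 0")
    case True
    then have "vec_embed (veronese n {} q) = (vec_embed (polys n) :: 'k vec set)" by (simp add: mono_ideal_def)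
    then show ?thesis using lin_res_polys True by (metis of_nat_0)
  next
    case False
    have "f = 0" if f: "f \<in> (veronese n {} q :: 'k mpoly set)" for f
      using veroneseD[OF f] False by (intro poly_mapping_eqI) fastforce
    moreover have "0 \<in> (veronese n {} q :: 'k mpoly set)" by (simp add: mono_ideal_def)
    ultimately have "veronese n {} q = ({0} :: 'k mpoly set)" by blast
    then have "vec_embed (veronese n {} q) = {\<lambda>i. 0 :: 'k mpoly}"
      by (auto simp: vec_embed_def fun_eq_iff) (metis neq0_conv)
    then show ?thesis using lin_res_zero by metis
  qed
next
  case (insert v V)
  show ?case
  proof (cases q)
    case 0
    then have "vec_embed (veronese n (insert v V) q) = (vec_embed (polys n) :: 'k vec set)" by (simp add: mono_ideal_def)
    then show ?thesis using lin_res_polys 0 by (metis of_nat_0)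
  next
    case (Suc q')
    have V: "V \<subseteq> {1..n}" "v \<in> {1..n}" using insert.prems by auto
    define Y where "Y = (vec_embed (veronese n V (Suc q')) :: 'k vec set)"
    define Z where "Z = (\<lambda>y i. var v * y i) ` (vec_embed (veronese n V q') :: 'k vec set)"
    obtain l1 where l1: "lin_res n l1 (int q) Y"
      using insert.IH[OF V(1), of q] Suc by (auto simp: Y_def)
    obtain l2 where l2: "lin_res n l2 (int q') (vec_embed (veronese n V q') :: 'k vec set)"
      using insert.IH[OF V(1), of q'] by auto
    \<comment> \<open>A common bound for both lengths; the sum may use one step more than the
      intersection.\<close>
    define L where "L = max l1 l2"
    have L: "l1 \<le> L" "l2 \<le> Suc L" "l1 \<le> Suc L" by (auto simp: L_def)
    have Y: "lin_res n (Suc L) (int q) Y" by (rule lin_res_mono[OF L(3) l1])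
    have "lin_res n (Suc L) (int q' + 1) Z"
      unfolding Z_def by (rule lin_res_var_mult[OF V(2) lin_res_mono[OF L(2) l2]])
    then have Z: "lin_res n (Suc L) (int q) Z" using Suc by (simp add: add.commute del: lin_res.simps)
    have YZ: "Y \<inter> Z = (\<lambda>y i. var v * y i) ` Y"
    proof (intro equalityI subsetI)
      fix x assume x: "x \<in> Y \<inter> Z"
      then obtain z where z: "z \<in> vec_embed (veronese n V q')" "x = (\<lambda>i. var v * z i)" by (auto simp: Z_def)
      have "x 0 \<in> veronese n V (Suc q') \<and> (\<exists>z\<in>veronese n V q'. x 0 = var v * z)"
        using x z by (auto simp: Y_def vec_embed_def)
      then obtain y where y: "y \<in> veronese n V (Suc q')" "x 0 = var v * y"
        using veronese_Int[OF insert.hyps(2) V(2) insert.hyps(1), of "x 0" q'] by blast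
      have "x = (\<lambda>i. var v * (if i = 0 then y else 0))"
        using x y(2) by (auto simp: Y_def vec_embed_def fun_eq_iff)
      moreover have "(\<lambda>i. if i = 0 then y else 0) \<in> Y" using y(1) by (simp add: Y_def vec_embed_def)
      ultimately show "x \<in> (\<lambda>y i. var v * y i) ` Y" by (rule image_eqI)
    next
      fix x assume "x \<in> (\<lambda>y i. var v * y i) ` Y"
      then obtain y where y: "y \<in> Y" "x = (\<lambda>i. var v * y i)" by auto
      then have "y 0 \<in> veronese n V (Suc q')" "\<And>j. j > 0 \<Longrightarrow> y j = 0" by (auto simp: Y_def vec_embed_def)
      moreover from this obtain z where "x 0 \<in> veronese n V (Suc q')" "z \<in> veronese n V q'" "x 0 = var v * z"
        using veronese_Int[OF insert.hyps(2) V(2) insert.hyps(1), of "x 0" q'] y(2) by blast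
      ultimately have x: "x \<in> Y" "y 0 = z" "z \<in> veronese n V q'"
        using y(2) shift_var_mult[of v "y 0"] shift_var_mult[of v z] by (auto simp: Y_def vec_embed_def)
      then have "y \<in> vec_embed (veronese n V q')" using y(1) by (simp add: Y_def vec_embed_def)
      then show "x \<in> Y \<inter> Z" using x(1) y(2) by (auto simp: Z_def)
    qed
    have "lin_res n L (int q + 1) (Y \<inter> Z)"
      unfolding YZ by (rule lin_res_var_mult[OF V(2) lin_res_mono[OF L(1) l1]])
    from lin_res_plus[OF Y Z this]
    have "lin_res n (Suc L) (int q) {\<lambda>i. y i + z i | y z. y \<in> Y \<and> z \<in> Z}" .
    moreover have "{\<lambda>i. y i + z i | y z. y \<in> Y \<and> z \<in> Z} = vec_embed (veronese n (insert v V) q)"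
    proof (intro equalityI subsetI)
      fix x assume "x \<in> {\<lambda>i. y i + z i | y z. y \<in> Y \<and> z \<in> Z}"
      then obtain y z where yz: "y \<in> vec_embed (veronese n V (Suc q'))" "z \<in> vec_embed (veronese n V q')"
        "x = (\<lambda>i. y i + var v * z i)" by (auto simp: Y_def Z_def)
      then have "x 0 \<in> veronese n (insert v V) (Suc q')"
        unfolding veronese_insert[OF insert.hyps V(2)] by (auto simp: vec_embed_def)
      then show "x \<in> vec_embed (veronese n (insert v V) q)" using yz Suc by (simp add: vec_embed_def)
    next
      fix x :: "'k vec" assume x: "x \<in> vec_embed (veronese n (insert v V) q)"
      then obtain y z where yz: "y \<in> veronese n V (Suc q')" "z \<in> veronese n V q'" "x 0 = y + var v * z"
        using veronese_insert[OF insert.hyps V(2), of "x 0" q'] Suc by (auto simp: vec_embed_def)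
      define y' where "y' = (\<lambda>i. if i = (0 :: nat) then y else 0)"
      define z' where "z' = (\<lambda>i. var v * (if i = (0 :: nat) then z else 0))"
      have "y' \<in> Y" using yz(1) by (simp add: y'_def Y_def vec_embed_def)
      moreover have "(\<lambda>i. if i = 0 then z else 0) \<in> vec_embed (veronese n V q')"
        using yz(2) by (simp add: vec_embed_def)
      then have "z' \<in> Z" unfolding z'_def Z_def by (rule rev_image_eqI) simp
      moreover have "x = (\<lambda>i. y' i + z' i)"
        using x yz(3) by (auto simp: vec_embed_def y'_def z'_def fun_eq_iff)
      ultimately show "x \<in> {\<lambda>i. y i + z i | y z. y \<in> Y \<and> z \<in> Z}" by blast
    qed
    ultimately show ?thesis by metis
  qed
qed

section \<open>The characterization\<close>

lemma circuits_uniform: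
  assumes "finite A"
  shows "circuits (uniform_matroid m A) = {C. C \<subseteq> A \<and> card C = m + 1}"
proof (intro equalityI subsetI)
  fix C assume "C \<in> circuits (uniform_matroid m A)"
  then have C: "C \<subseteq> A" "m < card C" "\<And>D. D \<subset> C \<Longrightarrow> card D \<le> m"
    by (auto simp: circuits_def uniform_matroid_def)
  have fin: "finite C" using C(1) assms finite_subset by auto
  obtain x where x: "x \<in> C" using C(2) by fastforce
  have "card (C - {x}) \<le> m" using x by (intro C(3)) auto
  then have "card C = m + 1" using C(2) fin x by simp
  then show "C \<in> {C. C \<subseteq> A \<and> card C = m + 1}" using C(1) by simp
next
  fix C assume C: "C \<in> {C. C \<subseteq> A \<and> card C = m + 1}"
  have "D \<subseteq> A \<and> card D \<le> m" if D: "D \<subset> C" for D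
  proof -
    have "finite C" using C assms finite_subset by auto
    then have "card D < card C" using D by (rule psubset_card_mono)
    then show ?thesis using C D by auto
  qed
  then show "C \<in> circuits (uniform_matroid m A)"
    using C by (auto simp: circuits_def uniform_matroid_def)
qed

text \<open>With \<open>card B \<le> m\<close> the second summand has no circuits, so only the trace
  on \<open>A\<close> is constrained.\<close>

lemma indep_uniform_plus_free:
  assumes A: "finite A" and B: "finite B" "card B \<le> m"
  shows "X \<in> indeps (direct_sum (uniform_matroid p A) (uniform_matroid m B)) \<longleftrightarrow>
    X \<subseteq> A \<union> B \<and> card (X \<inter> A) \<le> p"
proof -
  have "\<not> card C = m + 1" if "C \<subseteq> B" for C using card_mono[OF B(1) that] B(2) by auto
  then have "X \<in> indeps (direct_sum (uniform_matroid p A) (uniform_matroid m B)) \<longleftrightarrow>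
      X \<subseteq> A \<union> B \<and> (\<forall>C. C \<subseteq> A \<longrightarrow> card C = p + 1 \<longrightarrow> \<not> C \<subseteq> X)"
    unfolding direct_sum_def circuits_uniform[OF A] circuits_uniform[OF B(1)]
    by (auto simp: uniform_matroid_def)
  moreover have "(\<forall>C. C \<subseteq> A \<longrightarrow> card C = p + 1 \<longrightarrow> \<not> C \<subseteq> X) \<longleftrightarrow> card (X \<inter> A) \<le> p"
  proof
    assume none: "\<forall>C. C \<subseteq> A \<longrightarrow> card C = p + 1 \<longrightarrow> \<not> C \<subseteq> X"
    show "card (X \<inter> A) \<le> p"
    proof (rule ccontr)
      assume "\<not> card (X \<inter> A) \<le> p"
      then have "p + 1 \<le> card (X \<inter> A)" by simp
      then obtain C where "C \<subseteq> X \<inter> A" "card C = p + 1"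
        by (rule obtain_subset_with_card_n)
      then show False using none by auto
    qed
  next
    assume le: "card (X \<inter> A) \<le> p"
    show "\<forall>C. C \<subseteq> A \<longrightarrow> card C = p + 1 \<longrightarrow> \<not> C \<subseteq> X"
    proof (intro allI impI notI)
      fix C assume "C \<subseteq> A" "card C = p + 1" "C \<subseteq> X"
      then have "card C \<le> card (X \<inter> A)" using A by (intro card_mono) auto
      then show False using le \<open>card C = p + 1\<close> by simp
    qed
  qed
  ultimately show ?thesis by simp
qed

text \<open>An isomorphism matters only through the preimage \<open>N\<close> of \<open>A\<close>.
  Conversely, any bijections from \<open>N\<close> to \<open>A\<close> and from the complement of
  \<open>N\<close> to \<open>B\<close> glue to one.\<close>

lemma matroid_iso_uniform_plus_free_iff:
  assumes M: "finite (ground M)" and A: "finite A" and B: "finite B" "card B \<le> m" and AB: "A \<inter> B = {}"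
    and card: "card (A \<union> B) = card (ground M)"
  shows "matroid_iso M (direct_sum (uniform_matroid p A) (uniform_matroid m B)) \<longleftrightarrow>
    (\<exists>N\<subseteq>ground M. card N = card A \<and> (\<forall>X\<subseteq>ground M. X \<in> indeps M \<longleftrightarrow> card (X \<inter> N) \<le> p))"
proof -
  have ground: "ground (direct_sum (uniform_matroid p A) (uniform_matroid m B)) = A \<union> B"
    by (simp add: direct_sum_def uniform_matroid_def)
  note indep = indep_uniform_plus_free[OF A B, of _ p]
  have transport: "(f ` X \<in> indeps (direct_sum (uniform_matroid p A) (uniform_matroid m B))) \<longleftrightarrow> card (X \<inter> N) \<le> p"
    if f: "bij_betw f (ground M) (A \<union> B)" and N: "N = {x \<in> ground M. f x \<in> A}" and X: "X \<subseteq> ground M" for f N X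
  proof -
    have inj: "inj_on f (X \<inter> N)" using bij_betw_imp_inj_on[OF f] N by (auto intro: inj_on_subset)
    have "f ` X \<inter> A = f ` (X \<inter> N)" using X N by auto
    then have "card (f ` X \<inter> A) = card (X \<inter> N)" using card_image[OF inj] by simp
    moreover have "f ` X \<subseteq> A \<union> B" using f X by (auto simp: bij_betw_def)
    ultimately show ?thesis by (simp add: indep)
  qed
  show ?thesis
  proof
    assume "matroid_iso M (direct_sum (uniform_matroid p A) (uniform_matroid m B))"
    then obtain f where f: "bij_betw f (ground M) (A \<union> B)"
      "\<And>X. X \<subseteq> ground M \<Longrightarrow> X \<in> indeps M \<longleftrightarrow> f ` X \<in> indeps (direct_sum (uniform_matroid p A) (uniform_matroid m B))"
      unfolding matroid_iso_def ground by blast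
    define N where "N = {x \<in> ground M. f x \<in> A}"
    have "f ` N = A" using f(1) by (auto simp: N_def bij_betw_def)
    moreover have "inj_on f N" using bij_betw_imp_inj_on[OF f(1)] by (auto simp: N_def intro: inj_on_subset)
    ultimately have "card N = card A" using card_image by metis
    then show "\<exists>N\<subseteq>ground M. card N = card A \<and> (\<forall>X\<subseteq>ground M. X \<in> indeps M \<longleftrightarrow> card (X \<inter> N) \<le> p)"
      using f(2) transport[OF f(1) N_def] by (intro exI[of _ N]) (auto simp: N_def)
  next
    assume "\<exists>N\<subseteq>ground M. card N = card A \<and> (\<forall>X\<subseteq>ground M. X \<in> indeps M \<longleftrightarrow> card (X \<inter> N) \<le> p)"
    then obtain N where N: "N \<subseteq> ground M" "card N = card A" "\<And>X. X \<subseteq> ground M \<Longrightarrow> X \<in> indeps M \<longleftrightarrow> card (X \<inter> N) \<le> p"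
      by blast
    have fN: "finite N" using N(1) M finite_subset by auto
    obtain g where g: "bij_betw g N A" using finite_same_card_bij[OF fN A N(2)] by auto
    have "card (ground M - N) = card B"
      using card card_Un_disjoint[OF A B(1) AB] N(1,2) fN by (simp add: card_Diff_subset)
    then obtain h where h: "bij_betw h (ground M - N) B"
      using finite_same_card_bij[of "ground M - N" B] M B(1) by auto
    define f where "f x = (if x \<in> N then g x else h x)" for x
    have "bij_betw f (N \<union> (ground M - N)) (A \<union> B)"
      unfolding f_def using bij_betw_disjoint_Un[OF g h _ AB] by auto
    moreover have "N \<union> (ground M - N) = ground M" using N(1) by auto
    ultimately have f: "bij_betw f (ground M) (A \<union> B)" by simp
    have hB: "h x \<in> B" if "x \<in> ground M - N" for x using h that by (auto simp: bij_betw_def)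
    have gA: "g x \<in> A" if "x \<in> N" for x using g that by (auto simp: bij_betw_def)
    have "N = {x \<in> ground M. f x \<in> A}"
      using N(1) gA hB AB by (fastforce simp: f_def)
    then show "matroid_iso M (direct_sum (uniform_matroid p A) (uniform_matroid m B))"
      unfolding matroid_iso_def ground using f transport[OF f] N(3) by (intro exI[of _ f]) simp
  qed
qed

text \<open>The circuits are the sets of \<open>p + 1\<close> elements of \<open>N\<close>. Those
  through the least element make every \<open>p\<close>-subset of the rest a broken circuit, and the
  remaining circuits also yield \<open>p\<close>-subsets of the rest. If \<open>N\<close> has at
  most \<open>p\<close> elements, both ideals are zero.\<close>

lemma broken_circuit_ideal_eq_veronese:
  assumes M: "matroid M" and gM: "ground M = {1..n}" and lin: "linear_order_on {1..n} R" and p: "0 < p"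
    and N: "N \<subseteq> {1..n}" "\<And>X. X \<subseteq> {1..n} \<Longrightarrow> X \<in> indeps M \<longleftrightarrow> card (X \<inter> N) \<le> p"
  shows "mono_ideal n (broken_circuit_complex M R) = (veronese n (N - {min_wrt R N}) p :: 'k::field mpoly set)"
proof -
  interpret matroid M by (rule M)
  have fN: "finite N" using N(1) finite_subset by auto
  define a where "a = min_wrt R N"
  have circ: "C \<in> circuits M \<longleftrightarrow> C \<subseteq> N \<and> card C = p + 1" for C
  proof
    assume C: "C \<in> circuits M"
    have CE: "C \<subseteq> {1..n}" using circuit_subset_ground[OF C] gM by simp
    have "p < card (C \<inter> N)" using circuit_not_indep[OF C] N(2)[OF CE] by simp
    have sub: "card (D \<inter> N) \<le> p" if "D \<subset> C" for D
      using circuit_psubset_indep[OF C that] N(2)[of D] that CE by auto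
    have CN: "C \<subseteq> N"
    proof (rule ccontr)
      assume "\<not> C \<subseteq> N"
      then have "C \<inter> N \<subset> C" by auto
      then have "card (C \<inter> N \<inter> N) \<le> p" by (rule sub)
      then show False using \<open>p < card (C \<inter> N)\<close> by (simp add: Int_assoc)
    qed
    then have "C \<inter> N = C" by auto
    then have pC: "p < card C" using \<open>p < card (C \<inter> N)\<close> by simp
    have "C \<noteq> {}" using pC by auto
    then obtain x where x: "x \<in> C" by auto
    have "card ((C - {x}) \<inter> N) \<le> p" using x by (intro sub) auto
    moreover have "(C - {x}) \<inter> N = C - {x}" using CN by auto
    ultimately have "card C = p + 1" using pC x finite_circuit[OF C] by simp
    with CN show "C \<subseteq> N \<and> card C = p + 1" by simp
  next
    assume C: "C \<subseteq> N \<and> card C = p + 1"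
    then have fC: "finite C" using fN finite_subset by auto
    have "D \<in> indeps M" if D: "D \<subset> C" for D
    proof -
      have "card D < card C" using fC D by (rule psubset_card_mono)
      moreover have "D \<subseteq> {1..n}" "D \<inter> N = D" using D C N(1) by auto
      ultimately show ?thesis using N(2)[of D] C by simp
    qed
    moreover have "C \<subseteq> {1..n}" "C \<inter> N = C" using C N(1) by auto
    then have "C \<notin> indeps M" using N(2)[of C] C by simp
    ultimately show "C \<in> circuits M" using C N(1) gM by (auto simp: circuits_def)
  qed
  have face: "F \<in> broken_circuit_complex M R \<longleftrightarrow> card (F \<inter> (N - {a})) < p" if F: "F \<subseteq> {1..n}" for F
  proof
    assume Fc: "F \<in> broken_circuit_complex M R"
    show "card (F \<inter> (N - {a})) < p"
    proof (rule ccontr)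
      assume "\<not> card (F \<inter> (N - {a})) < p"
      then have "p \<le> card (F \<inter> (N - {a}))" by simp
      then obtain T where T: "T \<subseteq> F \<inter> (N - {a})" "card T = p" "finite T"
        by (rule obtain_subset_with_card_n)
      have "T \<noteq> {}" using T(2) p by auto
      then have Nne: "N \<noteq> {}" using T(1) by auto
      have a: "a \<in> N" "\<And>c. c \<in> N \<Longrightarrow> (a, c) \<in> R"
        using min_wrt[OF lin fN Nne N(1)] by (auto simp: a_def)
      have aT: "a \<notin> T" using T(1) by auto
      have "insert a T \<in> circuits M" unfolding circ using T a(1) aT by auto
      moreover have "min_wrt R (insert a T) = a" using T(1) a by (intro min_wrt_eqI[OF lin]) auto
      then have "broken_circuit R (insert a T) = T" using aT by (simp add: broken_circuit_def)
      moreover have "\<not> broken_circuit R (insert a T) \<subseteq> F"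
        using Fc \<open>insert a T \<in> circuits M\<close> unfolding broken_circuit_complex_def by blast
      ultimately show False using T(1) by auto
    qed
  next
    assume less: "card (F \<inter> (N - {a})) < p"
    have "\<not> broken_circuit R C \<subseteq> F" if C: "C \<in> circuits M" for C
    proof
      assume b: "broken_circuit R C \<subseteq> F"
      have CN: "C \<subseteq> N" "card C = p + 1" using C circ by auto
      have fC: "finite C" "C \<noteq> {}" using CN fN finite_subset by auto
      have "N \<noteq> {}" using CN(1) fC(2) by auto
      then have a: "\<And>c. c \<in> N \<Longrightarrow> (a, c) \<in> R"
        using min_wrt[OF lin fN _ N(1)] by (auto simp: a_def)
      have mC: "min_wrt R C \<in> C" using min_wrt(1)[OF lin fC] CN(1) N(1) by auto
      have "a \<notin> broken_circuit R C"
      proof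
        assume ab: "a \<in> broken_circuit R C"
        then have "min_wrt R C = a" using a CN(1) by (intro min_wrt_eqI[OF lin]) (auto simp: broken_circuit_def)
        then show False using ab by (simp add: broken_circuit_def)
      qed
      then have "broken_circuit R C \<subseteq> F \<inter> (N - {a})" using b CN(1) by (auto simp: broken_circuit_def)
      then have "card (broken_circuit R C) \<le> card (F \<inter> (N - {a}))" using fN by (intro card_mono) auto
      moreover have "card (broken_circuit R C) = p" using mC CN(2) fC by (simp add: broken_circuit_def)
      ultimately show False using less by simp
    qed
    then show "F \<in> broken_circuit_complex M R" using F gM by (simp add: broken_circuit_complex_def)
  qed
  show ?thesis
    unfolding mono_ideal_def a_def[symmetric] using face by (auto simp: polys_iff)
qed

theorem theorem3p3:
  fixes M :: "nat set_system" and R :: "nat rel" and n r :: nat and p :: int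
    and I :: "'k::field mpoly set"
  assumes "infinite (UNIV :: 'k set)"
    and "simple_matroid M"
    and "ground M = {1..n}"
    and "linear_order_on {1..n} R"
    and "matroid_rank M = r"
    and "I = stanley_reisner_ideal n (broken_circuit_complex M R)"
    and "circuits M = {} \<Longrightarrow> 2 \<le> p \<and> p \<le> int r"
  shows "has_linear_resolution n (ideal_module n I) (ideal_homog n I) p \<longleftrightarrow>
    2 \<le> p \<and> p \<le> int r \<and>
    matroid_iso M (direct_sum (uniform_matroid (nat p) {1..n - r + nat p})
                              (uniform_matroid (r - nat p) {n - r + nat p + 1..n}))"
proof -
  have M: "matroid M" using assms(2) by (simp add: simple_matroid_def)
  interpret matroid M by (rule M)
  have r: "rk M {1..n} = r" using matroid_rank_eq_rk assms(3,5) by simp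
  have rn: "r \<le> n" using rk_le_card[of "{1..n}"] r by simp
  have I: "I = mono_ideal n (broken_circuit_complex M R)"
    unfolding assms(6)
  proof (rule stanley_reisner_ideal_eq)
    show "G \<in> broken_circuit_complex M R" if "F \<in> broken_circuit_complex M R" "G \<subseteq> F" for F G
      using that unfolding broken_circuit_complex_def by blast
  qed
  \<comment> \<open>The bounds on \<open>p\<close> make the two intervals a partition of
    \<open>{1..n}\<close>; without them the truncated subtractions would give wrong sizes.\<close>
  have iso: "matroid_iso M (direct_sum (uniform_matroid (nat p) {1..n - r + nat p})
        (uniform_matroid (r - nat p) {n - r + nat p + 1..n})) \<longleftrightarrow>
      (\<exists>N\<subseteq>{1..n}. card N = n - r + nat p \<and> (\<forall>X\<subseteq>{1..n}. X \<in> indeps M \<longleftrightarrow> card (X \<inter> N) \<le> nat p))"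
    if p: "2 \<le> p" "p \<le> int r"
  proof -
    have "{1..n - r + nat p} \<union> {n - r + nat p + 1..n} = {1..n}" using p rn by auto
    then show ?thesis
      using matroid_iso_uniform_plus_free_iff[of M "{1..n - r + nat p}" "{n - r + nat p + 1..n}" "r - nat p" "nat p"]
        assms(3) p rn by simp
  qed
  show ?thesis
  proof
    assume "has_linear_resolution n (ideal_module n I) (ideal_homog n I) p"
    then obtain l where l: "lin_res n l p (vec_embed I)" using lin_res_if_linear_resolution by blast
    show "2 \<le> p \<and> p \<le> int r \<and> matroid_iso M (direct_sum (uniform_matroid (nat p) {1..n - r + nat p})
        (uniform_matroid (r - nat p) {n - r + nat p + 1..n}))"
    proof (cases "circuits M = {}")
      case True
      \<comment> \<open>The ideal is zero here and its resolution says nothing about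
        \<open>p\<close>, so the range of \<open>p\<close> comes from the last assumption. The
        matroid is free with \<open>r = n\<close>, and any set of \<open>p\<close> elements serves
        as \<open>N\<close>.\<close>
      then have p: "2 \<le> p" "p \<le> int r" using assms(7) by auto
      have indep: "X \<in> indeps M" if "X \<subseteq> {1..n}" for X
        using indep_iff_no_circuit[of X] True that assms(3) by simp
      then have "r = n" using rk_indep[of "{1..n}"] r by simp
      have "{1..nat p} \<subseteq> {1..n}" using p rn by auto
      moreover have "card (X \<inter> {1..nat p}) \<le> nat p" for X
        using card_mono[of "{1..nat p}" "X \<inter> {1..nat p}"] by simp
      ultimately show ?thesis
        unfolding iso[OF p] using p indep \<open>r = n\<close> by (intro conjI exI[of _ "{1..nat p}"]) auto
    next
      case False
      have "cycles_in_degree (ground M) (broken_circuit_complex M R) (nat p)"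
        using lin_res_cycles_in_degree[OF l[unfolded I]] assms(3) by simp
      moreover have "linear_order_on (ground M) R" using assms(3,4) by simp
      ultimately have "2 \<le> nat p \<and> (\<exists>N\<subseteq>ground M. card N + rk M (ground M) = card (ground M) + nat p \<and>
          (\<forall>X\<subseteq>ground M. X \<in> indeps M \<longleftrightarrow> card (X \<inter> N) \<le> nat p))"
        using uniform_plus_coloops[OF assms(2) _ False] by blast
      then obtain N where p2: "2 \<le> nat p" and N: "N \<subseteq> {1..n}" "card N + r = n + nat p"
        "\<forall>X\<subseteq>{1..n}. X \<in> indeps M \<longleftrightarrow> card (X \<inter> N) \<le> nat p"
        unfolding assms(3) r by auto
      have "card N \<le> n" using card_mono[OF _ N(1)] by simp
      \<comment> \<open>\<open>2 \<le> nat p\<close> excludes negative \<open>p\<close>, for which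
        \<open>nat p\<close> would be 0; and \<open>card N \<le> n\<close> turns the cardinality
        equation into \<open>p \<le> r\<close>.\<close>
      then have p: "2 \<le> p" "p \<le> int r" using N(2) p2 by auto
      have "card N = n - r + nat p" using N(2) rn by simp
      then show ?thesis unfolding iso[OF p] using p N(1,3) by blast
    qed
  next
    assume R: "2 \<le> p \<and> p \<le> int r \<and> matroid_iso M (direct_sum (uniform_matroid (nat p) {1..n - r + nat p})
        (uniform_matroid (r - nat p) {n - r + nat p + 1..n}))"
    then have p: "2 \<le> p" "p \<le> int r" by auto
    obtain N where N: "N \<subseteq> {1..n}" "\<And>X. X \<subseteq> {1..n} \<Longrightarrow> X \<in> indeps M \<longleftrightarrow> card (X \<inter> N) \<le> nat p"
      using R iso[OF p] by blast
    have I': "I = veronese n (N - {min_wrt R N}) (nat p)"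
      unfolding I using p by (intro broken_circuit_ideal_eq_veronese[OF M assms(3,4) _ N]) auto
    have V: "finite (N - {min_wrt R N})" "N - {min_wrt R N} \<subseteq> {1..n}"
      using N(1) finite_subset[OF N(1)] by auto
    obtain l where "lin_res n l (int (nat p)) (vec_embed I)"
      using lin_res_veronese[OF V, of "nat p"] unfolding I' by blast
    then show "has_linear_resolution n (ideal_module n I) (ideal_homog n I) p"
      using p by (intro linear_resolution_if_lin_res) simp
  qed
qed

end
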